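(* There is a function $f$ such that every instance of $P||C_{\max}$ with $n$ jobs, $m$ machines and integer processing times bounded by $p_{\max}$ can be solved optimally in time $f(p_{\max})\cdot(n+\log m)^{O(1)}$.
   Context: $P||C_{\max}$: given $m$ identical machines and a set $J$ of $n$ jobs, each job $j$ with positive integer processing time $p_j$ and released at time $0$, assign each job non-preemptively to a machine so as to minimize the makespan (maximum total processing time on a machine). $p_{\max}:=\max_j p_j$. *)

theory Defs
  imports Complex_Main
begin

definition valid_instance :: "nat \<Rightarrow> nat list \<Rightarrow> bool" where
  "valid_instance m p \<longleftrightarrow> m \<ge> 1 \<and> (\<forall>x\<in>set p. x > 0)"

definition valid_schedule :: "nat \<Rightarrow> nat list \<Rightarrow> (nat \<Rightarrow> nat) \<Rightarrow> bool" where
  "valid_schedule m p \<sigma> \<longleftrightarrow> (\<forall>j < length p. \<sigma> j < m)"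

definition load :: "nat list \<Rightarrow> (nat \<Rightarrow> nat) \<Rightarrow> nat \<Rightarrow> nat" where
  "load p \<sigma> i = (\<Sum>j\<in>{j. j < length p \<and> \<sigma> j = i}. p ! j)"

definition makespan :: "nat \<Rightarrow> nat list \<Rightarrow> (nat \<Rightarrow> nat) \<Rightarrow> nat" where
  "makespan m p \<sigma> = Max (load p \<sigma> ` {..<m})"

definition optimal_schedule :: "nat \<Rightarrow> nat list \<Rightarrow> (nat \<Rightarrow> nat) \<Rightarrow> bool" where
  "optimal_schedule m p \<sigma> \<longleftrightarrow> valid_schedule m p \<sigma> \<and>
     (\<forall>\<tau>. valid_schedule m p \<tau> \<longrightarrow> makespan m p \<sigma> \<le> makespan m p \<tau>)"

definition pmax :: "nat list \<Rightarrow> nat" where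
  "pmax p = Max (insert 0 (set p))"

text \<open>Tape symbols are naturals; 0 is the blank, 1 and 2 are the bits 0 and 1,
3 is a separator. States are naturals; 0 is the start state, 1 the halting state.
The transition maps (state, read symbol) to (new state, written symbol, head move),
with head move in {-1,0,1}.\<close>

record tm =
  tm_states :: nat
  tm_symbols :: nat
  tm_delta :: "nat \<Rightarrow> nat \<Rightarrow> nat \<times> nat \<times> int"

definition wf_tm :: "tm \<Rightarrow> bool" where
  "wf_tm M \<longleftrightarrow> tm_states M \<ge> 2 \<and> tm_symbols M \<ge> 4 \<and>
     (\<forall>q < tm_states M. \<forall>s < tm_symbols M.
        (case tm_delta M q s of (q', s', d) \<Rightarrow>
           q' < tm_states M \<and> s' < tm_symbols M \<and> d \<in> {-1, 0, 1}))"

type_synonym config = "nat \<times> (int \<Rightarrow> nat) \<times> int"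

definition tm_step :: "tm \<Rightarrow> config \<Rightarrow> config" where
  "tm_step M c = (case c of (q, tape, h) \<Rightarrow>
     if q = 1 then c
     else (case tm_delta M q (tape h) of (q', s', d) \<Rightarrow> (q', tape(h := s'), h + d)))"

definition tm_run :: "tm \<Rightarrow> nat \<Rightarrow> config \<Rightarrow> config" where
  "tm_run M t c = (tm_step M ^^ t) c"

definition initial_config :: "nat list \<Rightarrow> config" where
  "initial_config w = (0, (\<lambda>i. if 0 \<le> i \<and> i < int (length w) then w ! nat i else 0), 0)"

definition tape_output :: "(int \<Rightarrow> nat) \<Rightarrow> nat list \<Rightarrow> bool" where
  "tape_output tape w \<longleftrightarrow> (\<forall>i < length w. tape (int i) = w ! i) \<and> tape (int (length w)) = 0"

fun bin :: "nat \<Rightarrow> nat list" where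
  "bin n = (if n = 0 then [] else bin (n div 2) @ [n mod 2 + 1])"

definition encode_instance :: "nat \<Rightarrow> nat list \<Rightarrow> nat list" where
  "encode_instance m p = bin m @ concat (map (\<lambda>x. 3 # bin x) p)"

definition encode_schedule :: "nat \<Rightarrow> (nat \<Rightarrow> nat) \<Rightarrow> nat list" where
  "encode_schedule n \<sigma> = concat (map (\<lambda>j. bin (\<sigma> j) @ [3]) [0..<n])"

definition solves_within :: "tm \<Rightarrow> nat \<Rightarrow> nat list \<Rightarrow> nat \<Rightarrow> bool" where
  "solves_within M m p t \<longleftrightarrow>
     (case tm_run M t (initial_config (encode_instance m p)) of (q, tape, h) \<Rightarrow>
        q = 1 \<and> (\<exists>\<sigma>. optimal_schedule m p \<sigma> \<and> tape_output tape (encode_schedule (length p) \<sigma>)))"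

end

(* Moving b jobs of size a one way and a jobs of size b the other way between two machines changes
   no load, so some optimal schedule gives all machines nearly the same number of jobs of each size.
   There are then at most K = K(p_max) kinds of machines. Ordering the machines proportionally to
   their kinds, and the jobs proportionally to their sizes within each machine, gives a sequence in
   which each machine is an interval and, among the first k jobs, the number of jobs of size j exceeds
   k n_j / n by at most E = E(p_max). A search that appends one job at a time, either to the current
   machine or to a new one, and keeps to these windows sees at most (p_max E + 1)^p_max job multisets
   per step, hence few states (makespan, load, machine, remaining jobs).

   The search is written in a first-order language of functions on binary trees whose only loop is a
   fold over a list. Its running time is polynomial in the largest accumulator that occurs, so time
   analysis reduces to bounding sizes. The language is compiled to programs on a fixed number of
   stacks, which are the tracks of the tape of a one-tape machine. *)

theory Submission
  imports Defs "HOL-Library.Multiset" "HOL-Library.FuncSet"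
begin

section \<open>Compiling stack programs to Turing machines\<close>

text \<open>One fixed machine has to serve all values of \<open>p_max\<close>, so the window width
  is computed from the input as well, and \<open>p_max\<close> enters the running time only through
  sizes of accumulators. Numbers are kept in unary, which is affordable because all of them are
  bounded by a function of \<open>p_max\<close> times a polynomial in n + log m. The only exception
  is m, which is given in binary and may be exponentially large. It is cut off at the length of the
  input while it is parsed; this is harmless because the sequences needed for optimality consist of
  nonempty machines, at most n of them, and n is at most the input length. The windows bound the
  counts of a prefix from above only: the counts add up to the number of placed jobs, so lower
  bounds follow. Histories do not multiply the states, since every continuation depends on the key
  of a state alone and one history per key is enough. The histories record job sizes rather than
  jobs; the actual jobs are matched with them at the very end.\<close>

datatype scom =
    Push nat nat
  | Pop nat
  | Seq scom scom  (infixr ";;" 60)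
  | IfTop nat "nat set" scom scom
  | WhileTop nat "nat set" scom

type_synonym stacks = "nat \<Rightarrow> nat list"

text \<open>An empty stack reads as 0, the blank, so a test set without 0 also tests for
  nonemptiness.\<close>

definition top_sym :: "stacks \<Rightarrow> nat \<Rightarrow> nat" where
  "top_sym s i = (case s i of [] \<Rightarrow> 0 | a # _ \<Rightarrow> a)"

inductive bs :: "scom \<Rightarrow> stacks \<Rightarrow> nat \<Rightarrow> stacks \<Rightarrow> bool" where
  bs_Push: "bs (Push i a) s 1 (s(i := a # s i))"
| bs_Pop: "bs (Pop i) s 1 (s(i := tl (s i)))"
| bs_Seq: "bs c1 s t1 s1 \<Longrightarrow> bs c2 s1 t2 s2 \<Longrightarrow> bs (c1 ;; c2) s (t1 + t2) s2"
| bs_IfT: "top_sym s i \<in> A \<Longrightarrow> bs c1 s t s' \<Longrightarrow> bs (IfTop i A c1 c2) s (Suc t) s'"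
| bs_IfF: "top_sym s i \<notin> A \<Longrightarrow> bs c2 s t s' \<Longrightarrow> bs (IfTop i A c1 c2) s (Suc t) s'"
| bs_WhileF: "top_sym s i \<notin> A \<Longrightarrow> bs (WhileTop i A c) s 1 s"
| bs_WhileT: "top_sym s i \<in> A \<Longrightarrow> bs c s t1 s1 \<Longrightarrow> bs (WhileTop i A c) s1 t2 s2 \<Longrightarrow>
    bs (WhileTop i A c) s (Suc (t1 + t2)) s2"

fun wf_scom :: "nat \<Rightarrow> scom \<Rightarrow> bool" where
  "wf_scom k (Push i a) \<longleftrightarrow> i < k \<and> a \<in> {1, 2, 3}"
| "wf_scom k (Pop i) \<longleftrightarrow> i < k"
| "wf_scom k (c1 ;; c2) \<longleftrightarrow> wf_scom k c1 \<and> wf_scom k c2"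
| "wf_scom k (IfTop i A c1 c2) \<longleftrightarrow> i < k \<and> wf_scom k c1 \<and> wf_scom k c2"
| "wf_scom k (WhileTop i A c) \<longleftrightarrow> i < k \<and> wf_scom k c"

lemma wf_scom_mono: "wf_scom k c \<Longrightarrow> k \<le> k' \<Longrightarrow> wf_scom k' c"
  by (induction c) auto

definition wf_stacks :: "stacks \<Rightarrow> bool" where
  "wf_stacks s \<longleftrightarrow> (\<forall>i. set (s i) \<subseteq> {1, 2, 3})"

lemma wf_stacks_bs: "bs c s t s' \<Longrightarrow> wf_scom k c \<Longrightarrow> wf_stacks s \<Longrightarrow> wf_stacks s'"
proof (induction rule: bs.induct)
  case (bs_Pop i s)
  moreover have "set (tl (s i)) \<subseteq> set (s i)" by (cases "s i") auto
  ultimately show ?case unfolding wf_stacks_def by (metis fun_upd_apply subset_trans)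
qed (auto simp: wf_stacks_def)

text \<open>One unit of time pushes at most one symbol. So the running time bounds the heights as
  well, and with them the cost of scanning a track in the simulation.\<close>

lemma bs_height: "bs c s t s' \<Longrightarrow> length (s' i) \<le> length (s i) + t"
  by (induction rule: bs.induct) auto

section \<open>Base-4 digits: the tracks of a tape cell\<close>

definition dig :: "nat \<Rightarrow> nat \<Rightarrow> nat" where
  "dig i n = n div 4 ^ i mod 4"

definition set_dig :: "nat \<Rightarrow> nat \<Rightarrow> nat \<Rightarrow> nat" where
  "set_dig i a n = n mod 4 ^ i + (a + 4 * (n div 4 ^ Suc i)) * 4 ^ i"

lemma set_dig_div: "set_dig i a n div 4 ^ i = a + 4 * (n div 4 ^ Suc i)"
  unfolding set_dig_def by simp

lemma set_dig_mod: "set_dig i a n mod 4 ^ i = n mod 4 ^ i"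
  unfolding set_dig_def by simp

lemma dig_mod: "i < j \<Longrightarrow> dig i (n mod 4 ^ j) = dig i n"
proof -
  assume "i < j"
  then obtain d where "j = Suc i + d" using less_iff_Suc_add by auto
  then show ?thesis
    using mod_mult2_eq[of n "4 ^ i" "4 * 4 ^ d"] mod_mod_cancel[of 4 "4 * 4 ^ d" "n div 4 ^ i"]
    unfolding dig_def by (simp add: power_add mult.left_commute mult.assoc)
qed

lemma dig_set_dig:
  assumes "a < 4"
  shows "dig j (set_dig i a n) = (if j = i then a else dig j n)"
proof -
  consider "j = i" | "j < i" | d where "j = Suc i + d"
    by (metis add_Suc less_imp_Suc_add linorder_neqE_nat)
  then show ?thesis
  proof cases
    case 1
    then show ?thesis using assms by (simp add: dig_def set_dig_div)
  next
    case 2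
    then show ?thesis using dig_mod[of j i] set_dig_mod by (metis less_irrefl)
  next
    case 3
    have "set_dig i a n div 4 ^ Suc i = n div 4 ^ Suc i"
      using assms set_dig_div[of i a n] by (simp add: div_mult2_eq mult.commute[of 4])
    then show ?thesis using 3 by (simp add: dig_def power_add[of _ "Suc i"] div_mult2_eq[of _ "4 ^ Suc i"] del: power_Suc add_Suc)
  qed
qed

lemma set_dig_less:
  assumes "n < 4 ^ k" "i < k" "a < 4"
  shows "set_dig i a n < 4 ^ k"
proof -
  obtain d where k: "k = Suc i + d" using assms(2) less_iff_Suc_add by auto
  have "n div 4 ^ Suc i < 4 ^ d"
    using assms(1) unfolding k power_add by (simp add: less_mult_imp_div_less mult.commute del: power_Suc)
  then have "set_dig i a n div 4 ^ i < 4 * 4 ^ d"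
    using assms(3) set_dig_div by simp
  then have "set_dig i a n < 4 * 4 ^ d * 4 ^ i"
    by (metis div_less_iff_less_mult zero_less_numeral zero_less_power)
  then show ?thesis using k by (simp add: power_add ac_simps)
qed

lemma dig_marker: "i < k \<Longrightarrow> dig i (4 ^ k) = 0"
proof -
  assume "i < k"
  then obtain d where "k = i + Suc d" using less_iff_Suc_add by auto
  then show ?thesis by (simp add: dig_def power_add)
qed

text \<open>Popping an empty stack acts on the marker cell, which has to survive unchanged.\<close>

lemma set_dig_marker: "i < k \<Longrightarrow> set_dig i 0 (4 ^ k) = 4 ^ k"
proof -
  assume "i < k"
  then obtain d where "k = Suc i + d" using less_iff_Suc_add by auto
  then show ?thesis by (simp add: set_dig_def power_add)
qed

lemma dig_zero [simp]: "dig i 0 = 0"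
  by (simp add: dig_def)

lemma small_dig: "n < 4 \<Longrightarrow> dig i n = (if i = 0 then n else 0)"
  by (cases i) (auto simp: dig_def div_mult2_eq)

text \<open>Lets the final tape be read as plain symbols: once all stacks but 0 are empty, a cell
  equals its digit on track 0.\<close>

lemma eq_dig_0: "n < 4 ^ k \<Longrightarrow> (\<And>i. 0 < i \<Longrightarrow> i < k \<Longrightarrow> dig i n = 0) \<Longrightarrow> dig 0 n = n"
proof (induction k)
  case (Suc k)
  show ?case
  proof (cases "k = 0")
    case True
    then show ?thesis using Suc.prems by (simp add: dig_def)
  next
    case False
    have "n div 4 ^ k < 4" using Suc.prems(1) by (simp add: less_mult_imp_div_less)
    then have "n div 4 ^ k = 0" using Suc.prems(2)[of k] False by (simp add: dig_def)
    then show ?thesis using Suc by (simp add: div_eq_0_iff)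
  qed
qed (simp add: dig_def)

section \<open>Transition tables for stack programs\<close>

type_synonym entry = "nat \<Rightarrow> nat \<times> nat \<times> int"

text \<open>Goes left to the marker and steps back onto cell 0, where the code of every command
  starts and ends.\<close>

definition ret_entry :: "nat \<Rightarrow> nat \<Rightarrow> nat \<Rightarrow> entry" where
  "ret_entry k r e = (\<lambda>a. if a = 4 ^ k then (e, a, 1) else (r, a, -1))"

text \<open>Runs over the occupied cells of track \<open>i\<close> and steps back from the first
  free one: onto the top symbol or, for an empty stack, onto the marker.\<close>

definition scan_entry :: "nat \<Rightarrow> nat \<Rightarrow> entry" where
  "scan_entry i q = (\<lambda>a. if dig i a \<noteq> 0 then (q, a, 1) else (Suc q, a, -1))"

fun clen :: "scom \<Rightarrow> nat" where
  "clen (Push i a) = 2"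
| "clen (Pop i) = 3"
| "clen (c1 ;; c2) = clen c1 + clen c2"
| "clen (IfTop i A c1 c2) = 4 + clen c1 + clen c2"
| "clen (WhileTop i A c) = 4 + clen c"

text \<open>\<open>q\<close> is the first state of the block and \<open>e\<close> the state entered
  at its end; states are positions in the table. A branch has two return states because the outcome
  of the test must be remembered while the head travels back. The \<open>min\<close> keeps the
  written symbol inside the alphabet when the entry is applied to the marker, since
  \<open>wf_tm\<close> quantifies over all symbols.\<close>

fun tm_code :: "nat \<Rightarrow> scom \<Rightarrow> nat \<Rightarrow> nat \<Rightarrow> entry list" where
  "tm_code k (Push i v) q e =
     [\<lambda>a. if dig i a \<noteq> 0 then (q, a, 1) else (q + 1, min (4 ^ k) (set_dig i v a), 0),
      ret_entry k (q + 1) e]"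
| "tm_code k (Pop i) q e =
     [scan_entry i q, \<lambda>a. (q + 2, set_dig i 0 a, 0), ret_entry k (q + 2) e]"
| "tm_code k (c1 ;; c2) q e = tm_code k c1 q (q + clen c1) @ tm_code k c2 (q + clen c1) e"
| "tm_code k (IfTop i A c1 c2) q e =
     [scan_entry i q, \<lambda>a. (if dig i a \<in> A then q + 2 else q + 3, a, 0),
      ret_entry k (q + 2) (q + 4), ret_entry k (q + 3) (q + 4 + clen c1)]
      @ tm_code k c1 (q + 4) e @ tm_code k c2 (q + 4 + clen c1) e"
| "tm_code k (WhileTop i A c) q e =
     [scan_entry i q, \<lambda>a. (if dig i a \<in> A then q + 2 else q + 3, a, 0),
      ret_entry k (q + 2) (q + 4), ret_entry k (q + 3) e]
      @ tm_code k c (q + 4) q"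

lemma length_code [simp]: "length (tm_code k c q e) = clen c"
  by (induction c arbitrary: q e) auto

lemma clen_pos: "0 < clen c"
  by (induction c) auto

definition loaded :: "entry list \<Rightarrow> nat \<Rightarrow> entry list \<Rightarrow> bool" where
  "loaded tab q code \<longleftrightarrow> (\<exists>us vs. tab = us @ code @ vs \<and> length us = q)"

lemma loaded_append:
  "loaded tab q (xs @ ys) \<longleftrightarrow> loaded tab q xs \<and> loaded tab (q + length xs) ys"
proof
  assume "loaded tab q (xs @ ys)"
  then obtain us vs where "tab = us @ (xs @ ys) @ vs" "length us = q" unfolding loaded_def by blast
  then have "tab = us @ xs @ (ys @ vs)" "tab = (us @ xs) @ ys @ vs" by auto
  then show "loaded tab q xs \<and> loaded tab (q + length xs) ys"
    unfolding loaded_def using \<open>length us = q\<close> by (metis length_append)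
next
  assume *: "loaded tab q xs \<and> loaded tab (q + length xs) ys"
  then obtain us vs us' vs' where 1: "tab = us @ xs @ vs" "length us = q"
    and 2: "tab = us' @ ys @ vs'" "length us' = q + length xs" unfolding loaded_def by blast
  then have "us' = us @ xs" by (metis append.assoc append_eq_append_conv length_append)
  then show "loaded tab q (xs @ ys)" using 1 2 unfolding loaded_def by (metis append.assoc)
qed

lemma loaded_Cons:
  "loaded tab q (x # xs) \<longleftrightarrow> q < length tab \<and> tab ! q = x \<and> loaded tab (Suc q) xs"
proof -
  have "loaded tab q [x] \<longleftrightarrow> q < length tab \<and> tab ! q = x"
  proof
    assume "q < length tab \<and> tab ! q = x"
    then have "tab = take q tab @ [x] @ drop (Suc q) tab" "length (take q tab) = q"
      by (auto simp: id_take_nth_drop[of q tab, symmetric])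
    then show "loaded tab q [x]" unfolding loaded_def by blast
  qed (auto simp: loaded_def)
  then show ?thesis using loaded_append[of tab q "[x]" xs] by simp
qed

definition table_tm :: "nat \<Rightarrow> entry list \<Rightarrow> tm" where
  "table_tm k tab = \<lparr>tm_states = length tab, tm_symbols = 4 ^ k + 1,
     tm_delta = (\<lambda>q a. (tab ! q) a)\<rparr>"

text \<open>Stack \<open>i\<close> is stored bottom first as the \<open>i\<close>-th base-4 digit of the cells \<open>0, 1, \<dots>\<close>;
  cell \<open>-1\<close> carries the marker \<open>4 ^ k\<close>, which reads as blank on every track.\<close>

definition repr :: "nat \<Rightarrow> stacks \<Rightarrow> (int \<Rightarrow> nat) \<Rightarrow> bool" where
  "repr k s tape \<longleftrightarrow> tape (-1) = 4 ^ k \<and> (\<forall>x. tape (int x) < 4 ^ k \<and>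
     (\<forall>i<k. dig i (tape (int x)) = (if x < length (s i) then rev (s i) ! x else 0)))"

lemma tm_run_0 [simp]: "tm_run M 0 c = c"
  by (simp add: tm_run_def)

lemma tm_run_Suc: "tm_run M (Suc t) c = tm_run M t (tm_step M c)"
  by (simp add: tm_run_def funpow_Suc_right del: funpow.simps)

lemma tm_run_add: "tm_run M (t1 + t2) c = tm_run M t2 (tm_run M t1 c)"
  by (simp add: tm_run_def funpow_add add.commute[of t1])

lemma tm_run_snoc: "tm_run M (Suc t) c = tm_step M (tm_run M t c)"
  by (simp add: tm_run_def)

lemma table_step:
  "q \<noteq> 1 \<Longrightarrow> tm_step (table_tm k tab) (q, tape, h) =
     (case (tab ! q) (tape h) of (q', a, d) \<Rightarrow> (q', tape(h := a), h + d))"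
  by (simp add: tm_step_def table_tm_def)

text \<open>The position is written \<open>int x - 1\<close> so that \<open>x = 0\<close> is the
  case of a head already on the marker.\<close>

lemma ret_run:
  assumes "repr k s tape" "tab ! r = ret_entry k r e" "r \<noteq> 1"
  shows "tm_run (table_tm k tab) (Suc x) (r, tape, int x - 1) = (e, tape, 0)"
proof (induction x)
  case 0
  show ?case using assms by (simp add: tm_run_Suc table_step ret_entry_def repr_def fun_upd_idem)
next
  case (Suc x)
  have "tape (int x) \<noteq> 4 ^ k" using assms(1) unfolding repr_def by (metis less_irrefl)
  then have "tm_step (table_tm k tab) (r, tape, int (Suc x) - 1) = (r, tape, int x - 1)"
    using assms by (simp add: table_step ret_entry_def fun_upd_idem)
  then show ?case using Suc by (simp add: tm_run_Suc[of _ "Suc x"])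
qed

lemma repr_dig_nonzero:
  assumes "repr k s tape" "wf_stacks s" "i < k"
  shows "dig i (tape (int x)) \<noteq> 0 \<longleftrightarrow> x < length (s i)"
proof -
  have "x < length (s i) \<Longrightarrow> rev (s i) ! x \<in> {1, 2, 3}"
    using assms(2) nth_mem[of x "rev (s i)"] unfolding wf_stacks_def by auto
  then show ?thesis using assms unfolding repr_def by auto
qed

lemma scan_right:
  assumes "repr k s tape" "wf_stacks s" "i < k" "q \<noteq> 1"
    and ent: "\<And>a. dig i a \<noteq> 0 \<Longrightarrow> (tab ! q) a = (q, a, 1)"
  shows "x \<le> length (s i) \<Longrightarrow> tm_run (table_tm k tab) x (q, tape, 0) = (q, tape, int x)"
proof (induction x)
  case (Suc x)
  have "dig i (tape (int x)) \<noteq> 0" using repr_dig_nonzero[OF assms(1-3)] Suc.prems by simp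
  then have "tm_step (table_tm k tab) (q, tape, int x) = (q, tape, int (Suc x))"
    using ent assms(4) by (simp add: table_step fun_upd_idem)
  then show ?case using Suc by (simp add: tm_run_snoc)
qed simp

lemma scan_run:
  assumes "repr k s tape" "wf_stacks s" "i < k" "q \<noteq> 1" "tab ! q = scan_entry i q"
  shows "tm_run (table_tm k tab) (Suc (length (s i))) (q, tape, 0) =
    (Suc q, tape, int (length (s i)) - 1)"
proof -
  have "tm_run (table_tm k tab) (length (s i)) (q, tape, 0) = (q, tape, int (length (s i)))"
    by (rule scan_right[OF assms(1-4)]) (auto simp: assms(5) scan_entry_def)
  moreover have "dig i (tape (int (length (s i)))) = 0"
    using repr_dig_nonzero[OF assms(1-3)] by blast
  ultimately show ?thesis
    using assms(4,5) by (simp add: tm_run_snoc table_step scan_entry_def fun_upd_idem)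
qed

text \<open>For an empty stack the inspected cell is the marker, whose digits below \<open>k\<close>
  are 0, in agreement with \<open>top_sym\<close>.\<close>

lemma dig_top:
  assumes "repr k s tape" "i < k"
  shows "dig i (tape (int (length (s i)) - 1)) = top_sym s i"
proof (cases "s i")
  case Nil
  then show ?thesis using assms by (simp add: repr_def top_sym_def dig_marker)
next
  case (Cons a xs)
  have "dig i (tape (int (length xs))) = rev (s i) ! length xs"
    using assms Cons unfolding repr_def by simp
  then show ?thesis using Cons by (simp add: top_sym_def nth_append)
qed

lemma repr_push:
  assumes "repr k s tape" "i < k" "a \<in> {1, 2, 3}"
  shows "repr k (s(i := a # s i))
    (tape(int (length (s i)) := set_dig i a (tape (int (length (s i))))))"
  using assms unfolding repr_def
  by (auto simp: dig_set_dig set_dig_less nth_append)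

lemma repr_pop:
  assumes "repr k s tape" "i < k"
  shows "repr k (s(i := tl (s i)))
    (tape(int (length (s i)) - 1 := set_dig i 0 (tape (int (length (s i)) - 1))))"
proof (cases "s i")
  case Nil
  then show ?thesis using assms unfolding repr_def
    by (auto simp: set_dig_marker fun_upd_idem)
next
  case (Cons a xs)
  then show ?thesis using assms unfolding repr_def
    by (auto simp: dig_set_dig set_dig_less nth_append)
qed

lemma branch_run:
  assumes "repr k s tape" "wf_stacks s" "i < k" "q \<ge> 2"
    and "tab ! q = scan_entry i q"
    and "tab ! Suc q = (\<lambda>a. (if dig i a \<in> A then q + 2 else q + 3, a, 0))"
    and "tab ! (q + 2) = ret_entry k (q + 2) e1" "tab ! (q + 3) = ret_entry k (q + 3) e2"
  shows "tm_run (table_tm k tab) (2 * length (s i) + 3) (q, tape, 0) =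
    (if top_sym s i \<in> A then e1 else e2, tape, 0)"
proof -
  let ?M = "table_tm k tab" and ?n = "length (s i)"
  have *: "2 * ?n + 3 = Suc (Suc ?n) + Suc ?n" by simp
  have 1: "tm_run ?M (Suc (Suc ?n)) (q, tape, 0) =
      (if top_sym s i \<in> A then q + 2 else q + 3, tape, int ?n - 1)"
    using scan_run[OF assms(1-3) _ assms(5)] assms(4,6) dig_top[OF assms(1,3)]
    by (simp add: tm_run_snoc[of _ "Suc ?n"] table_step fun_upd_idem)
  show ?thesis
    unfolding * tm_run_add[of _ "Suc (Suc ?n)"] 1
    using ret_run[OF assms(1), of tab "q + 2" e1 ?n] ret_run[OF assms(1), of tab "q + 3" e2 ?n]
      assms(4,7,8) by simp
qed

text \<open>Each unit of time costs one scan to the top of a stack and one way back, plus a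
  constant, hence the factor \<open>2 * H + 6\<close>. The premise bounds height plus remaining time
  by \<open>H\<close>; by \<open>bs_height\<close> it is preserved while the run proceeds.\<close>

lemma code_correct:
  assumes "bs c s t s'"
  shows "wf_scom k c \<Longrightarrow> wf_stacks s \<Longrightarrow> repr k s tape \<Longrightarrow> 2 \<le> q \<Longrightarrow>
    loaded tab q (tm_code k c q e) \<Longrightarrow> \<forall>i<k. length (s i) + t \<le> H \<Longrightarrow>
    \<exists>t' tape'. t' \<le> t * (2 * H + 6) \<and> repr k s' tape' \<and>
      tm_run (table_tm k tab) t' (q, tape, 0) = (e, tape', 0)"
  using assms
proof (induction arbitrary: tape q e rule: bs.induct)
  case (bs_Push i a s)
  let ?M = "table_tm k tab" and ?n = "length (s i)"
  let ?tape = "tape(int ?n := set_dig i a (tape (int ?n)))"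
  note ik = bs_Push.prems(1)[simplified, THEN conjunct1]
  have 1: "tm_run ?M ?n (q, tape, 0) = (q, tape, int ?n)"
    by (rule scan_right[OF bs_Push.prems(3,2) ik])
      (use bs_Push.prems in \<open>auto simp: loaded_Cons\<close>)
  have "dig i (tape (int ?n)) = 0"
    using repr_dig_nonzero[OF bs_Push.prems(3,2) ik] by blast
  moreover have "set_dig i a (tape (int ?n)) < 4 ^ k"
    using bs_Push.prems(1,3) by (auto intro!: set_dig_less simp: repr_def)
  ultimately have 2: "tm_run ?M (Suc ?n) (q, tape, 0) = (q + 1, ?tape, int (Suc ?n) - 1)"
    using bs_Push.prems(4,5) 1 by (simp add: tm_run_snoc table_step loaded_Cons min_absorb2)
  have r: "repr k (s(i := a # s i)) ?tape"
    using repr_push[OF bs_Push.prems(3)] bs_Push.prems by simp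
  have "tm_run ?M (Suc ?n + Suc (Suc ?n)) (q, tape, 0) = (e, ?tape, 0)"
    unfolding tm_run_add[of _ "Suc ?n"] 2
    by (rule ret_run[OF r]) (use bs_Push.prems in \<open>auto simp: loaded_Cons\<close>)
  moreover have "Suc ?n + Suc (Suc ?n) \<le> 1 * (2 * H + 6)"
    using bs_Push.prems(6) ik by auto
  ultimately show ?case using r by blast
next
  case (bs_Pop i s)
  let ?M = "table_tm k tab" and ?n = "length (s i)"
  let ?tape = "tape(int ?n - 1 := set_dig i 0 (tape (int ?n - 1)))"
  note ik = bs_Pop.prems(1)[simplified]
  have 1: "tm_run ?M (Suc ?n) (q, tape, 0) = (Suc q, tape, int ?n - 1)"
    by (rule scan_run[OF bs_Pop.prems(3,2) ik])
      (use bs_Pop.prems in \<open>auto simp: loaded_Cons\<close>)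
  have 2: "tm_run ?M (Suc (Suc ?n)) (q, tape, 0) = (q + 2, ?tape, int ?n - 1)"
    unfolding tm_run_snoc[of _ "Suc ?n"] 1
    using bs_Pop.prems(4,5) by (simp add: table_step loaded_Cons)
  have r: "repr k (s(i := tl (s i))) ?tape"
    using repr_pop[OF bs_Pop.prems(3)] bs_Pop.prems by simp
  have "tm_run ?M (Suc (Suc ?n) + Suc ?n) (q, tape, 0) = (e, ?tape, 0)"
    unfolding tm_run_add[of _ "Suc (Suc ?n)"] 2
    by (rule ret_run[OF r]) (use bs_Pop.prems in \<open>auto simp: loaded_Cons numeral_2_eq_2\<close>)
  moreover have "Suc (Suc ?n) + Suc ?n \<le> 1 * (2 * H + 6)"
    using bs_Pop.prems(6) ik by auto
  ultimately show ?case using r by blast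
next
  case (bs_Seq c1 s t1 s1 c2 t2 s2)
  have l: "loaded tab q (tm_code k c1 q (q + clen c1))"
    "loaded tab (q + clen c1) (tm_code k c2 (q + clen c1) e)"
    using bs_Seq.prems(5) by (auto simp: loaded_append)
  obtain t' tape' where 1: "t' \<le> t1 * (2 * H + 6)" "repr k s1 tape'"
    "tm_run (table_tm k tab) t' (q, tape, 0) = (q + clen c1, tape', 0)"
    using bs_Seq.IH(1)[OF _ bs_Seq.prems(2-4) l(1)] bs_Seq.prems(1,6) by fastforce
  have "\<forall>i<k. length (s1 i) + t2 \<le> H"
    using bs_height[OF bs_Seq.hyps(1)] bs_Seq.prems(6)
    by (metis (no_types, opaque_lifting) add.assoc add_le_mono1 le_trans)
  then obtain t'' tape'' where 2: "t'' \<le> t2 * (2 * H + 6)" "repr k s2 tape''"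
    "tm_run (table_tm k tab) t'' (q + clen c1, tape', 0) = (e, tape'', 0)"
    using bs_Seq.IH(2)[OF _ wf_stacks_bs[OF bs_Seq.hyps(1)] 1(2) _ l(2)] bs_Seq.prems by fastforce
  show ?case
    by (rule exI[of _ "t' + t''"], rule exI[of _ tape''])
      (use 1 2 in \<open>simp add: tm_run_add add_mult_distrib\<close>)
next
  case (bs_IfT s i A c1 t s' c2)
  have l: "loaded tab (q + 4) (tm_code k c1 (q + 4) e)"
    using bs_IfT.prems(5) by (auto simp: loaded_append loaded_Cons eval_nat_numeral)
  have 1: "tm_run (table_tm k tab) (2 * length (s i) + 3) (q, tape, 0) = (q + 4, tape, 0)"
    using branch_run[OF bs_IfT.prems(3,2) _ bs_IfT.prems(4), of i tab A "q+4" "q + 4 + clen c1"]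
      bs_IfT.prems(1,5) bs_IfT.hyps(1) by (auto simp: loaded_Cons eval_nat_numeral)
  obtain t' tape' where 2: "t' \<le> t * (2 * H + 6)" "repr k s' tape'"
    "tm_run (table_tm k tab) t' (q + 4, tape, 0) = (e, tape', 0)"
    using bs_IfT.IH[OF _ bs_IfT.prems(2,3) _ l] bs_IfT.prems(1,6) by fastforce
  have "length (s i) \<le> H" using bs_IfT.prems(1,6) by fastforce
  then show ?case
    by (intro exI[of _ "(2 * length (s i) + 3) + t'"] exI[of _ tape'])
      (use 1 2 in \<open>simp add: tm_run_add[of _ "2 * length (s i) + 3"]\<close>)
next
  case (bs_IfF s i A c2 t s' c1)
  have l: "loaded tab (q + 4 + clen c1) (tm_code k c2 (q + 4 + clen c1) e)"
    using bs_IfF.prems(5) by (auto simp: loaded_append loaded_Cons eval_nat_numeral)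
  have 1: "tm_run (table_tm k tab) (2 * length (s i) + 3) (q, tape, 0) = (q + 4 + clen c1, tape, 0)"
    using branch_run[OF bs_IfF.prems(3,2) _ bs_IfF.prems(4), of i tab A "q+4" "q + 4 + clen c1"]
      bs_IfF.prems(1,5) bs_IfF.hyps(1) by (auto simp: loaded_Cons eval_nat_numeral)
  obtain t' tape' where 2: "t' \<le> t * (2 * H + 6)" "repr k s' tape'"
    "tm_run (table_tm k tab) t' (q + 4 + clen c1, tape, 0) = (e, tape', 0)"
    using bs_IfF.IH[OF _ bs_IfF.prems(2,3) _ l] bs_IfF.prems(1,4,6) by fastforce
  have "length (s i) \<le> H" using bs_IfF.prems(1,6) by fastforce
  then show ?case
    by (intro exI[of _ "(2 * length (s i) + 3) + t'"] exI[of _ tape'])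
      (use 1 2 in \<open>simp add: tm_run_add[of _ "2 * length (s i) + 3"]\<close>)
next
  case (bs_WhileF s i A c)
  have 1: "tm_run (table_tm k tab) (2 * length (s i) + 3) (q, tape, 0) = (e, tape, 0)"
    using branch_run[OF bs_WhileF.prems(3,2) _ bs_WhileF.prems(4), of i tab A "q+4" e]
      bs_WhileF.prems(1,5) bs_WhileF.hyps(1) by (auto simp: loaded_Cons eval_nat_numeral)
  have "length (s i) \<le> H" using bs_WhileF.prems(1,6) by fastforce
  then show ?case using 1 bs_WhileF.prems(3)
    by (intro exI[of _ "2 * length (s i) + 3"] exI[of _ tape]) simp
next
  case (bs_WhileT s i A c t1 s1 t2 s2)
  have l: "loaded tab (q + 4) (tm_code k c (q + 4) q)"
    using bs_WhileT.prems(5) by (auto simp: loaded_append loaded_Cons eval_nat_numeral)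
  have 1: "tm_run (table_tm k tab) (2 * length (s i) + 3) (q, tape, 0) = (q + 4, tape, 0)"
    using branch_run[OF bs_WhileT.prems(3,2) _ bs_WhileT.prems(4), of i tab A "q+4" e]
      bs_WhileT.prems(1,5) bs_WhileT.hyps(1) by (auto simp: loaded_Cons eval_nat_numeral)
  obtain t' tape' where 2: "t' \<le> t1 * (2 * H + 6)" "repr k s1 tape'"
    "tm_run (table_tm k tab) t' (q + 4, tape, 0) = (q, tape', 0)"
    using bs_WhileT.IH(1)[OF _ bs_WhileT.prems(2,3) _ l] bs_WhileT.prems(1,6) by fastforce
  have "\<forall>i<k. length (s1 i) + t2 \<le> H"
  proof (intro allI impI)
    fix j assume "j < k"
    then show "length (s1 j) + t2 \<le> H"
      using bs_height[OF bs_WhileT.hyps(2), of j] bs_WhileT.prems(6)[rule_format, of j] by linarith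
  qed
  then obtain t'' tape'' where 3: "t'' \<le> t2 * (2 * H + 6)" "repr k s2 tape''"
    "tm_run (table_tm k tab) t'' (q, tape', 0) = (e, tape'', 0)"
    using bs_WhileT.IH(2)[OF bs_WhileT.prems(1) wf_stacks_bs[OF bs_WhileT.hyps(2)] 2(2)
      bs_WhileT.prems(4,5)] bs_WhileT.prems(1,2) by fastforce
  have "length (s i) \<le> H" using bs_WhileT.prems(1,6) by fastforce
  then show ?case
    by (intro exI[of _ "(2 * length (s i) + 3) + t' + t''"] exI[of _ tape''])
      (use 1 2 3 in \<open>simp add: tm_run_add[of _ "2 * length (s i) + 3 + t'"]
         tm_run_add[of _ "2 * length (s i) + 3"] add_mult_distrib\<close>)
qed

definition wf_entry :: "nat \<Rightarrow> nat \<Rightarrow> entry \<Rightarrow> bool" where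
  "wf_entry k N en \<longleftrightarrow> (\<forall>a < 4 ^ k + 1. case en a of (q', s', d) \<Rightarrow>
     q' < N \<and> s' < 4 ^ k + 1 \<and> d \<in> {-1, 0, 1})"

lemma code_wf:
  "wf_scom k c \<Longrightarrow> q + clen c \<le> N \<Longrightarrow> e < N \<Longrightarrow> en \<in> set (tm_code k c q e) \<Longrightarrow> wf_entry k N en"
proof (induction c arbitrary: q e)
  case (Pop i)
  then show ?case
    using set_dig_marker[of i k] set_dig_less[of _ k i 0]
    by (auto simp: wf_entry_def scan_entry_def ret_entry_def less_Suc_eq split: if_splits)
next
  case (Seq c1 c2)
  have "q + clen c1 < N" using Seq.prems(2) clen_pos[of c2] by simp
  moreover have "en \<in> set (tm_code k c1 q (q + clen c1)) \<or> en \<in> set (tm_code k c2 (q + clen c1) e)"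
    using Seq.prems(4) by simp
  ultimately show ?case
    using Seq.IH(1)[of q "q + clen c1"] Seq.IH(2)[of "q + clen c1" e] Seq.prems(1-3) by fastforce
next
  case (IfTop i A c1 c2)
  have lt: "q + 4 < N" "q + 4 + clen c1 < N" using IfTop.prems(2) clen_pos[of c1] clen_pos[of c2] by auto
  consider "en \<in> set (tm_code k c1 (q + 4) e)" | "en \<in> set (tm_code k c2 (q + 4 + clen c1) e)"
    | "en = scan_entry i q" | "en = (\<lambda>a. (if dig i a \<in> A then q + 2 else q + 3, a, 0))"
    | "en = ret_entry k (q + 2) (q + 4)" | "en = ret_entry k (q + 3) (q + 4 + clen c1)"
    using IfTop.prems(4) by auto
  then show ?case
  proof cases
    case 1
    then show ?thesis using IfTop.IH(1)[of "q + 4" e] IfTop.prems(1-3) by simp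
  next
    case 2
    then show ?thesis using IfTop.IH(2)[of "q + 4 + clen c1" e] IfTop.prems(1-3) by simp
  qed (use lt in \<open>auto simp: wf_entry_def scan_entry_def ret_entry_def\<close>)
next
  case (WhileTop i A c)
  have lt: "q + 4 < N" using WhileTop.prems(2) clen_pos[of c] by auto
  consider "en \<in> set (tm_code k c (q + 4) q)"
    | "en = scan_entry i q" | "en = (\<lambda>a. (if dig i a \<in> A then q + 2 else q + 3, a, 0))"
    | "en = ret_entry k (q + 2) (q + 4)" | "en = ret_entry k (q + 3) e"
    using WhileTop.prems(4) by auto
  then show ?case
  proof cases
    case 1
    then show ?thesis using WhileTop.IH[of "q + 4" q] WhileTop.prems(1,2) lt by simp
  qed (use lt WhileTop.prems(3) in \<open>auto simp: wf_entry_def scan_entry_def ret_entry_def\<close>)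
next
  case (Push i v)
  then have "en = (\<lambda>a. if dig i a \<noteq> 0 then (q, a, 1) else (q + 1, min (4 ^ k) (set_dig i v a), 0)) \<or>
      en = ret_entry k (q + 1) e" by simp
  then show ?case
    using Push.prems(2,3) by (auto simp: wf_entry_def ret_entry_def less_Suc_eq_le split: if_splits)
qed

text \<open>State 0 moves from cell 0 to cell -1, state 2 writes the marker there and returns, state
  1 is the halting state, and the code proper starts at state 3.\<close>

definition scom_tm :: "nat \<Rightarrow> scom \<Rightarrow> tm" where
  "scom_tm k c = table_tm k ([\<lambda>a. (2, a, -1), \<lambda>a. (1, a, 0), \<lambda>a. (3, 4 ^ k, 1)] @ tm_code k c 3 1)"

lemma wf_scom_tm:
  assumes "wf_scom k c" "1 \<le> k"
  shows "wf_tm (scom_tm k c)"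
proof -
  let ?tab = "[\<lambda>a. (2, a, -1), \<lambda>a. (1, a, 0), \<lambda>a. (3, 4 ^ k, 1)] @ tm_code k c 3 1"
  have pos: "0 < clen c" by (rule clen_pos)
  have "\<forall>en \<in> set (tm_code k c 3 1). wf_entry k (length ?tab) en"
    using code_wf[OF assms(1), of 3 "length ?tab" 1] by simp
  moreover have "wf_entry k (length ?tab) (\<lambda>a. (2, a, -1))"
    "wf_entry k (length ?tab) (\<lambda>a. (1, a, 0))" "wf_entry k (length ?tab) (\<lambda>a. (3, 4 ^ k, 1))"
    using pos by (auto simp: wf_entry_def)
  ultimately have "\<forall>en \<in> set ?tab. wf_entry k (length ?tab) en" by simp
  then have "wf_entry k (length ?tab) (?tab ! q)" if "q < length ?tab" for q
    using that nth_mem by blast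
  moreover have "(4::nat) ^ 1 \<le> 4 ^ k" using assms(2) by (intro power_increasing) auto
  ultimately show ?thesis
    using pos unfolding wf_tm_def scom_tm_def table_tm_def wf_entry_def
    by (simp del: append_Cons append.simps)
qed

text \<open>The symbols 1, 2, 3 are their own encodings on track 0. So the input already represents
  stack 0 with the last symbol on top, whence \<open>rev w\<close>, and the output is read back in
  the same way.\<close>

lemma scom_tm_run:
  assumes "wf_scom k c" "1 \<le> k" "set w \<subseteq> {1, 2, 3}"
    and bs: "bs c ((\<lambda>_. [])(0 := rev w)) t ((\<lambda>_. [])(0 := rev v))"
  shows "\<exists>t' tape h. t' \<le> (t + 1) * (2 * (length w + t) + 6) \<and>
    tm_run (scom_tm k c) t' (initial_config w) = (1, tape, h) \<and> tape_output tape v"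
proof -
  let ?s = "(\<lambda>_. [])(0 := rev w)" and ?s' = "(\<lambda>_. [])(0 := rev v)"
  let ?tab = "[\<lambda>a. (2, a, -1), \<lambda>a. (1, a, 0), \<lambda>a. (3, 4 ^ k, 1)] @ tm_code k c 3 1"
  define tape0 where "tape0 = (\<lambda>i. if 0 \<le> i \<and> i < int (length w) then w ! nat i else 0)"
  define tape1 where "tape1 = tape0(-1 := 4 ^ k)"
  have k4: "(4::nat) \<le> 4 ^ k" using power_increasing[of 1 k "4::nat"] assms(2) by simp
  have w_sym: "x < length w \<Longrightarrow> w ! x < 4" for x
    using assms(3) nth_mem[of x w] by fastforce
  have start: "tm_run (scom_tm k c) 2 (initial_config w) = (3, tape1, 0)"
    unfolding numeral_2_eq_2 scom_tm_def initial_config_def tape0_def[symmetric]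
    by (simp add: tm_run_Suc table_step tape1_def fun_upd_idem)
  have r: "repr k ?s tape1"
    unfolding repr_def tape1_def tape0_def
    using k4 w_sym by (auto simp: small_dig intro: less_le_trans)
  have wfs: "wf_stacks ?s" using assms(3) by (auto simp: wf_stacks_def)
  have ld: "loaded ?tab 3 (tm_code k c 3 1)"
    unfolding loaded_def by (intro exI[of _ "take 3 ?tab"] exI[of _ "[]"]) simp
  have H: "\<forall>i<k. length (?s i) + t \<le> length w + t" and three: "(2::nat) \<le> 3" by auto
  obtain t' tape' where 1: "t' \<le> t * (2 * (length w + t) + 6)" "repr k ?s' tape'"
    "tm_run (table_tm k ?tab) t' (3, tape1, 0) = (1, tape', 0)"
    using code_correct[OF bs assms(1) wfs r three ld H] by blast
  have v_sym: "set v \<subseteq> {1, 2, 3}"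
    using wf_stacks_bs[OF bs assms(1) wfs] unfolding wf_stacks_def by (metis fun_upd_same set_rev)
  have cell: "tape' (int x) = (if x < length v then v ! x else 0)" for x
  proof -
    have "tape' (int x) < 4 ^ k" "\<forall>i<k. dig i (tape' (int x)) =
        (if x < length (?s' i) then rev (?s' i) ! x else 0)"
      using 1(2) unfolding repr_def by blast+
    then show ?thesis using eq_dig_0[of "tape' (int x)" k] assms(2)
      by (metis (no_types, lifting) fun_upd_apply length_rev less_nat_zero_code list.size(3)
          neq0_conv rev_rev_ident not_one_le_zero)
  qed
  have "tm_run (scom_tm k c) (2 + t') (initial_config w) = (1, tape', 0)"
    unfolding tm_run_add start using 1(3) by (simp add: scom_tm_def)
  moreover have "2 + t' \<le> (t + 1) * (2 * (length w + t) + 6)" using 1(1) by simp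
  moreover have "tape_output tape' v" unfolding tape_output_def using cell by simp
  ultimately show ?thesis by blast
qed

section \<open>Timed routines for single stacks\<close>

definition runs :: "scom \<Rightarrow> stacks \<Rightarrow> nat \<Rightarrow> stacks \<Rightarrow> bool" where
  "runs c s t s' \<longleftrightarrow> (\<exists>t'\<le>t. bs c s t' s')"

lemma runs_le: "runs c s t s' \<Longrightarrow> t \<le> t' \<Longrightarrow> runs c s t' s'"
  unfolding runs_def using le_trans by blast

lemma runs_Push: "s' = s(i := a # s i) \<Longrightarrow> 1 \<le> t \<Longrightarrow> runs (Push i a) s t s'"
  unfolding runs_def using bs_Push by blast

lemma runs_Pop: "s' = s(i := tl (s i)) \<Longrightarrow> 1 \<le> t \<Longrightarrow> runs (Pop i) s t s'"
  unfolding runs_def using bs_Pop by blast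

lemma runs_Seq: "runs c1 s t1 s1 \<Longrightarrow> runs c2 s1 t2 s2 \<Longrightarrow> runs (c1 ;; c2) s (t1 + t2) s2"
  unfolding runs_def using bs_Seq by (metis add_mono)

lemma runs_IfT: "top_sym s i \<in> A \<Longrightarrow> runs c1 s t s' \<Longrightarrow> runs (IfTop i A c1 c2) s (Suc t) s'"
  unfolding runs_def using bs_IfT by (metis Suc_le_mono)

lemma runs_IfF: "top_sym s i \<notin> A \<Longrightarrow> runs c2 s t s' \<Longrightarrow> runs (IfTop i A c1 c2) s (Suc t) s'"
  unfolding runs_def using bs_IfF by (metis Suc_le_mono)

lemma runs_WhileF: "top_sym s i \<notin> A \<Longrightarrow> runs (WhileTop i A c) s 1 s"
  unfolding runs_def using bs_WhileF by blast

lemma runs_WhileT: "top_sym s i \<in> A \<Longrightarrow> runs c s t1 s1 \<Longrightarrow> runs (WhileTop i A c) s1 t2 s2 \<Longrightarrow>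
    runs (WhileTop i A c) s (Suc (t1 + t2)) s2"
  unfolding runs_def using bs_WhileT by (metis Suc_le_mono add_mono)

lemma top_sym_simps [simp]:
  "s i = [] \<Longrightarrow> top_sym s i = 0" "s i = a # xs \<Longrightarrow> top_sym s i = a"
  by (simp_all add: top_sym_def)

text \<open>A loop whose test set is empty is never entered and serves as the missing
  no-operation.\<close>

definition skip_cmd :: "nat \<Rightarrow> scom" where "skip_cmd i = WhileTop i {} (Pop i)"

lemma runs_skip: "runs (skip_cmd i) s 1 s"
  unfolding skip_cmd_def by (rule runs_WhileF) simp

definition clear :: "nat \<Rightarrow> scom" where "clear i = WhileTop i {1, 2, 3} (Pop i)"

lemma runs_clear:
  assumes "set (s i) \<subseteq> {1, 2, 3}"
  shows "runs (clear i) s (2 * length (s i) + 1) (s(i := []))"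
  using assms
proof (induction "s i" arbitrary: s)
  case Nil
  then show ?case using runs_WhileF[of s i "{1,2,3}" "Pop i"]
    by (simp add: clear_def fun_upd_idem)
next
  case (Cons a xs)
  note si = Cons.hyps(2)[symmetric]
  have "set xs \<subseteq> {1, 2, 3}" using Cons.prems unfolding si by simp
  then have "runs (clear i) (s(i := xs)) (2 * length xs + 1) (s(i := []))"
    using Cons.hyps(1)[of "s(i := xs)"] by simp
  moreover have "runs (Pop i) s 1 (s(i := xs))"
    using si by (intro runs_Pop) auto
  ultimately have "runs (clear i) s (Suc (1 + (2 * length xs + 1))) (s(i := []))"
    unfolding clear_def using si Cons.prems by (intro runs_WhileT) auto
  then show ?case by (rule runs_le) (simp flip: Cons.hyps(2))
qed

definition move_rev :: "nat \<Rightarrow> nat \<Rightarrow> scom" where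
  "move_rev i j = WhileTop i {1, 2} (IfTop i {1} (Pop i ;; Push j 1) (Pop i ;; Push j 2))"

lemma runs_move:
  assumes "set (s i) \<subseteq> {1, 2}" "i \<noteq> j"
  shows "runs (move_rev i j) s (4 * length (s i) + 1) (s(i := [], j := rev (s i) @ s j))"
  using assms
proof (induction "s i" arbitrary: s)
  case Nil
  then have "runs (move_rev i j) s 1 s" unfolding move_rev_def by (intro runs_WhileF) simp
  then show ?case by (simp flip: Nil.hyps add: fun_upd_idem)
next
  case (Cons a xs)
  note si = Cons.hyps(2)[symmetric]
  have xs: "set xs \<subseteq> {1, 2}" using Cons.prems unfolding si by simp
  let ?s = "s(i := xs, j := a # s j)"
  have "runs (move_rev i j) ?s (4 * length xs + 1) (?s(i := [], j := rev xs @ a # s j))"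
    using Cons.hyps(1)[of ?s] xs Cons.prems(2-) by simp
  moreover have "?s(i := [], j := rev xs @ a # s j) = s(i := [], j := rev (s i) @ s j)"
    using Cons.prems by (auto simp: fun_eq_iff simp flip: Cons.hyps(2))
  moreover have "runs (IfTop i {1} (Pop i ;; Push j 1) (Pop i ;; Push j 2)) s (Suc (1 + 1)) ?s"
  proof (cases "a = 1")
    case True
    then show ?thesis using Cons.hyps(2)[symmetric] Cons.prems(2)
      by (intro runs_IfT runs_Seq[OF runs_Pop[OF refl] runs_Push]) auto
  next
    case False
    then show ?thesis using Cons.hyps(2)[symmetric] Cons.prems
      by (intro runs_IfF runs_Seq[OF runs_Pop[OF refl] runs_Push]) auto
  qed
  ultimately have "runs (move_rev i j) s (Suc (Suc (1 + 1) + (4 * length xs + 1))) (s(i := [], j := rev (s i) @ s j))"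
    unfolding move_rev_def using Cons.hyps(2)[symmetric] Cons.prems by (intro runs_WhileT) auto
  then show ?case by (rule runs_le) (simp flip: Cons.hyps(2))
qed

definition move_rev2 :: "nat \<Rightarrow> nat \<Rightarrow> nat \<Rightarrow> scom" where
  "move_rev2 i j k = WhileTop i {1, 2} (IfTop i {1} (Pop i ;; Push j 1 ;; Push k 1) (Pop i ;; Push j 2 ;; Push k 2))"

lemma runs_move2:
  assumes "set (s i) \<subseteq> {1, 2}" "i \<noteq> j" "i \<noteq> k" "j \<noteq> k"
  shows "runs (move_rev2 i j k) s (5 * length (s i) + 1)
    (s(i := [], j := rev (s i) @ s j, k := rev (s i) @ s k))"
  using assms
proof (induction "s i" arbitrary: s)
  case Nil
  then have "runs (move_rev2 i j k) s 1 s" unfolding move_rev2_def by (intro runs_WhileF) simp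
  then show ?case by (simp flip: Nil.hyps add: fun_upd_idem)
next
  case (Cons a xs)
  note si = Cons.hyps(2)[symmetric]
  have xs: "set xs \<subseteq> {1, 2}" using Cons.prems unfolding si by simp
  let ?s = "s(i := xs, j := a # s j, k := a # s k)"
  let ?f = "?s(i := [], j := rev xs @ a # s j, k := rev xs @ a # s k)"
  have "runs (move_rev2 i j k) ?s (5 * length xs + 1) ?f"
    using Cons.hyps(1)[of ?s] xs Cons.prems(2-) by simp
  moreover have "?f = s(i := [], j := rev (s i) @ s j, k := rev (s i) @ s k)"
    using Cons.prems by (auto simp: fun_eq_iff simp flip: Cons.hyps(2))
  moreover have "runs (IfTop i {1} (Pop i ;; Push j 1 ;; Push k 1) (Pop i ;; Push j 2 ;; Push k 2))
      s (Suc (1 + (1 + 1))) ?s"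
  proof (cases "a = 1")
    case True
    then show ?thesis using Cons.hyps(2)[symmetric] Cons.prems(2-4)
      by (intro runs_IfT runs_Seq[OF runs_Pop[OF refl] runs_Seq[OF runs_Push[OF refl] runs_Push]]) auto
  next
    case False
    then show ?thesis using Cons.hyps(2)[symmetric] Cons.prems
      by (intro runs_IfF runs_Seq[OF runs_Pop[OF refl] runs_Seq[OF runs_Push[OF refl] runs_Push]]) auto
  qed
  ultimately have "runs (move_rev2 i j k) s (Suc (Suc (1 + (1 + 1)) + (5 * length xs + 1)))
      (s(i := [], j := rev (s i) @ s j, k := rev (s i) @ s k))"
    unfolding move_rev2_def using Cons.hyps(2)[symmetric] Cons.prems by (intro runs_WhileT) auto
  then show ?case by (rule runs_le) (simp flip: Cons.hyps(2))
qed

text \<open>Two reversals through the empty scratch stack \<open>k\<close> restore the order, and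
  the second one writes the original and the copy at once.\<close>

definition copy_reg :: "nat \<Rightarrow> nat \<Rightarrow> nat \<Rightarrow> scom" where
  "copy_reg i j k = move_rev i k ;; move_rev2 k i j"

lemma runs_copy:
  assumes "set (s i) \<subseteq> {1, 2}" "i \<noteq> j" "i \<noteq> k" "j \<noteq> k" "s k = []"
    and "s' = s(j := s i @ s j)" "9 * length (s i) + 2 \<le> t"
  shows "runs (copy_reg i j k) s t s'"
proof -
  let ?s = "s(i := [], k := rev (s i))"
  have 1: "runs (move_rev i k) s (4 * length (s i) + 1) ?s"
    using runs_move[of s i k] assms by simp
  have 2: "runs (move_rev2 k i j) ?s (5 * length (s i) + 1)
      (?s(k := [], i := rev (?s k) @ ?s i, j := rev (?s k) @ ?s j))"
    using runs_move2[of ?s k i j] assms by auto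
  have "?s(k := [], i := rev (?s k) @ ?s i, j := rev (?s k) @ ?s j) = s'"
    using assms by (auto simp: fun_eq_iff)
  with runs_Seq[OF 1 2] have "runs (copy_reg i j k) s (9 * length (s i) + 2) s'"
    unfolding copy_reg_def by simp
  then show ?thesis by (rule runs_le[OF _ assms(7)])
qed

definition move_reg :: "nat \<Rightarrow> nat \<Rightarrow> nat \<Rightarrow> scom" where
  "move_reg i j k = move_rev i k ;; move_rev k j"

lemma runs_movek:
  assumes "set (s i) \<subseteq> {1, 2}" "i \<noteq> j" "i \<noteq> k" "j \<noteq> k" "s k = []"
    and "s' = s(i := [], j := s i @ s j)" "8 * length (s i) + 2 \<le> t"
  shows "runs (move_reg i j k) s t s'"
proof -
  let ?s = "s(i := [], k := rev (s i))"
  have 1: "runs (move_rev i k) s (4 * length (s i) + 1) ?s"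
    using runs_move[of s i k] assms by simp
  have 2: "runs (move_rev k j) ?s (4 * length (s i) + 1) (?s(k := [], j := rev (?s k) @ ?s j))"
    using runs_move[of ?s k j] assms by auto
  have "?s(k := [], j := rev (?s k) @ ?s j) = s'"
    using assms by (auto simp: fun_eq_iff)
  with runs_Seq[OF 1 2] have "runs (move_reg i j k) s (8 * length (s i) + 2) s'"
    unfolding move_reg_def by simp
  then show ?thesis by (rule runs_le[OF _ assms(7)])
qed

section \<open>A language of functions on binary trees\<close>

datatype tree = Lf | Nd tree tree

text \<open>Preorder code. It is self-delimiting, so a subtree can be split off a stack without
  separators, and its first symbol tells a leaf from a node.\<close>

fun enc :: "tree \<Rightarrow> nat list" where
  "enc Lf = [1]"
| "enc (Nd a b) = 2 # enc a @ enc b"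

lemma set_enc: "set (enc v) \<subseteq> {1, 2}"
  by (induction v) auto

lemma enc_append_inj: "enc v @ xs = enc w @ ys \<longleftrightarrow> v = w \<and> xs = ys"
proof (induction v arbitrary: w xs ys)
  case Lf
  then show ?case by (cases w) auto
next
  case (Nd a b)
  then show ?case by (cases w) auto
qed

lemma enc_inj: "enc v = enc w \<longleftrightarrow> v = w"
  using enc_append_inj[of v "[]" w "[]"] by simp

abbreviation sz :: "tree \<Rightarrow> nat" where "sz v \<equiv> length (enc v)"

lemma sz_pos: "1 \<le> sz v"
  by (cases v) auto

lemma top_enc: "s i = enc v @ xs \<Longrightarrow> top_sym s i = (if v = Lf then 1 else 2)"
  by (cases v) auto

text \<open>Stack \<open>k\<close> counts in unary how many subtrees are still to be read: a leaf
  completes one, a node replaces one by two. The code of the tree arrives on \<open>j\<close> in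
  reverse.\<close>

definition split_top :: "nat \<Rightarrow> nat \<Rightarrow> nat \<Rightarrow> scom" where
  "split_top i j k = Push k 1 ;;
     WhileTop k {1} (IfTop i {1} (Pop i ;; Push j 1 ;; Pop k) (Pop i ;; Push j 2 ;; Push k 1))"

text \<open>Stated with an arbitrary continuation of the same loop, so that in the induction the
  runs for the two subtrees of a node can be chained.\<close>

lemma runs_split_loop:
  assumes "i \<noteq> j" "i \<noteq> k" "j \<noteq> k"
  defines "W \<equiv> WhileTop k {1} (IfTop i {1} (Pop i ;; Push j 1 ;; Pop k) (Pop i ;; Push j 2 ;; Push k 1))"
  shows "s i = enc a @ r \<Longrightarrow> s k = 1 # ks \<Longrightarrow>
    runs W (s(i := r, j := rev (enc a) @ s j, k := ks)) t s' \<Longrightarrow> runs W s (5 * sz a + t) s'"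
proof (induction a arbitrary: s r ks t)
  case Lf
  have "runs (IfTop i {1} (Pop i ;; Push j 1 ;; Pop k) (Pop i ;; Push j 2 ;; Push k 1)) s (Suc (1 + (1 + 1)))
      (s(i := r, j := rev (enc Lf) @ s j, k := ks))"
    using Lf assms(1-3)
    by (intro runs_IfT runs_Seq[OF runs_Pop[OF refl] runs_Seq[OF runs_Push[OF refl] runs_Pop]]) auto
  from runs_WhileT[of s k "{1}", OF _ this Lf.prems(3)[unfolded W_def]] Lf.prems(2)
  have "runs W s (Suc (Suc (1 + (1 + 1)) + t)) s'" by (simp add: W_def)
  then show ?case by (rule runs_le) simp
next
  case (Nd a b)
  let ?s1 = "s(i := enc a @ enc b @ r, j := 2 # s j, k := 1 # s k)"
  have 1: "runs (IfTop i {1} (Pop i ;; Push j 1 ;; Pop k) (Pop i ;; Push j 2 ;; Push k 1)) s (Suc (1 + (1 + 1))) ?s1"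
    using Nd.prems assms(1-3)
    by (intro runs_IfF runs_Seq[OF runs_Pop[OF refl] runs_Seq[OF runs_Push[OF refl] runs_Push]]) auto
  let ?s2 = "?s1(i := enc b @ r, j := rev (enc a) @ ?s1 j, k := 1 # ks)"
  have "?s2(i := r, j := rev (enc b) @ ?s2 j, k := ks) = s(i := r, j := rev (enc (Nd a b)) @ s j, k := ks)"
    using assms(1-3) by (auto simp: fun_eq_iff)
  with Nd.prems(3) have "runs W (?s2(i := r, j := rev (enc b) @ ?s2 j, k := ks)) t s'" by (simp only:)
  then have "runs W ?s2 (5 * sz b + t) s'"
    by (rule Nd.IH(2)[rotated 2]) (use assms(1-3) in auto)
  then have "runs W ?s1 (5 * sz a + (5 * sz b + t)) s'"
    by (rule Nd.IH(1)[rotated 2]) (use Nd.prems assms(1-3) in auto)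
  from runs_WhileT[of s k "{1}", OF _ 1 this[unfolded W_def]] Nd.prems(2)
  have "runs W s (Suc (Suc (1 + (1 + 1)) + (5 * sz a + (5 * sz b + t)))) s'" by (simp add: W_def)
  then show ?case by (rule runs_le) simp
qed

lemma runs_split:
  assumes "i \<noteq> j" "i \<noteq> k" "j \<noteq> k" "s i = enc a @ r" "s k = []"
    and "s' = s(i := r, j := rev (enc a) @ s j)" "5 * sz a + 2 \<le> t"
  shows "runs (split_top i j k) s t s'"
proof -
  let ?c = "IfTop i {1} (Pop i ;; Push j 1 ;; Pop k) (Pop i ;; Push j 2 ;; Push k 1)"
  have "runs (WhileTop k {1} ?c) s' 1 s'"
    using assms by (intro runs_WhileF) auto
  moreover have "s' = (s(k := [1]))(i := r, j := rev (enc a) @ (s(k := [1])) j, k := [])"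
    using assms by (auto simp: fun_eq_iff)
  ultimately have "runs (WhileTop k {1} ?c) (s(k := [1])) (5 * sz a + 1) s'"
    using assms by (intro runs_split_loop[where r = r and ks = "[]"]) auto
  with runs_Push[of "s(k := [1])" s k 1 1] have "runs (split_top i j k) s (1 + (5 * sz a + 1)) s'"
    unfolding split_top_def using assms(5) by (intro runs_Seq) auto
  then show ?thesis by (rule runs_le) (use assms in simp)
qed

text \<open>The first mismatch empties both stacks and leaves a mark on \<open>k\<close>. If
  \<open>i\<close> was a proper prefix, something remains on \<open>j\<close>; the last loop,
  executed at most once, is the conditional that turns this into a mark.\<close>

definition eqtest :: "nat \<Rightarrow> nat \<Rightarrow> nat \<Rightarrow> scom" where
  "eqtest i j k =
    WhileTop i {1, 2}
      (IfTop i {1} (IfTop j {1} (Pop i ;; Pop j) (clear i ;; clear j ;; Push k 1))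
               (IfTop j {2} (Pop i ;; Pop j) (clear i ;; clear j ;; Push k 1))) ;;
    WhileTop j {1, 2} (clear j ;; Push k 1)"

lemma runs_eqtest_loop:
  assumes "i \<noteq> j" "i \<noteq> k" "j \<noteq> k"
  defines "body \<equiv> IfTop i {1} (IfTop j {1} (Pop i ;; Pop j) (clear i ;; clear j ;; Push k 1))
               (IfTop j {2} (Pop i ;; Pop j) (clear i ;; clear j ;; Push k 1))"
  shows "set (s i) \<subseteq> {1, 2} \<Longrightarrow> set (s j) \<subseteq> {1, 2} \<Longrightarrow> s k = [] \<Longrightarrow>
    \<exists>X Y. runs (WhileTop i {1, 2} body) s (5 * length (s i) + 2 * length (s j) + 8)
        (s(i := [], j := X, k := Y)) \<and> length X \<le> length (s j) \<and> set X \<subseteq> {1, 2} \<and>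
      (if s i = s j then X = [] \<and> Y = [] else X \<noteq> [] \<and> Y = [] \<or> X = [] \<and> Y = [1])"
proof (induction "s i" arbitrary: s)
  case Nil
  note si = Nil.hyps[symmetric]
  have "runs (WhileTop i {1, 2} body) s 1 s"
    using si by (intro runs_WhileF) simp
  moreover have "s(i := [], j := s j, k := []) = s" using si Nil.prems by (auto simp: fun_eq_iff)
  ultimately have "runs (WhileTop i {1, 2} body) s (5 * length (s i) + 2 * length (s j) + 8)
      (s(i := [], j := s j, k := []))"
    by (auto elim: runs_le)
  then show ?case
    by (intro exI[of _ "s j"] exI[of _ "[]"] conjI, assumption) (use Nil.prems si in auto)
next
  case (Cons a xs)
  note si = Cons.hyps(2)[symmetric]
  have xs: "set xs \<subseteq> {1, 2}" "a = 1 \<or> a = 2" using Cons.prems unfolding si by auto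
  show ?case
  proof (cases "\<exists>ys. s j = a # ys")
    case True
    then obtain ys where sj: "s j = a # ys" by blast
    let ?s = "s(i := xs, j := ys)"
    obtain X Y where XY: "runs (WhileTop i {1, 2} body) ?s (5 * length xs + 2 * length ys + 8)
        (?s(i := [], j := X, k := Y))" "length X \<le> length ys" "set X \<subseteq> {1, 2}"
      "if xs = ys then X = [] \<and> Y = [] else X \<noteq> [] \<and> Y = [] \<or> X = [] \<and> Y = [1]"
      using Cons.hyps(1)[of ?s] xs Cons.prems sj assms(1-3) by auto
    have pp: "runs (Pop i ;; Pop j) s (1 + 1) ?s"
      using si sj assms(1-3) by (intro runs_Seq[OF runs_Pop[OF refl] runs_Pop]) auto
    have "runs body s (Suc (Suc (1 + 1))) ?s"
      using xs(2)
    proof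
      assume "a = 1"
      then show ?thesis unfolding body_def using si sj pp by (intro runs_IfT) auto
    next
      assume "a = 2"
      then show ?thesis unfolding body_def using si sj pp
        by (intro runs_IfF[OF _ runs_IfT]) auto
    qed
    from runs_WhileT[of s i "{1, 2}", OF _ this XY(1)] si xs(2)
    have "runs (WhileTop i {1, 2} body) s (Suc (Suc (Suc (1 + 1)) + (5 * length xs + 2 * length ys + 8)))
        (?s(i := [], j := X, k := Y))" by auto
    moreover have "?s(i := [], j := X, k := Y) = s(i := [], j := X, k := Y)"
      by (auto simp: fun_eq_iff)
    ultimately have "runs (WhileTop i {1, 2} body) s (5 * length (s i) + 2 * length (s j) + 8)
        (s(i := [], j := X, k := Y))"
      using si sj by (auto elim: runs_le)
    then show ?thesis using XY si sj by (intro exI[of _ X] exI[of _ Y]) auto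
  next
    case False
    let ?s1 = "s(i := [])" and ?s2 = "s(i := [], j := [])" and ?s3 = "s(i := [], j := [], k := [1])"
    have "set (s i) \<subseteq> {1, 2, 3}" "set (s j) \<subseteq> {1, 2, 3}" using Cons.prems by auto
    then have "runs (clear i) s (2 * length (s i) + 1) ?s1"
      "runs (clear j) ?s1 (2 * length (s j) + 1) ?s2"
      using runs_clear[of s i] runs_clear[of ?s1 j] assms(1-3) by auto
    moreover have "runs (Push k 1) ?s2 1 ?s3"
      using Cons.prems assms(1-3) by (intro runs_Push) auto
    ultimately have cl: "runs (clear i ;; clear j ;; Push k 1) s
        (2 * length (s i) + 1 + (2 * length (s j) + 1 + 1)) ?s3"
      by (intro runs_Seq)
    have ne: "top_sym s j \<noteq> a"
      using False xs(2) by (cases "s j") auto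
    have "runs body s (Suc (Suc (2 * length (s i) + 1 + (2 * length (s j) + 1 + 1)))) ?s3"
      using xs(2)
    proof
      assume "a = 1"
      then show ?thesis unfolding body_def using si ne cl by (intro runs_IfT[OF _ runs_IfF]) auto
    next
      assume "a = 2"
      then show ?thesis unfolding body_def using si ne cl by (intro runs_IfF) auto
    qed
    moreover have "runs (WhileTop i {1, 2} body) ?s3 1 ?s3"
      using assms(1-3) by (intro runs_WhileF) simp
    ultimately have "runs (WhileTop i {1, 2} body) s
        (Suc (Suc (Suc (2 * length (s i) + 1 + (2 * length (s j) + 1 + 1))) + 1)) ?s3"
      using si xs(2) by (intro runs_WhileT) auto
    then have "runs (WhileTop i {1, 2} body) s (5 * length (s i) + 2 * length (s j) + 8) ?s3"
      by (rule runs_le) simp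
    moreover have "s i \<noteq> s j" using False si by metis
    ultimately show ?thesis by (intro exI[of _ "[]"] exI[of _ "[1]"] conjI) auto
  qed
qed

lemma runs_eqtest:
  assumes "i \<noteq> j" "i \<noteq> k" "j \<noteq> k" "set (s i) \<subseteq> {1, 2}" "set (s j) \<subseteq> {1, 2}" "s k = []"
    and "s' = s(i := [], j := [], k := (if s i = s j then [] else [1]))"
    and "5 * length (s i) + 4 * length (s j) + 12 \<le> t"
  shows "runs (eqtest i j k) s t s'"
proof -
  obtain X Y where XY: "runs (WhileTop i {1, 2}
      (IfTop i {1} (IfTop j {1} (Pop i ;; Pop j) (clear i ;; clear j ;; Push k 1))
               (IfTop j {2} (Pop i ;; Pop j) (clear i ;; clear j ;; Push k 1))))
       s (5 * length (s i) + 2 * length (s j) + 8)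
        (s(i := [], j := X, k := Y))" "length X \<le> length (s j)" "set X \<subseteq> {1, 2}"
      "if s i = s j then X = [] \<and> Y = [] else X \<noteq> [] \<and> Y = [] \<or> X = [] \<and> Y = [1]"
    using runs_eqtest_loop[OF assms(1-6)] by blast
  let ?s = "s(i := [], j := X, k := Y)"
  have "runs (WhileTop j {1, 2} (clear j ;; Push k 1)) ?s (2 * length X + 4) s'"
  proof (cases "X = []")
    case True
    then have "s' = ?s" using assms(7) XY(4) by (auto split: if_splits)
    moreover have "runs (WhileTop j {1, 2} (clear j ;; Push k 1)) ?s 1 ?s"
      using True assms(1-3) by (intro runs_WhileF) simp
    ultimately show ?thesis using runs_le by fastforce
  next
    case False
    then have Y: "Y = []" "s i \<noteq> s j" using XY(4) by (auto split: if_splits)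
    have "runs (clear j) ?s (2 * length X + 1) (?s(j := []))"
      using runs_clear[of ?s j] XY(3) assms(1-3) by auto
    moreover have "runs (Push k 1) (?s(j := [])) 1 s'"
      using Y assms(1-3,7) by (intro runs_Push) (auto simp: fun_eq_iff)
    ultimately have "runs (clear j ;; Push k 1) ?s (2 * length X + 1 + 1) s'" by (rule runs_Seq)
    moreover have "runs (WhileTop j {1, 2} (clear j ;; Push k 1)) s' 1 s'"
      using assms(1-3,7) by (intro runs_WhileF) simp
    moreover have "top_sym ?s j \<in> {1, 2}"
      using False XY(3) assms(1-3) by (cases X) auto
    ultimately have "runs (WhileTop j {1, 2} (clear j ;; Push k 1)) ?s (Suc (2 * length X + 1 + 1 + 1)) s'"
      by (intro runs_WhileT)
    then show ?thesis by (rule runs_le) simp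
  qed
  with XY(1) have "runs (eqtest i j k) s (5 * length (s i) + 2 * length (s j) + 8 + (2 * length X + 4)) s'"
    unfolding eqtest_def by (rule runs_Seq)
  then show ?thesis by (rule runs_le) (use XY(2) assms(8) in simp)
qed

section \<open>The tree language, its size bounds and its compiler\<close>

datatype fn =
    IdF | Hd | Tl | LfC
  | PairF fn fn
  | Comp fn fn  (infixl "\<diamondop>" 55)
  | Cond fn fn fn
  | Eqf fn fn
  | Fold fn fn fn

fun hd_tree :: "tree \<Rightarrow> tree" where
  "hd_tree Lf = Lf" | "hd_tree (Nd a b) = a"

fun tl_tree :: "tree \<Rightarrow> tree" where
  "tl_tree Lf = Lf" | "tl_tree (Nd a b) = b"

fun elems :: "tree \<Rightarrow> tree list" where
  "elems Lf = []" | "elems (Nd a b) = a # elems b"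

definition boolt :: "bool \<Rightarrow> tree" where "boolt b = (if b then Nd Lf Lf else Lf)"

text \<open>As there are no variables, the body of a fold receives the whole argument
  \<open>v\<close> besides accumulator and element.\<close>

primrec eval :: "fn \<Rightarrow> tree \<Rightarrow> tree" where
  "eval IdF v = v"
| "eval Hd v = hd_tree v"
| "eval Tl v = tl_tree v"
| "eval LfC v = Lf"
| "eval (PairF f g) v = Nd (eval f v) (eval g v)"
| "eval (g \<diamondop> f) v = eval g (eval f v)"
| "eval (Cond c f g) v = (if eval c v \<noteq> Lf then eval f v else eval g v)"
| "eval (Eqf f g) v = boolt (eval f v = eval g v)"
| "eval (Fold l a b) v = foldl (\<lambda>acc e. eval b (Nd acc (Nd e v))) (eval a v) (elems (eval l v))"

text \<open>The bound is imposed on each new accumulator but not on the initial one, whose size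
  \<open>out_bound\<close> controls.\<close>

fun fold_ok :: "nat \<Rightarrow> (tree \<Rightarrow> bool) \<Rightarrow> (tree \<Rightarrow> tree) \<Rightarrow> tree \<Rightarrow> tree \<Rightarrow> tree list \<Rightarrow> bool" where
  "fold_ok N P F v acc [] = True"
| "fold_ok N P F v acc (e # es) = (let w = Nd acc (Nd e v) in
     P w \<and> sz (F w) \<le> N \<and> fold_ok N P F v (F w) es)"

text \<open>Only the accumulators of folds need an explicit size bound: everything else grows at most linearly.\<close>

primrec ok :: "nat \<Rightarrow> fn \<Rightarrow> tree \<Rightarrow> bool" where
  "ok N (PairF f g) v = (ok N f v \<and> ok N g v)"
| "ok N (g \<diamondop> f) v = (ok N f v \<and> ok N g (eval f v))"
| "ok N (Cond c f g) v = (ok N c v \<and> (if eval c v \<noteq> Lf then ok N f v else ok N g v))"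
| "ok N (Eqf f g) v = (ok N f v \<and> ok N g v)"
| "ok N (Fold l a b) v = (ok N l v \<and> ok N a v \<and>
     fold_ok N (ok N b) (eval b) v (eval a v) (elems (eval l v)))"
| "ok N IdF v = True" | "ok N Hd v = True" | "ok N Tl v = True" | "ok N LfC v = True"

lemma fold_ok_mono:
  assumes "N \<le> N'" "\<And>w. P w \<Longrightarrow> P' w"
  shows "fold_ok N P F v acc es \<Longrightarrow> fold_ok N' P' F v acc es"
  using assms by (induction es arbitrary: acc) (auto simp: Let_def intro: le_trans)

lemma ok_mono: "N \<le> N' \<Longrightarrow> ok N f v \<Longrightarrow> ok N' f v"
proof (induction f arbitrary: v)
  case (Fold l a b)
  then show ?case by (auto intro: fold_ok_mono[where P = "ok N b"])
qed auto

text \<open>A fold returns its start value or a later accumulator, hence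
  \<open>out_bound a N + N\<close> however many rounds there are. This is what keeps the bound
  polynomial in \<open>N\<close>.\<close>

fun out_bound :: "fn \<Rightarrow> nat \<Rightarrow> nat" where
  "out_bound (PairF f g) N = out_bound f N + out_bound g N + 1"
| "out_bound (g \<diamondop> f) N = out_bound g (out_bound f N)"
| "out_bound (Cond c f g) N = out_bound f N + out_bound g N"
| "out_bound (Eqf f g) N = N + 3"
| "out_bound (Fold l a b) N = out_bound a N + N"
| "out_bound _ N = N + 1"

lemma out_bound_ge: "N \<le> out_bound f N"
  by (induction f arbitrary: N) (auto intro: le_trans trans_le_add1 le_SucI)

lemma fold_ok_sz:
  "fold_ok N P F v acc es \<Longrightarrow> sz acc \<le> M \<Longrightarrow> N \<le> M \<Longrightarrow>
    sz (foldl (\<lambda>acc e. F (Nd acc (Nd e v))) acc es) \<le> M"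
  by (induction es arbitrary: acc) (auto simp: Let_def)

lemma sz_hd_tl: "sz (hd_tree v) \<le> sz v" "sz (tl_tree v) \<le> sz v"
  by (cases v; simp)+

lemma sz_eval_le: "sz v \<le> N \<Longrightarrow> ok N f v \<Longrightarrow> sz (eval f v) \<le> out_bound f N"
proof (induction f arbitrary: v N)
  case (Comp g f)
  then have "sz (eval f v) \<le> out_bound f N" "ok (out_bound f N) g (eval f v)"
    using ok_mono[OF out_bound_ge] by auto
  then show ?case using Comp.IH(1) by simp
next
  case (Cond c f g)
  then show ?case by (auto intro: trans_le_add1 trans_le_add2)
next
  case (Fold l a b)
  then show ?case by (auto intro!: fold_ok_sz simp: trans_le_add1)
qed (auto simp: boolt_def intro: le_trans[OF sz_hd_tl(1)] le_trans[OF sz_hd_tl(2)] add_mono)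

text \<open>\<open>compile f d\<close> replaces the tree in register \<open>d\<close> by its image; the registers above \<open>d\<close> are
  scratch space and must be empty before and are empty afterwards.\<close>

fun compile :: "fn \<Rightarrow> nat \<Rightarrow> scom" where
  "compile IdF d = skip_cmd d"
| "compile Hd d = IfTop d {2} (Pop d ;; split_top d (d+1) (d+2) ;; clear d ;; move_rev (d+1) d) (skip_cmd d)"
| "compile Tl d = IfTop d {2} (Pop d ;; split_top d (d+1) (d+2) ;; clear (d+1)) (skip_cmd d)"
| "compile LfC d = clear d ;; Push d 1"
| "compile (PairF f g) d =
     copy_reg d (d+1) (d+2) ;; compile f (d+1) ;; copy_reg d (d+2) (d+3) ;; compile g (d+2) ;;
     clear d ;; move_reg (d+2) d (d+3) ;; move_reg (d+1) d (d+2) ;; Push d 2"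
| "compile (g \<diamondop> f) d = compile f d ;; compile g d"
| "compile (Cond c f g) d =
     copy_reg d (d+1) (d+2) ;; compile c (d+1) ;;
     IfTop (d+1) {2} (clear (d+1) ;; compile f d) (clear (d+1) ;; compile g d)"
| "compile (Eqf f g) d =
     copy_reg d (d+1) (d+2) ;; compile f (d+1) ;; copy_reg d (d+2) (d+3) ;; compile g (d+2) ;;
     clear d ;; eqtest (d+1) (d+2) (d+3) ;;
     IfTop (d+3) {1} (Pop (d+3) ;; Push d 1) (Push d 1 ;; Push d 1 ;; Push d 2)"
| "compile (Fold l a b) d =
     copy_reg d (d+1) (d+2) ;; compile l (d+1) ;; copy_reg d (d+2) (d+3) ;; compile a (d+2) ;;
     WhileTop (d+1) {2}
       (Pop (d+1) ;; split_top (d+1) (d+3) (d+4) ;; copy_reg d (d+4) (d+5) ;; move_rev (d+3) (d+4) ;;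
        Push (d+4) 2 ;; move_reg (d+2) (d+4) (d+3) ;; Push (d+4) 2 ;; compile b (d+4) ;;
        move_reg (d+4) (d+2) (d+3)) ;;
     clear (d+1) ;; clear d ;; move_reg (d+2) d (d+1)"

text \<open>A fold has at most \<open>out_bound l N\<close> rounds, and the argument of its body
  consists of an accumulator, a list element and the original argument; their bounds add up to the
  size at which \<open>time_bound b\<close> is taken.\<close>

fun time_bound :: "fn \<Rightarrow> nat \<Rightarrow> nat" where
  "time_bound (PairF f g) N = time_bound f N + time_bound g N + 20 * N + 8 * out_bound f N + 8 * out_bound g N + 10"
| "time_bound (g \<diamondop> f) N = time_bound f N + time_bound g (out_bound f N)"
| "time_bound (Cond c f g) N = time_bound c N + time_bound f N + time_bound g N + 9 * N + 2 * out_bound c N + 10"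
| "time_bound (Eqf f g) N = time_bound f N + time_bound g N + 20 * N + 5 * out_bound f N + 4 * out_bound g N + 30"
| "time_bound (Fold l a b) N = time_bound l N + time_bound a N + 20 * N + 8 * (out_bound a N + N) + 20 +
     (out_bound l N + 1) * (9 * out_bound l N + 9 * N + 8 * (out_bound a N + N) + 20 + 8 * out_bound a N + 8 * N +
       time_bound b (out_bound a N + N + out_bound l N + N + 2))"
| "time_bound _ N = 20 * N + 20"

definition enc_state :: "stacks \<Rightarrow> nat \<Rightarrow> tree \<Rightarrow> bool" where
  "enc_state s d v \<longleftrightarrow> s d = enc v \<and> (\<forall>j>d. s j = [])"

lemma runs_Seq_le:
  "runs c1 s t1 s1 \<Longrightarrow> runs c2 s1 t2 s2 \<Longrightarrow> t1 + t2 \<le> t \<Longrightarrow> runs (c1 ;; c2) s t s2"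
  using runs_Seq runs_le by blast

lemma runs_clear_le:
  "set (s i) \<subseteq> {1, 2} \<Longrightarrow> s' = s(i := []) \<Longrightarrow> 2 * length (s i) + 1 \<le> t \<Longrightarrow> runs (clear i) s t s'"
  using runs_clear[of s i] runs_le by fastforce

lemma runs_move_le:
  "set (s i) \<subseteq> {1, 2} \<Longrightarrow> i \<noteq> j \<Longrightarrow> s' = s(i := [], j := rev (s i) @ s j) \<Longrightarrow>
    4 * length (s i) + 1 \<le> t \<Longrightarrow> runs (move_rev i j) s t s'"
  using runs_move[of s i j] runs_le by fastforce

lemma compile_Pair:
  assumes "enc_state s d v" "sz v \<le> N" "sz x \<le> A" "sz y \<le> B"
    and f: "\<And>s. enc_state s (d+1) v \<Longrightarrow> runs (compile f (d+1)) s t1 (s(d+1 := enc x))"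
    and g: "\<And>s. enc_state s (d+2) v \<Longrightarrow> runs (compile g (d+2)) s t2 (s(d+2 := enc y))"
    and t: "t1 + t2 + 20 * N + 8 * A + 8 * B + 10 \<le> t"
  shows "runs (compile (PairF f g) d) s t (s(d := enc (Nd x y)))"
proof -
  note e = assms(1)[unfolded enc_state_def]
  let ?s1 = "s(d+1 := enc v)" and ?s2 = "s(d+1 := enc x)"
  let ?s3 = "?s2(d+2 := enc v)" and ?s4 = "?s2(d+2 := enc y)"
  let ?s5 = "?s4(d := [])" and ?s6 = "?s2(d := enc y)" and ?s7 = "s(d := enc x @ enc y)"
  have 1: "runs (copy_reg d (d+1) (d+2)) s (9 * N + 2) ?s1"
    using e assms(2) set_enc by (intro runs_copy) auto
  have 2: "runs (compile f (d+1)) ?s1 t1 ?s2"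
    using f[of ?s1] e by (auto simp: enc_state_def)
  have 3: "runs (copy_reg d (d+2) (d+3)) ?s2 (9 * N + 2) ?s3"
    using e assms(2) set_enc by (intro runs_copy) auto
  have 4: "runs (compile g (d+2)) ?s3 t2 ?s4"
    using g[of ?s3] e by (auto simp: enc_state_def)
  have 5: "runs (clear d) ?s4 (2 * N + 1) ?s5"
    using e assms(2) set_enc by (intro runs_clear_le) auto
  have 6: "runs (move_reg (d+2) d (d+3)) ?s5 (8 * B + 2) ?s6"
    using e assms(4) set_enc by (intro runs_movek) (auto simp: fun_eq_iff)
  have 7: "runs (move_reg (d+1) d (d+2)) ?s6 (8 * A + 2) ?s7"
    using e assms(3) set_enc by (intro runs_movek) (auto simp: fun_eq_iff)
  have 8: "runs (Push d 2) ?s7 1 (s(d := enc (Nd x y)))"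
    by (intro runs_Push) auto
  show ?thesis
    unfolding compile.simps
    by (rule runs_Seq_le[OF 1 runs_Seq[OF 2 runs_Seq[OF 3 runs_Seq[OF 4 runs_Seq[OF 5
        runs_Seq[OF 6 runs_Seq[OF 7 8]]]]]]]) (use t in simp)
qed

lemma compile_Cond:
  assumes "enc_state s d v" "sz v \<le> N" "sz x \<le> A"
    and c: "\<And>s. enc_state s (d+1) v \<Longrightarrow> runs (compile c (d+1)) s t1 (s(d+1 := enc x))"
    and f: "x \<noteq> Lf \<Longrightarrow> runs (compile f d) s t2 s'"
    and g: "x = Lf \<Longrightarrow> runs (compile g d) s t2 s'"
    and t: "t1 + t2 + 9 * N + 2 * A + 10 \<le> t"
  shows "runs (compile (Cond c f g) d) s t s'"
proof -
  note e = assms(1)[unfolded enc_state_def]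
  let ?s1 = "s(d+1 := enc v)" and ?s2 = "s(d+1 := enc x)"
  have 1: "runs (copy_reg d (d+1) (d+2)) s (9 * N + 2) ?s1"
    using e assms(2) set_enc by (intro runs_copy) auto
  have 2: "runs (compile c (d+1)) ?s1 t1 ?s2"
    using c[of ?s1] e by (auto simp: enc_state_def)
  have 3: "runs (clear (d+1)) ?s2 (2 * A + 1) s"
    using e assms(3) set_enc by (intro runs_clear_le) (auto simp: fun_eq_iff)
  have top: "top_sym ?s2 (d+1) = (if x = Lf then 1 else 2)"
    using top_enc[of ?s2 "d+1" x "[]"] by simp
  have 4: "runs (IfTop (d+1) {2} (clear (d+1) ;; compile f d) (clear (d+1) ;; compile g d)) ?s2
      (Suc (2 * A + 1 + t2)) s'"
  proof (cases "x = Lf")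
    case True
    then show ?thesis using top runs_Seq[OF 3 g] by (intro runs_IfF) auto
  next
    case False
    then show ?thesis using top runs_Seq[OF 3 f] by (intro runs_IfT) auto
  qed
  show ?thesis
    unfolding compile.simps by (rule runs_Seq_le[OF 1 runs_Seq[OF 2 4]]) (use t in simp)
qed

lemma compile_Eqf:
  assumes "enc_state s d v" "sz v \<le> N" "sz x \<le> A" "sz y \<le> B"
    and f: "\<And>s. enc_state s (d+1) v \<Longrightarrow> runs (compile f (d+1)) s t1 (s(d+1 := enc x))"
    and g: "\<And>s. enc_state s (d+2) v \<Longrightarrow> runs (compile g (d+2)) s t2 (s(d+2 := enc y))"
    and t: "t1 + t2 + 20 * N + 5 * A + 4 * B + 30 \<le> t"
  shows "runs (compile (Eqf f g) d) s t (s(d := enc (boolt (x = y))))"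
proof -
  note e = assms(1)[unfolded enc_state_def]
  let ?s1 = "s(d+1 := enc v)" and ?s2 = "s(d+1 := enc x)"
  let ?s3 = "?s2(d+2 := enc v)" and ?s4 = "?s2(d+2 := enc y)"
  let ?s5 = "?s4(d := [])" and ?s6 = "s(d := [], d+3 := (if x = y then [] else [1]))"
  have 1: "runs (copy_reg d (d+1) (d+2)) s (9 * N + 2) ?s1"
    using e assms(2) set_enc by (intro runs_copy) auto
  have 2: "runs (compile f (d+1)) ?s1 t1 ?s2"
    using f[of ?s1] e by (auto simp: enc_state_def)
  have 3: "runs (copy_reg d (d+2) (d+3)) ?s2 (9 * N + 2) ?s3"
    using e assms(2) set_enc by (intro runs_copy) auto
  have 4: "runs (compile g (d+2)) ?s3 t2 ?s4"
    using g[of ?s3] e by (auto simp: enc_state_def)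
  have 5: "runs (clear d) ?s4 (2 * N + 1) ?s5"
    using e assms(2) set_enc by (intro runs_clear_le) auto
  have 6: "runs (eqtest (d+1) (d+2) (d+3)) ?s5 (5 * A + 4 * B + 12) ?s6"
    using e assms(3,4) set_enc by (intro runs_eqtest) (auto simp: fun_eq_iff enc_inj)
  have 7: "runs (IfTop (d+3) {1} (Pop (d+3) ;; Push d 1) (Push d 1 ;; Push d 1 ;; Push d 2)) ?s6
      4 (s(d := enc (boolt (x = y))))"
  proof (cases "x = y")
    case True
    have "runs (Push d 1 ;; Push d 1 ;; Push d 2) ?s6 (1 + (1 + 1)) (s(d := enc (boolt (x = y))))"
      using True e by (intro runs_Seq[OF runs_Push[OF refl] runs_Seq[OF runs_Push[OF refl] runs_Push]])
        (auto simp: boolt_def fun_eq_iff)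
    then have "runs (IfTop (d+3) {1} (Pop (d+3) ;; Push d 1) (Push d 1 ;; Push d 1 ;; Push d 2)) ?s6
      (Suc (1 + (1 + 1))) (s(d := enc (boolt (x = y))))"
      using True by (intro runs_IfF) auto
    then show ?thesis by (rule runs_le) simp
  next
    case False
    have "runs (Pop (d+3) ;; Push d 1) ?s6 (1 + 1) (s(d := enc (boolt (x = y))))"
      using False e by (intro runs_Seq[OF runs_Pop[OF refl] runs_Push])
        (auto simp: boolt_def fun_eq_iff)
    then have "runs (IfTop (d+3) {1} (Pop (d+3) ;; Push d 1) (Push d 1 ;; Push d 1 ;; Push d 2)) ?s6
      (Suc (1 + 1)) (s(d := enc (boolt (x = y))))"
      using False by (intro runs_IfT) auto
    then show ?thesis by (rule runs_le) simp
  qed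
  show ?thesis
    unfolding compile.simps
    by (rule runs_Seq_le[OF 1 runs_Seq[OF 2 runs_Seq[OF 3 runs_Seq[OF 4 runs_Seq[OF 5
        runs_Seq[OF 6 7]]]]]]) (use t in simp)
qed

text \<open>\<open>P\<close> and \<open>F\<close> stand for the side condition and the value of the
  body, so that the loop can be analysed apart from the induction over functions.\<close>

lemma compile_fold_loop:
  fixes P :: "tree \<Rightarrow> bool" and F :: "tree \<Rightarrow> tree"
  assumes b: "\<And>s w. enc_state s (d+4) w \<Longrightarrow> P w \<Longrightarrow> sz w \<le> A + M + N + 2 \<Longrightarrow>
      runs (compile b (d+4)) s tb (s(d+4 := enc (F w)))"
    and "sz v \<le> N" "N \<le> A"
  defines "body \<equiv> Pop (d+1) ;; split_top (d+1) (d+3) (d+4) ;; copy_reg d (d+4) (d+5) ;; move_rev (d+3) (d+4) ;;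
        Push (d+4) 2 ;; move_reg (d+2) (d+4) (d+3) ;; Push (d+4) 2 ;; compile b (d+4) ;;
        move_reg (d+4) (d+2) (d+3)"
  shows "s d = enc v \<Longrightarrow> s (d+1) = enc L \<Longrightarrow> s (d+2) = enc acc \<Longrightarrow> \<forall>j>d+2. s j = [] \<Longrightarrow>
    fold_ok N P F v acc (elems L) \<Longrightarrow> sz acc \<le> A \<Longrightarrow> sz L \<le> M \<Longrightarrow>
    runs (WhileTop (d+1) {2} body) s (length (elems L) * (tb + 9 * M + 17 * N + 8 * A + 20) + 1)
      (s(d+1 := [1], d+2 := enc (foldl (\<lambda>acc e. F (Nd acc (Nd e v))) acc (elems L))))"
proof (induction L arbitrary: s acc)
  case Lf
  then have "s(d+1 := [1], d+2 := enc acc) = s" by (auto simp: fun_eq_iff)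
  moreover have "runs (WhileTop (d+1) {2} body) s 1 s"
    using Lf by (intro runs_WhileF) simp
  ultimately show ?case by (simp only: elems.simps list.size foldl.simps mult_0 add_0)
next
  case (Nd x L)
  let ?w = "Nd acc (Nd x v)"
  let ?s1 = "s(d+1 := enc x @ enc L)"
  let ?s2 = "s(d+1 := enc L, d+3 := rev (enc x))"
  let ?s3 = "?s2(d+4 := enc v)"
  let ?s4 = "s(d+1 := enc L, d+4 := enc x @ enc v)"
  let ?s5 = "s(d+1 := enc L, d+4 := enc (Nd x v))"
  let ?s6 = "s(d+1 := enc L, d+2 := [], d+4 := enc acc @ enc (Nd x v))"
  let ?s7 = "s(d+1 := enc L, d+2 := [], d+4 := enc ?w)"
  let ?s8 = "s(d+1 := enc L, d+2 := [], d+4 := enc (F ?w))"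
  let ?s9 = "s(d+1 := enc L, d+2 := enc (F ?w))"
  note above = Nd.prems(4)[rule_format]
  have sx: "sz x \<le> M" "sz L \<le> M" and sF: "sz (F ?w) \<le> N" "P ?w" "fold_ok N P F v (F ?w) (elems L)"
    using Nd.prems(5,7) by (auto simp: Let_def)
  have sw: "sz ?w \<le> A + M + N + 2" using Nd.prems(6,7) assms(2) by simp
  have 1: "runs (Pop (d+1)) s 1 ?s1"
    using Nd.prems(2) by (intro runs_Pop) auto
  have 2: "runs (split_top (d+1) (d+3) (d+4)) ?s1 (5 * M + 2) ?s2"
    using sx above by (intro runs_split[where a = x and r = "enc L"]) (auto simp: fun_eq_iff)
  have 3: "runs (copy_reg d (d+4) (d+5)) ?s2 (9 * N + 2) ?s3"
    using Nd.prems(1) above assms(2) set_enc by (intro runs_copy) (auto simp: fun_eq_iff)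
  \<comment> \<open>The split has left the element reversed on \<open>d+3\<close>; this single
    reversal puts it in order in front of \<open>v\<close>.\<close>
  have 4: "runs (move_rev (d+3) (d+4)) ?s3 (4 * M + 1) ?s4"
    using sx above set_enc by (intro runs_move_le) (auto simp: fun_eq_iff)
  have 5: "runs (Push (d+4) 2) ?s4 1 ?s5"
    by (intro runs_Push) (auto simp: fun_eq_iff)
  have 6: "runs (move_reg (d+2) (d+4) (d+3)) ?s5 (8 * A + 2) ?s6"
    using Nd.prems(3,6) above set_enc by (intro runs_movek) (auto simp: fun_eq_iff)
  have 7: "runs (Push (d+4) 2) ?s6 1 ?s7"
    by (intro runs_Push) (auto simp: fun_eq_iff)
  have 8: "runs (compile b (d+4)) ?s7 tb ?s8"
    using b[of ?s7 ?w, OF _ sF(2) sw] above by (auto simp: enc_state_def)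
  have 9: "runs (move_reg (d+4) (d+2) (d+3)) ?s8 (8 * N + 2) ?s9"
    using sF(1) above set_enc by (intro runs_movek) (auto simp: fun_eq_iff)
  have B: "runs body s (tb + 9 * M + 17 * N + 8 * A + 19) ?s9"
    unfolding body_def
    by (rule runs_Seq_le[OF 1 runs_Seq[OF 2 runs_Seq[OF 3 runs_Seq[OF 4 runs_Seq[OF 5
        runs_Seq[OF 6 runs_Seq[OF 7 runs_Seq[OF 8 9]]]]]]]]) simp
  have "runs (WhileTop (d+1) {2} body) ?s9 (length (elems L) * (tb + 9 * M + 17 * N + 8 * A + 20) + 1)
      (?s9(d+1 := [1], d+2 := enc (foldl (\<lambda>acc e. F (Nd acc (Nd e v))) (F ?w) (elems L))))"
    using Nd.prems(1) above sF sx assms(3) by (intro Nd.IH(2)) auto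
  moreover have "?s9(d+1 := [1], d+2 := enc (foldl (\<lambda>acc e. F (Nd acc (Nd e v))) (F ?w) (elems L))) =
    s(d+1 := [1], d+2 := enc (foldl (\<lambda>acc e. F (Nd acc (Nd e v))) acc (elems (Nd x L))))"
    by (auto simp: fun_eq_iff)
  moreover have "top_sym s (d+1) \<in> {2}" using Nd.prems(2) by simp
  ultimately have "runs (WhileTop (d+1) {2} body) s (Suc (tb + 9 * M + 17 * N + 8 * A + 19 +
      (length (elems L) * (tb + 9 * M + 17 * N + 8 * A + 20) + 1)))
      (s(d+1 := [1], d+2 := enc (foldl (\<lambda>acc e. F (Nd acc (Nd e v))) acc (elems (Nd x L)))))"
    using B by (metis runs_WhileT)
  then show ?case by (rule runs_le) simp
qed

lemma length_elems: "length (elems v) \<le> sz v"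
  by (induction v) auto

text \<open>\<open>N\<close> is generalised because the outer function of a composition and the body
  of a fold run with larger size bounds; \<open>ok_mono\<close> makes their side conditions
  available there.\<close>

theorem compile_correct:
  "enc_state s d v \<Longrightarrow> sz v \<le> N \<Longrightarrow> ok N f v \<Longrightarrow>
    runs (compile f d) s (time_bound f N) (s(d := enc (eval f v)))"
proof (induction f arbitrary: s d v N)
  case IdF
  then have "s(d := enc (eval IdF v)) = s" by (simp add: enc_state_def fun_upd_idem)
  then show ?case using runs_le[OF runs_skip[of d s]] by simp
next
  case Hd
  note e = Hd.prems(1)[unfolded enc_state_def]
  show ?case
  proof (cases v)
    case Lf
    then have "s(d := enc (eval Hd v)) = s" using e by (simp add: fun_upd_idem)
    moreover have "runs (compile Hd d) s (Suc 1) s"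
      unfolding compile.simps using e Lf by (intro runs_IfF runs_skip) auto
    ultimately show ?thesis using runs_le by fastforce
  next
    case (Nd a b)
    have sza: "sz a \<le> N" "sz b \<le> N" using Nd Hd.prems(2) by auto
    have 1: "runs (Pop d) s 1 (s(d := enc a @ enc b))"
      using e Nd by (intro runs_Pop) auto
    have 2: "runs (split_top d (d+1) (d+2)) (s(d := enc a @ enc b)) (5 * N + 2)
        (s(d := enc b, d+1 := rev (enc a)))"
      using e sza by (intro runs_split[where a = a and r = "enc b"]) (auto simp: fun_eq_iff)
    have 3: "runs (clear d) (s(d := enc b, d+1 := rev (enc a))) (2 * N + 1)
        (s(d := [], d+1 := rev (enc a)))"
      using sza set_enc by (intro runs_clear_le) auto
    have 4: "runs (move_rev (d+1) d) (s(d := [], d+1 := rev (enc a))) (4 * N + 1) (s(d := enc a))"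
      using e sza set_enc by (intro runs_move_le) (auto simp: fun_eq_iff)
    have "runs (compile Hd d) s (Suc (1 + ((5 * N + 2) + ((2 * N + 1) + (4 * N + 1))))) (s(d := enc a))"
      unfolding compile.simps using e Nd
      by (intro runs_IfT runs_Seq[OF 1 runs_Seq[OF 2 runs_Seq[OF 3 4]]]) auto
    then show ?thesis unfolding Nd eval.simps hd_tree.simps by (rule runs_le) simp
  qed
next
  case Tl
  note e = Tl.prems(1)[unfolded enc_state_def]
  show ?case
  proof (cases v)
    case Lf
    then have "s(d := enc (eval Tl v)) = s" using e by (simp add: fun_upd_idem)
    moreover have "runs (compile Tl d) s (Suc 1) s"
      unfolding compile.simps using e Lf by (intro runs_IfF runs_skip) auto
    ultimately show ?thesis using runs_le by fastforce
  next
    case (Nd a b)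
    have sza: "sz a \<le> N" "sz b \<le> N" using Nd Tl.prems(2) by auto
    have 1: "runs (Pop d) s 1 (s(d := enc a @ enc b))"
      using e Nd by (intro runs_Pop) auto
    have 2: "runs (split_top d (d+1) (d+2)) (s(d := enc a @ enc b)) (5 * N + 2)
        (s(d := enc b, d+1 := rev (enc a)))"
      using e sza by (intro runs_split[where a = a and r = "enc b"]) (auto simp: fun_eq_iff)
    have 3: "runs (clear (d+1)) (s(d := enc b, d+1 := rev (enc a))) (2 * N + 1) (s(d := enc b))"
      using e sza set_enc by (intro runs_clear_le) (auto simp: fun_eq_iff)
    have "runs (compile Tl d) s (Suc (1 + ((5 * N + 2) + (2 * N + 1)))) (s(d := enc b))"
      unfolding compile.simps using e Nd
      by (intro runs_IfT runs_Seq[OF 1 runs_Seq[OF 2 3]]) auto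
    then show ?thesis unfolding Nd eval.simps tl_tree.simps by (rule runs_le) simp
  qed
next
  case LfC
  have "runs (clear d) s (2 * N + 1) (s(d := []))"
    using LfC.prems set_enc by (intro runs_clear_le) (auto simp: enc_state_def)
  moreover have "runs (Push d 1) (s(d := [])) 1 (s(d := enc (eval LfC v)))"
    by (intro runs_Push) auto
  ultimately have "runs (compile LfC d) s (2 * N + 1 + 1) (s(d := enc (eval LfC v)))"
    unfolding compile.simps by (rule runs_Seq)
  then show ?case by (rule runs_le) simp
next
  case (PairF f g)
  have oks: "ok N f v" "ok N g v" using PairF.prems(3) by auto
  show ?case unfolding eval.simps
    by (rule compile_Pair[OF PairF.prems(1,2) sz_eval_le[OF PairF.prems(2) oks(1)]
          sz_eval_le[OF PairF.prems(2) oks(2)] PairF.IH(1)[OF _ PairF.prems(2) oks(1)]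
          PairF.IH(2)[OF _ PairF.prems(2) oks(2)]]) simp_all
next
  case (Comp g f)
  have oks: "ok N f v" "ok (out_bound f N) g (eval f v)"
    using Comp.prems(3) ok_mono[OF out_bound_ge[of N f]] by auto
  let ?s = "s(d := enc (eval f v))"
  have e: "enc_state ?s d (eval f v)" using Comp.prems(1) by (auto simp: enc_state_def)
  have "?s(d := enc (eval g (eval f v))) = s(d := enc (eval (g \<diamondop> f) v))"
    by (simp add: fun_eq_iff)
  then show ?case
    using runs_Seq[OF Comp.IH(2)[OF Comp.prems(1,2) oks(1)] Comp.IH(1)[OF e sz_eval_le[OF Comp.prems(2) oks(1)] oks(2)]]
    unfolding compile.simps time_bound.simps by (simp only:)
next
  case (Cond c f g)
  let ?s = "s(d := enc (eval (Cond c f g) v))"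
  have okc: "ok N c v" using Cond.prems(3) by simp
  have 1: "runs (compile f d) s (time_bound f N + time_bound g N) ?s" if c: "eval c v \<noteq> Lf"
  proof -
    have okf: "ok N f v" using Cond.prems(3) c by simp
    show ?thesis unfolding eval.simps if_P[OF c]
      by (rule runs_le[OF Cond.IH(2)[OF Cond.prems(1,2) okf]]) simp
  qed
  have 2: "runs (compile g d) s (time_bound f N + time_bound g N) ?s" if c: "eval c v = Lf"
  proof -
    have okg: "ok N g v" and nc: "\<not> eval c v \<noteq> Lf" using Cond.prems(3) c by simp_all
    show ?thesis unfolding eval.simps if_not_P[OF nc]
      by (rule runs_le[OF Cond.IH(3)[OF Cond.prems(1,2) okg]]) simp
  qed
  show ?case
    by (rule compile_Cond[OF Cond.prems(1,2) sz_eval_le[OF Cond.prems(2) okc]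
          Cond.IH(1)[OF _ Cond.prems(2) okc] 1 2]) simp_all
next
  case (Eqf f g)
  have oks: "ok N f v" "ok N g v" using Eqf.prems(3) by auto
  show ?case unfolding eval.simps
    by (rule compile_Eqf[OF Eqf.prems(1,2) sz_eval_le[OF Eqf.prems(2) oks(1)]
          sz_eval_le[OF Eqf.prems(2) oks(2)] Eqf.IH(1)[OF _ Eqf.prems(2) oks(1)]
          Eqf.IH(2)[OF _ Eqf.prems(2) oks(2)]]) simp_all
next
  case (Fold l a b)
  note e = Fold.prems(1)[unfolded enc_state_def] and sv = Fold.prems(2)
  let ?L = "eval l v" and ?a = "eval a v" and ?r = "eval (Fold l a b) v"
  let ?A = "out_bound a N + N" and ?M = "out_bound l N"
  let ?W = "?A + ?M + N + 2"
  have iter: "n * x + 1 \<le> (k + 1) * x" if "n \<le> k" "1 \<le> x" for n k x :: nat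
    using add_mono[OF mult_le_mono1[OF that(1), of x] that(2)] by simp
  have oks: "ok N l v" "ok N a v" "fold_ok N (ok N b) (eval b) v ?a (elems ?L)"
    using Fold.prems(3) by auto
  have szs: "sz ?L \<le> ?M" "sz ?a \<le> ?A"
    using sz_eval_le[OF sv oks(1)] sz_eval_le[OF sv oks(2)] by auto
  have szr: "sz ?r \<le> ?A" using sz_eval_le[OF sv Fold.prems(3)] by simp
  let ?s1 = "s(d+1 := enc v)" and ?s2 = "s(d+1 := enc ?L)"
  let ?s3 = "?s2(d+2 := enc v)" and ?s4 = "?s2(d+2 := enc ?a)"
  let ?s5 = "?s4(d+1 := [1], d+2 := enc ?r)" and ?s6 = "s(d+2 := enc ?r)"
  let ?s7 = "s(d := [], d+2 := enc ?r)"
  have 1: "runs (copy_reg d (d+1) (d+2)) s (9 * N + 2) ?s1"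
    using e sv set_enc by (intro runs_copy) auto
  have 2: "runs (compile l (d+1)) ?s1 (time_bound l N) ?s2"
  proof -
    have "enc_state ?s1 (d+1) v" using e by (auto simp: enc_state_def)
    moreover have "?s1(d+1 := enc ?L) = ?s2" by simp
    ultimately show ?thesis using Fold.IH(1)[of ?s1 "d+1" v N] sv oks(1) by (simp only:)
  qed
  have 3: "runs (copy_reg d (d+2) (d+3)) ?s2 (9 * N + 2) ?s3"
    using e sv set_enc by (intro runs_copy) auto
  have 4: "runs (compile a (d+2)) ?s3 (time_bound a N) ?s4"
  proof -
    have "enc_state ?s3 (d+2) v" using e by (auto simp: enc_state_def)
    moreover have "?s3(d+2 := enc ?a) = ?s4" by simp
    ultimately show ?thesis using Fold.IH(2)[of ?s3 "d+2" v N] sv oks(2) by (simp only:)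
  qed
  have "runs (compile b (d+4)) s (time_bound b ?W) (s(d+4 := enc (eval b w)))"
    if "enc_state s (d+4) w" "ok N b w" "sz w \<le> ?W" for s w
    by (rule Fold.IH(3)[OF that(1,3) ok_mono[OF _ that(2)]]) simp
  note loop = compile_fold_loop[where P = "ok N b" and F = "eval b" and b = b, OF this sv le_add2]
  have "runs (WhileTop (d+1) {2}
       (Pop (d+1) ;; split_top (d+1) (d+3) (d+4) ;; copy_reg d (d+4) (d+5) ;; move_rev (d+3) (d+4) ;;
        Push (d+4) 2 ;; move_reg (d+2) (d+4) (d+3) ;; Push (d+4) 2 ;; compile b (d+4) ;;
        move_reg (d+4) (d+2) (d+3))) ?s4
     (length (elems ?L) * (time_bound b ?W + 9 * ?M + 17 * N + 8 * ?A + 20) + 1) ?s5"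
    unfolding eval.simps by (rule loop) (use e szs oks in auto)
  moreover have "length (elems ?L) * (time_bound b ?W + 9 * ?M + 17 * N + 8 * ?A + 20) + 1
      \<le> (?M + 1) * (time_bound b ?W + 9 * ?M + 17 * N + 8 * ?A + 20)"
    by (rule iter[OF le_trans[OF length_elems szs(1)]]) simp
  ultimately have 5: "runs (WhileTop (d+1) {2}
       (Pop (d+1) ;; split_top (d+1) (d+3) (d+4) ;; copy_reg d (d+4) (d+5) ;; move_rev (d+3) (d+4) ;;
        Push (d+4) 2 ;; move_reg (d+2) (d+4) (d+3) ;; Push (d+4) 2 ;; compile b (d+4) ;;
        move_reg (d+4) (d+2) (d+3))) ?s4
     ((?M + 1) * (time_bound b ?W + 9 * ?M + 17 * N + 8 * ?A + 20)) ?s5"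
    by (rule runs_le)
  have 6: "runs (clear (d+1)) ?s5 3 ?s6"
    using e by (intro runs_clear_le) (auto simp: fun_eq_iff)
  have 7: "runs (clear d) ?s6 (2 * N + 1) ?s7"
    using e sv set_enc by (intro runs_clear_le) (auto simp: fun_eq_iff)
  have 8: "runs (move_reg (d+2) d (d+1)) ?s7 (8 * ?A + 2) (s(d := enc ?r))"
    using e szr set_enc by (intro runs_movek) (auto simp: fun_eq_iff simp del: eval.simps)
  show ?case
    unfolding compile.simps
    by (rule runs_Seq_le[OF 1 runs_Seq[OF 2 runs_Seq[OF 3 runs_Seq[OF 4 runs_Seq[OF 5
        runs_Seq[OF 6 runs_Seq[OF 7 8]]]]]]]) (simp add: algebra_simps)
qed

section \<open>Polynomial bounds\<close>

definition poly_bounded :: "(nat \<Rightarrow> nat) \<Rightarrow> bool" where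
  "poly_bounded h \<longleftrightarrow> (\<exists>C d. \<forall>N. h N \<le> C * (N + 1) ^ d)"

lemma poly_bounded_le: "poly_bounded g \<Longrightarrow> (\<And>N. h N \<le> g N) \<Longrightarrow> poly_bounded h"
  unfolding poly_bounded_def using le_trans by blast

lemma poly_bounded_const: "poly_bounded (\<lambda>N. c)"
  unfolding poly_bounded_def by (intro exI[of _ c] exI[of _ 0]) simp

lemma poly_bounded_id: "poly_bounded (\<lambda>N. N)"
  unfolding poly_bounded_def by (intro exI[of _ 1]) simp

lemma poly_bounded_add:
  assumes "poly_bounded g" "poly_bounded h"
  shows "poly_bounded (\<lambda>N. g N + h N)"
proof -
  obtain C d C' d' where g: "\<And>N. g N \<le> C * (N + 1) ^ d" and h: "\<And>N. h N \<le> C' * (N + 1) ^ d'"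
    using assms unfolding poly_bounded_def by blast
  have "g N + h N \<le> (C + C') * (N + 1) ^ (d + d')" for N
  proof -
    have "(N + 1) ^ d \<le> (N + 1) ^ (d + d')" "(N + 1) ^ d' \<le> (N + 1) ^ (d + d')"
      by (auto intro!: power_increasing simp del: power_Suc)
    then show ?thesis
      using g[of N] h[of N] mult_le_mono2[of "(N+1)^d" _ C] mult_le_mono2[of "(N+1)^d'" _ C']
      unfolding add_mult_distrib by (meson add_mono le_trans)
  qed
  then show ?thesis unfolding poly_bounded_def by blast
qed

lemma poly_bounded_mult:
  assumes "poly_bounded g" "poly_bounded h"
  shows "poly_bounded (\<lambda>N. g N * h N)"
proof -
  obtain C d C' d' where g: "\<And>N. g N \<le> C * (N + 1) ^ d" and h: "\<And>N. h N \<le> C' * (N + 1) ^ d'"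
    using assms unfolding poly_bounded_def by blast
  have "g N * h N \<le> (C * C') * (N + 1) ^ (d + d')" for N
    using mult_le_mono[OF g[of N] h[of N]] by (simp add: power_add ac_simps)
  then show ?thesis unfolding poly_bounded_def by blast
qed

lemma poly_bounded_comp:
  assumes "poly_bounded g" "poly_bounded h"
  shows "poly_bounded (\<lambda>N. g (h N))"
proof -
  obtain C d C' d' where g: "\<And>N. g N \<le> C * (N + 1) ^ d" and h: "\<And>N. h N \<le> C' * (N + 1) ^ d'"
    using assms unfolding poly_bounded_def by blast
  have "g (h N) \<le> (C * (C' + 1) ^ d) * (N + 1) ^ (d' * d)" for N
  proof -
    have "h N + 1 \<le> (C' + 1) * (N + 1) ^ d'" 
    proof -
      have "1 \<le> (N + 1) ^ d'" by simp
      then have "h N + 1 \<le> C' * (N + 1) ^ d' + (N + 1) ^ d'" using h[of N] by linarith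
      then show ?thesis by (simp only: add_mult_distrib mult_1)
    qed
    then have "(h N + 1) ^ d \<le> ((C' + 1) * (N + 1) ^ d') ^ d" by (rule power_mono) simp
    then have "(h N + 1) ^ d \<le> (C' + 1) ^ d * (N + 1) ^ (d' * d)"
      by (simp only: power_mult_distrib power_mult)
    then show ?thesis using g[of "h N"] le_trans mult_le_mono2 by (simp only: mult.assoc)
  qed
  then show ?thesis unfolding poly_bounded_def by blast
qed

lemma poly_bounded_Suc: "poly_bounded h \<Longrightarrow> poly_bounded (\<lambda>N. Suc (h N))"
  using poly_bounded_add[of h "\<lambda>_. 1"] poly_bounded_const by simp

lemmas poly_bounded_intros = poly_bounded_Suc poly_bounded_Suc[OF poly_bounded_id] poly_bounded_const poly_bounded_id poly_bounded_add poly_bounded_mult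

lemma poly_bounded_out_bound: "poly_bounded (out_bound f)"
proof (induction f)
  case (Comp g f)
  then show ?case using poly_bounded_comp[of "out_bound g" "out_bound f"] by simp
qed (simp_all add: poly_bounded_intros)

lemma poly_bounded_time_bound: "poly_bounded (time_bound f)"
proof (induction f)
  case (Comp g f)
  then show ?case using poly_bounded_comp[of "time_bound g" "out_bound f"]
    by (simp add: poly_bounded_intros poly_bounded_out_bound)
next
  case (Fold l a b)
  have inner: "poly_bounded (\<lambda>N. out_bound a N + N + out_bound l N + N + 2)"
    by (intro poly_bounded_intros poly_bounded_out_bound)
  show ?case
  proof (rule poly_bounded_le)
    fix N show "time_bound (Fold l a b) N \<le> time_bound l N + time_bound a N + 20 * N + 8 * (out_bound a N + N) + 20 +
     (out_bound l N + 1) * (9 * out_bound l N + 9 * N + 8 * (out_bound a N + N) + 20 + 8 * out_bound a N + 8 * N +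
       time_bound b (out_bound a N + N + out_bound l N + N + 2))" by simp
  qed (intro poly_bounded_intros poly_bounded_out_bound poly_bounded_comp[OF Fold.IH(3) inner] Fold.IH(1,2))
qed (simp_all add: poly_bounded_intros poly_bounded_out_bound)

text \<open>The alphabet part of \<open>wf_scom\<close>. The number of stacks is fixed afterwards: a
  program mentions only finitely many.\<close>

fun pushes_ok :: "scom \<Rightarrow> bool" where
  "pushes_ok (Push i a) \<longleftrightarrow> a \<in> {1, 2, 3}"
| "pushes_ok (Pop i) \<longleftrightarrow> True"
| "pushes_ok (c1 ;; c2) \<longleftrightarrow> pushes_ok c1 \<and> pushes_ok c2"
| "pushes_ok (IfTop i A c1 c2) \<longleftrightarrow> pushes_ok c1 \<and> pushes_ok c2"
| "pushes_ok (WhileTop i A c) \<longleftrightarrow> pushes_ok c"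

lemma pushes_ok_wf: "pushes_ok c \<Longrightarrow> \<exists>k. wf_scom k c"
proof (induction c)
  case (Seq c1 c2)
  then show ?case using wf_scom_mono by (metis max.cobounded1 max.cobounded2 pushes_ok.simps(3) wf_scom.simps(3))
next
  case (IfTop i A c1 c2)
  then obtain k1 k2 where "wf_scom k1 c1" "wf_scom k2 c2" by auto
  then have "wf_scom (Suc i + k1 + k2) (IfTop i A c1 c2)"
    by (auto intro: wf_scom_mono[of k1] wf_scom_mono[of k2])
  then show ?case ..
next
  case (WhileTop i A c)
  then obtain k where "wf_scom k c" by auto
  then have "wf_scom (Suc i + k) (WhileTop i A c)" by (auto intro: wf_scom_mono)
  then show ?case ..
qed auto

lemma pushes_ok_compile: "pushes_ok (compile f d)"
  by (induction f arbitrary: d)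
    (simp_all add: skip_cmd_def clear_def move_rev_def move_rev2_def copy_reg_def move_reg_def split_top_def eqtest_def)

fun pushes :: "nat \<Rightarrow> nat list \<Rightarrow> scom" where
  "pushes i [] = skip_cmd i"
| "pushes i (x # xs) = Push i x ;; pushes i xs"

lemma runs_pushes: "runs (pushes i xs) s (length xs + 1) (s(i := rev xs @ s i))"
proof (induction xs arbitrary: s)
  case Nil
  then show ?case using runs_skip by (simp add: fun_upd_idem)
next
  case (Cons x xs)
  have "runs (pushes i (x # xs)) s (1 + (length xs + 1)) (s(i := x # s i, i := rev xs @ (s(i := x # s i)) i))"
    unfolding pushes.simps by (intro runs_Seq[OF runs_Push[OF refl order_refl]] Cons.IH)
  moreover have "s(i := x # s i, i := rev xs @ (s(i := x # s i)) i) = s(i := rev (x # xs) @ s i)"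
    by (auto simp: fun_eq_iff)
  moreover have "1 + (length xs + 1) = length (x # xs) + 1" by simp
  ultimately show ?case by (simp only:)
qed

lemma pushes_ok_pushes: "set xs \<subseteq> {1, 2, 3} \<Longrightarrow> pushes_ok (pushes i xs)"
  by (induction xs) (auto simp: skip_cmd_def)

definition lst :: "tree list \<Rightarrow> tree" where "lst xs = foldr Nd xs Lf"

lemma lst_simps [simp]: "lst [] = Lf" "lst (x # xs) = Nd x (lst xs)"
  by (simp_all add: lst_def)

lemma elems_lst [simp]: "elems (lst xs) = xs"
  by (induction xs) auto

lemma lst_elems [simp]: "lst (elems v) = v"
  by (induction v) auto

text \<open>Unary numbers as lists of leaves, so that arithmetic consists of folds over
  lists.\<close>

definition num :: "nat \<Rightarrow> tree" where "num n = lst (replicate n Lf)"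

text \<open>The shift by one turns each bit into its own numeral: the symbols 1 and 2 become 0 and
  1, and the separator becomes 2.\<close>

definition symt :: "nat \<Rightarrow> tree" where "symt a = num (a - 1)"

lemma symt_simps: "symt 1 = Lf" "symt 2 = Nd Lf Lf" "symt 3 = Nd Lf (Nd Lf Lf)"
  by (simp_all add: symt_def num_def eval_nat_numeral)

text \<open>Stack 0 has the last input symbol on top, so putting the popped symbols in front of the
  list on stack 1 restores the order. The initial 1 is the code of the empty list.\<close>

definition read_input :: scom where
  "read_input = Push 1 1 ;; WhileTop 0 {1, 2, 3}
     (IfTop 0 {1} (Pop 0 ;; pushes 1 (rev (2 # enc (symt 1))))
       (IfTop 0 {2} (Pop 0 ;; pushes 1 (rev (2 # enc (symt 2))))
                 (Pop 0 ;; pushes 1 (rev (2 # enc (symt 3))))))"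

text \<open>The nested tests follow the codes 1, 211 and 21211 of the three symbols.\<close>

definition write_output :: scom where
  "write_output = WhileTop 1 {2} (Pop 1 ;; IfTop 1 {1} (Pop 1 ;; Push 0 1)
     (Pop 1 ;; Pop 1 ;; IfTop 1 {1} (Pop 1 ;; Push 0 2) (Pop 1 ;; Pop 1 ;; Pop 1 ;; Push 0 3))) ;; Pop 1"

lemma sz_symt: "a \<in> {1, 2, 3} \<Longrightarrow> sz (symt a) \<le> 5"
  by (auto simp: symt_simps simp del: One_nat_def)

lemma runs_read_loop:
  assumes "set w \<subseteq> {1, 2, 3}" "s 0 = w" "s 1 = enc v"
  shows "runs (WhileTop 0 {1, 2, 3}
     (IfTop 0 {1} (Pop 0 ;; pushes 1 (rev (2 # enc (symt 1))))
       (IfTop 0 {2} (Pop 0 ;; pushes 1 (rev (2 # enc (symt 2))))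
                 (Pop 0 ;; pushes 1 (rev (2 # enc (symt 3))))))) s (20 * length w + 1)
     (s(0 := [], 1 := enc (lst (rev (map symt w) @ elems v))))"
  using assms
proof (induction w arbitrary: s v)
  case Nil
  have eq: "s(0 := [], 1 := enc (lst (rev (map symt []) @ elems v))) = s"
    using Nil by (auto simp: fun_eq_iff)
  show ?case unfolding eq by (rule runs_le[OF runs_WhileF]) (use Nil in auto)
next
  case (Cons a w)
  let ?s = "s(0 := w, 1 := enc (Nd (symt a) v))"
  let ?b = "IfTop 0 {1} (Pop 0 ;; pushes 1 (rev (2 # enc (symt 1))))
       (IfTop 0 {2} (Pop 0 ;; pushes 1 (rev (2 # enc (symt 2))))
                 (Pop 0 ;; pushes 1 (rev (2 # enc (symt 3)))))"
  have p: "runs (Pop 0 ;; pushes 1 (rev (2 # enc (symt a)))) s (1 + 7) ?s"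
  proof (rule runs_Seq[OF runs_Pop[OF refl order_refl]])
    have "sz (symt a) \<le> 5" using Cons.prems(1) by (intro sz_symt) auto
    then show "runs (pushes 1 (rev (2 # enc (symt a)))) (s(0 := tl (s 0))) 7 ?s"
      using runs_pushes[of 1 "rev (2 # enc (symt a))" "s(0 := tl (s 0))"] Cons.prems(2,3)
      by (auto intro: runs_le)
  qed
  have "a = 1 \<or> a = 2 \<or> a = 3" using Cons.prems(1) by auto
  then have step: "runs ?b s (Suc (Suc (1 + 7))) ?s"
  proof (elim disjE)
    assume a: "a = 1"
    have "runs ?b s (Suc (1 + 7)) ?s"
      using p Cons.prems(2) unfolding a by (intro runs_IfT) auto
    then show ?thesis by (rule runs_le) simp
  next
    assume a: "a = 2"
    show ?thesis using p Cons.prems(2) unfolding a by (intro runs_IfF[OF _ runs_IfT]) auto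
  next
    assume a: "a = 3"
    show ?thesis using p Cons.prems(2) unfolding a by (intro runs_IfF[OF _ runs_IfF]) auto
  qed
  have loop: "runs (WhileTop 0 {1, 2, 3} ?b) ?s (20 * length w + 1)
     (?s(0 := [], 1 := enc (lst (rev (map symt w) @ elems (Nd (symt a) v)))))"
    using Cons.prems by (intro Cons.IH) auto
  have eq: "?s(0 := [], 1 := enc (lst (rev (map symt w) @ elems (Nd (symt a) v)))) =
    s(0 := [], 1 := enc (lst (rev (map symt (a # w)) @ elems v)))"
    by (auto simp: fun_eq_iff)
  have top: "top_sym s 0 \<in> {1, 2, 3}" using Cons.prems by auto
  show ?case by (rule runs_le[OF runs_WhileT[OF top step loop[unfolded eq]]]) simp
qed

lemma runs_read_input:
  assumes "set w \<subseteq> {1, 2, 3}"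
  shows "runs read_input ((\<lambda>_::nat. [])(0 := rev w)) (20 * length w + 2) ((\<lambda>_::nat. [])(1 := enc (lst (map symt w))))"
proof -
  let ?s = "(\<lambda>_::nat. [])(0 := rev w)"
  have "runs (Push 1 1) ?s 1 (?s(1 := [1]))" by (intro runs_Push) auto
  moreover note runs_read_loop[of "rev w" "?s(1 := [1])" Lf]
  moreover have "?s(1 := [1], 0 := [], 1 := enc (lst (rev (map symt (rev w)) @ elems Lf))) =
      (\<lambda>_::nat. [])(1 := enc (lst (map symt w)))" by (auto simp: fun_eq_iff rev_map)
  ultimately show ?thesis unfolding read_input_def using assms
    by (intro runs_Seq_le) auto
qed

lemma runs_write_loop:
  assumes "set w \<subseteq> {1, 2, 3}" "s 1 = enc (lst (map symt w))"
  shows "runs (WhileTop 1 {2} (Pop 1 ;; IfTop 1 {1} (Pop 1 ;; Push 0 1)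
     (Pop 1 ;; Pop 1 ;; IfTop 1 {1} (Pop 1 ;; Push 0 2) (Pop 1 ;; Pop 1 ;; Pop 1 ;; Push 0 3)))) s
     (20 * length w + 1) (s(0 := rev w @ s 0, 1 := [1]))"
  using assms
proof (induction w arbitrary: s)
  case Nil
  then have eq: "s(0 := rev [] @ s 0, 1 := [1]) = s" by (auto simp: fun_eq_iff)
  show ?case unfolding eq by (rule runs_le[OF runs_WhileF]) (use Nil in auto)
next
  case (Cons a w)
  let ?i = "IfTop 1 {1} (Pop 1 ;; Push 0 2) (Pop 1 ;; Pop 1 ;; Pop 1 ;; Push 0 3)"
  let ?b = "Pop 1 ;; IfTop 1 {1} (Pop 1 ;; Push 0 1) (Pop 1 ;; Pop 1 ;; ?i)"
  let ?s = "s(0 := a # s 0, 1 := enc (lst (map symt w)))"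
  let ?r = "enc (lst (map symt w))"
  have s1: "s 1 = 2 # enc (symt a) @ ?r" using Cons.prems(2) by simp
  have "a = 1 \<or> a = 2 \<or> a = 3" using Cons.prems(1) by auto
  then have b: "runs ?b s 10 ?s"
  proof (elim disjE)
    assume a: "a = 1"
    have "runs ?b s (1 + Suc (1 + 1)) ?s"
      using s1 unfolding a symt_simps
      by (intro runs_Seq[OF runs_Pop[OF refl order_refl]] runs_IfT
        runs_Seq[OF runs_Pop[OF refl order_refl] runs_Push]) (auto simp: fun_eq_iff)
    then show ?thesis by (rule runs_le) simp
  next
    assume a: "a = 2"
    have "runs ?b s (1 + Suc (1 + (1 + Suc (1 + 1)))) ?s"
      using s1 unfolding a symt_simps
      by (intro runs_Seq[OF runs_Pop[OF refl order_refl] runs_IfF]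
          runs_Seq[OF runs_Pop[OF refl order_refl] runs_Seq[OF runs_Pop[OF refl order_refl]]] runs_IfT
        runs_Seq[OF runs_Pop[OF refl order_refl] runs_Push]) (auto simp: fun_eq_iff)
    then show ?thesis by (rule runs_le) simp
  next
    assume a: "a = 3"
    have "runs ?b s (1 + Suc (1 + (1 + Suc (1 + (1 + (1 + 1)))))) ?s"
      using s1 unfolding a symt_simps
      by (intro runs_Seq[OF runs_Pop[OF refl order_refl] runs_IfF]
          runs_Seq[OF runs_Pop[OF refl order_refl] runs_Seq[OF runs_Pop[OF refl order_refl] runs_IfF]]
        runs_Seq[OF runs_Pop[OF refl order_refl] runs_Seq[OF runs_Pop[OF refl order_refl]
          runs_Seq[OF runs_Pop[OF refl order_refl] runs_Push]]]) (auto simp: fun_eq_iff)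
    then show ?thesis by (rule runs_le) simp
  qed
  have loop: "runs (WhileTop 1 {2} ?b) ?s (20 * length w + 1) (?s(0 := rev w @ ?s 0, 1 := [1]))"
    using Cons.prems by (intro Cons.IH) auto
  have eq: "?s(0 := rev w @ ?s 0, 1 := [1]) = s(0 := rev (a # w) @ s 0, 1 := [1])"
    by (auto simp: fun_eq_iff)
  have top: "top_sym s 1 \<in> {2}" using s1 by simp
  show ?case by (rule runs_le[OF runs_WhileT[OF top b loop[unfolded eq]]]) simp
qed

lemma runs_write_output:
  assumes "set w \<subseteq> {1, 2, 3}"
  shows "runs write_output ((\<lambda>_::nat. [])(1 := enc (lst (map symt w)))) (20 * length w + 2) ((\<lambda>_::nat. [])(0 := rev w))"
proof -
  let ?s = "(\<lambda>_::nat. [])(1 := enc (lst (map symt w)))"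
  note runs_write_loop[of w ?s]
  moreover have "runs (Pop 1) (?s(0 := rev w @ ?s 0, 1 := [1])) 1 ((\<lambda>_::nat. [])(0 := rev w))"
    by (intro runs_Pop) (auto simp: fun_eq_iff)
  ultimately show ?thesis unfolding write_output_def using assms
    by (intro runs_Seq_le) auto
qed

lemma length_le_sz_lst: "length xs \<le> sz (lst xs)"
  using length_elems[of "lst xs"] by simp

text \<open>\<open>M\<close>, \<open>C\<close> and \<open>d\<close> are chosen before
  \<open>N\<close>. A bound on accumulators that varies with the instance thus becomes a time bound
  for one fixed machine.\<close>

theorem fn_turing_machine:
  "\<exists>M C d. wf_tm M \<and> (\<forall>w v N. set w \<subseteq> {1, 2, 3} \<and> set v \<subseteq> {1, 2, 3} \<and>
     eval f (lst (map symt w)) = lst (map symt v) \<and> sz (lst (map symt w)) \<le> N \<and>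
     ok N f (lst (map symt w)) \<longrightarrow>
     (\<exists>t tape h. t \<le> C * (N + 1) ^ d \<and> tm_run M t (initial_config w) = (1, tape, h) \<and>
        tape_output tape v))"
proof -
  define c where "c = read_input ;; compile f 1 ;; write_output"
  have "pushes_ok c"
    unfolding c_def read_input_def write_output_def
    by (auto simp: pushes_ok_compile symt_simps skip_cmd_def intro!: pushes_ok_pushes simp del: One_nat_def)
  then obtain k where "wf_scom k c" using pushes_ok_wf by blast
  then have wf: "wf_scom (Suc k) c" by (rule wf_scom_mono) simp
  define T where "T N = (20 * N + 2) + (time_bound f N + (20 * out_bound f N + 2))" for N
  have "poly_bounded (\<lambda>N. (T N + 1) * (2 * (N + T N) + 6))"
    unfolding T_def by (intro poly_bounded_intros poly_bounded_time_bound poly_bounded_out_bound)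
  then obtain C d where Cd: "\<And>N. (T N + 1) * (2 * (N + T N) + 6) \<le> C * (N + 1) ^ d"
    unfolding poly_bounded_def by blast
  have "\<exists>t tape h. t \<le> C * (N + 1) ^ d \<and> tm_run (scom_tm (Suc k) c) t (initial_config w) = (1, tape, h) \<and>
        tape_output tape v"
    if w: "set w \<subseteq> {1, 2, 3}" "set v \<subseteq> {1, 2, 3}" and ev: "eval f (lst (map symt w)) = lst (map symt v)"
      and N: "sz (lst (map symt w)) \<le> N" "ok N f (lst (map symt w))" for w v N
  proof -
    have lw: "length w \<le> N" using length_le_sz_lst[of "map symt w"] N(1) by simp
    have lv: "length v \<le> out_bound f N"
      using length_le_sz_lst[of "map symt v"] sz_eval_le[OF N] ev by simp
    have "runs read_input ((\<lambda>_::nat. [])(0 := rev w)) (20 * N + 2) ((\<lambda>_::nat. [])(1 := enc (lst (map symt w))))"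
      using runs_le[OF runs_read_input[OF w(1)]] lw by simp
    moreover have "runs (compile f 1) ((\<lambda>_::nat. [])(1 := enc (lst (map symt w)))) (time_bound f N)
        ((\<lambda>_::nat. [])(1 := enc (lst (map symt w)), 1 := enc (eval f (lst (map symt w)))))"
      using N by (intro compile_correct) (auto simp: enc_state_def)
    then have "runs (compile f 1) ((\<lambda>_::nat. [])(1 := enc (lst (map symt w)))) (time_bound f N)
        ((\<lambda>_::nat. [])(1 := enc (lst (map symt v))))" by (simp add: ev)
    moreover have "runs write_output ((\<lambda>_::nat. [])(1 := enc (lst (map symt v)))) (20 * out_bound f N + 2) ((\<lambda>_::nat. [])(0 := rev v))"
      using runs_le[OF runs_write_output[OF w(2)]] lv by simp
    ultimately have "runs c ((\<lambda>_::nat. [])(0 := rev w)) (T N) ((\<lambda>_::nat. [])(0 := rev v))"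
      unfolding c_def T_def by (intro runs_Seq)
    then obtain t where t: "t \<le> T N" "bs c ((\<lambda>_::nat. [])(0 := rev w)) t ((\<lambda>_::nat. [])(0 := rev v))"
      unfolding runs_def by blast
    obtain t' tape h where "t' \<le> (t + 1) * (2 * (length w + t) + 6)"
      "tm_run (scom_tm (Suc k) c) t' (initial_config w) = (1, tape, h)" "tape_output tape v"
      using scom_tm_run[OF wf _ w(1) t(2)] by auto
    moreover have "(t + 1) * (2 * (length w + t) + 6) \<le> (T N + 1) * (2 * (N + T N) + 6)"
      using t(1) lw by (intro mult_le_mono) auto
    ultimately show ?thesis using Cd[of N] by (meson le_trans)
  qed
  moreover have "wf_tm (scom_tm (Suc k) c)" using wf_scom_tm[OF wf] by simp
  ultimately show ?thesis
    by (intro exI[of _ "scom_tm (Suc k) c"] exI[of _ C] exI[of _ d]) (auto simp only:)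
qed

section \<open>Balanced schedules\<close>

lemma sum_two:
  fixes f :: "'a \<Rightarrow> nat"
  assumes "finite S" "a \<in> S" "b \<in> S" "a \<noteq> b"
  shows "sum f S = f a + f b + sum f (S - {a, b})"
proof -
  have "sum f S = sum f ({a, b} \<union> (S - {a, b}))" using assms by (intro arg_cong[of _ _ "sum f"]) auto
  also have "\<dots> = sum f {a, b} + sum f (S - {a, b})" using assms by (intro sum.union_disjoint) auto
  finally show ?thesis using assms(4) by simp
qed

lemma sum_fun_upd2:
  fixes F :: "'a \<Rightarrow> 'b \<Rightarrow> nat"
  assumes "finite S" "a \<in> S" "b \<in> S" "a \<noteq> b"
  shows "(\<Sum>k\<in>S. F k ((r(a := u, b := v)) k)) = F a u + F b v + (\<Sum>k\<in>S - {a, b}. F k (r k))"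
  using sum_two[OF assms, of "\<lambda>k. F k ((r(a := u, b := v)) k)"] assms(4) by (auto intro: sum.cong)

definition feasible :: "nat \<Rightarrow> nat \<Rightarrow> (nat \<Rightarrow> nat) \<Rightarrow> nat \<Rightarrow> (nat \<Rightarrow> nat \<Rightarrow> nat) \<Rightarrow> bool" where
  "feasible m P c T x \<longleftrightarrow> (\<forall>j\<in>{1..P}. (\<Sum>i<m. x i j) = c j) \<and> (\<forall>i<m. (\<Sum>j\<in>{1..P}. j * x i j) \<le> T)"

text \<open>Balanced configurations are found by minimising this sum of squares among the feasible
  ones.\<close>

definition potential :: "nat \<Rightarrow> nat \<Rightarrow> (nat \<Rightarrow> nat \<Rightarrow> nat) \<Rightarrow> nat" where
  "potential m P x = (\<Sum>i<m. \<Sum>j\<in>{1..P}. (x i j)\<^sup>2)"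

lemma square_transfer:
  fixes q b e :: nat
  assumes "0 < b" "0 < e"
  shows "(q + e)\<^sup>2 + (q + b)\<^sup>2 < (q + b + e)\<^sup>2 + q\<^sup>2"
proof -
  have "(q + b + e)\<^sup>2 + q\<^sup>2 = (q + e)\<^sup>2 + (q + b)\<^sup>2 + 2 * b * e"
    by (simp add: power2_eq_square algebra_simps)
  then show ?thesis using assms by simp
qed

lemma square_transfer_diff:
  fixes p q b :: nat
  assumes "0 < b" "q + b < p"
  shows "(p - b)\<^sup>2 + (q + b)\<^sup>2 < p\<^sup>2 + q\<^sup>2"
proof -
  obtain e where "p = q + b + e" "0 < e" using less_imp_add_positive[OF assms(2)] by auto
  then show ?thesis using square_transfer[OF assms(1), of e q] by simp
qed

text \<open>Only the rows \<open>i\<close> and \<open>i'\<close> change, so column sums, loads and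
  potential have to be compared on these two rows only.\<close>

lemma exchange_two_rows:
  assumes x: "feasible m P c T x" and ij: "i < m" "i' < m" "i \<noteq> i'"
    and col: "\<And>j. j \<in> {1..P} \<Longrightarrow> r j + r' j = x i j + x i' j"
    and load: "(\<Sum>j\<in>{1..P}. j * r j) \<le> T" "(\<Sum>j\<in>{1..P}. j * r' j) \<le> T"
    and pot: "(\<Sum>j\<in>{1..P}. (r j)\<^sup>2 + (r' j)\<^sup>2) < (\<Sum>j\<in>{1..P}. (x i j)\<^sup>2 + (x i' j)\<^sup>2)"
  shows "\<exists>y. feasible m P c T y \<and> potential m P y < potential m P x"
proof (intro exI conjI)
  let ?y = "x(i := r, i' := r')"
  note S = finite_lessThan[of m] and mem = lessThan_iff[THEN iffD2, OF ij(1)] lessThan_iff[THEN iffD2, OF ij(2)]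
  have "(\<Sum>k<m. ?y k j) = c j" if "j \<in> {1..P}" for j
    using sum_fun_upd2[OF S mem ij(3), of "\<lambda>_ v. v j" x r r'] sum_two[OF S mem ij(3), of "\<lambda>k. x k j"]
      col[OF that] x that unfolding feasible_def by simp
  moreover have "\<forall>k<m. (\<Sum>j\<in>{1..P}. j * ?y k j) \<le> T"
    using x load unfolding feasible_def by simp
  ultimately show "feasible m P c T ?y" unfolding feasible_def by blast
  show "potential m P ?y < potential m P x"
    using sum_fun_upd2[OF S mem ij(3), of "\<lambda>_ v. \<Sum>j\<in>{1..P}. (v j)\<^sup>2" x r r']
      sum_two[OF S mem ij(3), of "\<lambda>k. \<Sum>j\<in>{1..P}. (x k j)\<^sup>2"] pot
    unfolding potential_def by (simp add: sum.distrib)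
qed

text \<open>The term \<open>P * P * P\<close> covers the load by which all other sizes together can
  favour the second machine if each of them occurs there at most \<open>P\<close> times more often;
  \<open>P + 1\<close> leaves room to move up to \<open>P\<close> jobs and still decrease the
  potential.\<close>

definition gap :: "nat \<Rightarrow> nat" where "gap P = P * P * P + P + 1"

text \<open>Since \<open>b\<close> jobs of size \<open>a\<close> weigh as much as \<open>a\<close> jobs of size \<open>b\<close>, two machines whose
  configurations differ a lot can be made more similar without changing any load, or else one of them
  has a much larger load and can hand over a single job.\<close>

lemma balanced_feasible:
  assumes "feasible m P c T x0"
  obtains x where "feasible m P c T x"
    "\<And>i i' j. i < m \<Longrightarrow> i' < m \<Longrightarrow> j \<in> {1..P} \<Longrightarrow> x i j \<le> x i' j + gap P"
proof -
  obtain x where x: "feasible m P c T x" and min: "\<And>y. feasible m P c T y \<Longrightarrow> potential m P x \<le> potential m P y"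
    using ex_has_least_nat[of "feasible m P c T" x0 "potential m P"] assms by blast
  have "x i a \<le> x i' a + gap P" if ij: "i < m" "i' < m" and a: "a \<in> {1..P}" for i i' a
  proof (rule ccontr)
    assume "\<not> x i a \<le> x i' a + gap P"
    then have big: "x i' a + gap P < x i a" by simp
    then have ne: "i \<noteq> i'" by auto
    have aP: "1 \<le> a" "a \<le> P" using a by auto
    note S = finite_atLeastAtMost[of 1 P]
    have "\<exists>y. feasible m P c T y \<and> potential m P y < potential m P x"
    proof (cases "\<exists>b\<in>{1..P}. x i b + P < x i' b")
      case True
      then obtain b where b: "b \<in> {1..P}" "x i b + P < x i' b" by blast
      have bP: "1 \<le> b" "b \<le> P" using b by auto
      have ab: "a \<noteq> b" using big b(2) by auto
      let ?r = "(x i)(a := x i a - b, b := x i b + a)"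
      let ?r' = "(x i')(a := x i' a + b, b := x i' b - a)"
      have xa: "b \<le> x i a" "a \<le> x i' b" using big b(2) aP bP unfolding gap_def by auto
      then obtain d e where de: "x i a = b + d" "x i' b = a + e" using le_Suc_ex by metis
      show ?thesis
      proof (rule exchange_two_rows[OF x ij ne, of ?r ?r'])
        show "?r j + ?r' j = x i j + x i' j" for j
          using xa ab by simp
        have "(\<Sum>j\<in>{1..P}. j * ?r j) = (\<Sum>j\<in>{1..P}. j * x i j)"
          using sum_fun_upd2[OF S a b(1) ab, of "\<lambda>j v. j * v" "x i"]
            sum_two[OF S a b(1) ab, of "\<lambda>j. j * x i j"] de ab
          by (simp add: algebra_simps)
        then show "(\<Sum>j\<in>{1..P}. j * ?r j) \<le> T" using x ij unfolding feasible_def by simp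
        have "(\<Sum>j\<in>{1..P}. j * ?r' j) = (\<Sum>j\<in>{1..P}. j * x i' j)"
          using sum_fun_upd2[OF S a b(1) ab, of "\<lambda>j v. j * v" "x i'"]
            sum_two[OF S a b(1) ab, of "\<lambda>j. j * x i' j"] de ab
          by (simp add: algebra_simps)
        then show "(\<Sum>j\<in>{1..P}. j * ?r' j) \<le> T" using x ij unfolding feasible_def by simp
        have "(x i a - b)\<^sup>2 + (x i' a + b)\<^sup>2 < (x i a)\<^sup>2 + (x i' a)\<^sup>2"
          using big bP unfolding gap_def by (intro square_transfer_diff) auto
        moreover have "(x i' b - a)\<^sup>2 + (x i b + a)\<^sup>2 < (x i' b)\<^sup>2 + (x i b)\<^sup>2"
          using b(2) aP by (intro square_transfer_diff) auto
        ultimately show "(\<Sum>j\<in>{1..P}. (?r j)\<^sup>2 + (?r' j)\<^sup>2) < (\<Sum>j\<in>{1..P}. (x i j)\<^sup>2 + (x i' j)\<^sup>2)"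
          using sum_fun_upd2[OF S a b(1) ab, of "\<lambda>j v. v\<^sup>2" "x i" "x i a - b" "x i b + a"]
            sum_fun_upd2[OF S a b(1) ab, of "\<lambda>j v. v\<^sup>2" "x i'" "x i' a + b" "x i' b - a"]
            sum_two[OF S a b(1) ab, of "\<lambda>j. (x i j)\<^sup>2"] sum_two[OF S a b(1) ab, of "\<lambda>j. (x i' j)\<^sup>2"]
          unfolding sum.distrib by linarith
      qed
    next
      case False
      then have le: "x i' j \<le> x i j + P" if "j \<in> {1..P}" for j using that by force
      let ?r = "(x i)(a := x i a - 1)" and ?r' = "(x i')(a := x i' a + 1)"
      \<comment> \<open>Each of the other sizes gives \<open>i'\<close> at most \<open>P * P\<close>
        more load than \<open>i\<close>. The surplus of more than \<open>gap P\<close> jobs of size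
        \<open>a\<close> on \<open>i\<close> pays for all of this and still leaves at least
        \<open>a\<close>, the weight of the job to be handed over.\<close>
      have load_le: "(\<Sum>j\<in>{1..P}. j * x i' j) + a \<le> (\<Sum>j\<in>{1..P}. j * x i j)"
      proof -
        have "(\<Sum>j\<in>{1..P} - {a}. j * x i' j) \<le> (\<Sum>j\<in>{1..P} - {a}. j * x i j + P * P)"
        proof (rule sum_mono)
          fix j assume j: "j \<in> {1..P} - {a}"
          have "j * x i' j \<le> j * x i j + j * P" using mult_le_mono2[OF le, of j j] j by (simp add: algebra_simps)
          moreover have "j * P \<le> P * P" using j by (intro mult_le_mono1) simp
          ultimately show "j * x i' j \<le> j * x i j + P * P" by linarith
        qed
        also have "\<dots> \<le> (\<Sum>j\<in>{1..P} - {a}. j * x i j) + P * (P * P)"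
          using a by (simp add: sum.distrib)
        finally have 1: "(\<Sum>j\<in>{1..P} - {a}. j * x i' j) \<le> (\<Sum>j\<in>{1..P} - {a}. j * x i j) + P * (P * P)" .
        have "a * (x i' a + (P * (P * P) + 1)) \<le> a * x i a"
          using big by (intro mult_le_mono2) (simp add: gap_def algebra_simps)
        moreover have "P * (P * P) \<le> a * (P * (P * P))" using aP(1) by simp
        ultimately have "a * x i' a + (P * (P * P) + a) \<le> a * x i a"
          by (simp only: distrib_left mult_1_right)
        with 1 show ?thesis
          using sum.remove[OF S a, of "\<lambda>j. j * x i j"] sum.remove[OF S a, of "\<lambda>j. j * x i' j"] by linarith
      qed
      show ?thesis
      proof (rule exchange_two_rows[OF x ij ne, of ?r ?r'])
        show "?r j + ?r' j = x i j + x i' j" for j using big by simp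
        have "(\<Sum>j\<in>{1..P}. j * ?r j) \<le> (\<Sum>j\<in>{1..P}. j * x i j)"
          by (intro sum_mono) simp
        then show "(\<Sum>j\<in>{1..P}. j * ?r j) \<le> T" using x ij unfolding feasible_def by (meson le_trans)
        have "(\<Sum>j\<in>{1..P}. j * ?r' j) = (\<Sum>j\<in>{1..P}. j * x i' j) + a"
          using sum.remove[OF S a, of "\<lambda>j. j * ?r' j"] sum.remove[OF S a, of "\<lambda>j. j * x i' j"] by simp
        then show "(\<Sum>j\<in>{1..P}. j * ?r' j) \<le> T"
          using load_le x ij unfolding feasible_def by (metis le_trans)
        have "(x i a - 1)\<^sup>2 + (x i' a + 1)\<^sup>2 < (x i a)\<^sup>2 + (x i' a)\<^sup>2"
          using big unfolding gap_def by (intro square_transfer_diff) auto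
        then show "(\<Sum>j\<in>{1..P}. (?r j)\<^sup>2 + (?r' j)\<^sup>2) < (\<Sum>j\<in>{1..P}. (x i j)\<^sup>2 + (x i' j)\<^sup>2)"
          using sum.remove[OF S a, of "\<lambda>j. (?r j)\<^sup>2 + (?r' j)\<^sup>2"]
            sum.remove[OF S a, of "\<lambda>j. (x i j)\<^sup>2 + (x i' j)\<^sup>2"] by simp
      qed
    qed
    then show False using min by (meson not_less)
  qed
  then show ?thesis using that x by blast
qed

text \<open>The \<open>t\<close>-th copy of \<open>v\<close> is placed according to the key \<open>t / count M v\<close>.\<close>

lemma proportional_order:
  fixes M :: "'a multiset"
  defines "N \<equiv> size M" and "K \<equiv> card (set_mset M)"
  obtains w where "mset w = M"
    "\<And>k v. k \<le> N \<Longrightarrow> N * count (mset (take k w)) v \<le> k * count M v + K * N"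
    "\<And>k v. k \<le> N \<Longrightarrow> k * count M v \<le> N * count (mset (take k w)) v + K * N"
proof -
  define A where "A = (SIGMA v:set_mset M. {1..count M v})"
  have fA: "finite A" unfolding A_def by (intro finite_SigmaI) auto
  define key :: "'a \<times> nat \<Rightarrow> real" where "key = (\<lambda>(v, t). real t / real (count M v))"
  obtain zs where zs: "set zs = A" "distinct zs" using finite_distinct_list[OF fA] by blast
  define ys where "ys = sort_key key zs"
  have ys: "set ys = A" "distinct ys" "sorted (map key ys)" using zs by (auto simp: ys_def)
  define w where "w = map fst ys"
  have cnt: "count (mset (map fst xs)) v = card {t. (v, t) \<in> set xs}" if "distinct xs" for xs :: "('a \<times> nat) list" and v
    using that
  proof (induction xs)
    case (Cons x xs)
    obtain v' t' where x: "x = (v', t')" by (cases x)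
    have fin: "finite {t. (v, t) \<in> set xs}" by (rule finite_subset[of _ "snd ` set xs"]) force+
    show ?case
    proof (cases "v' = v")
      case True
      have "{t. (v, t) \<in> set (x # xs)} = insert t' {t. (v, t) \<in> set xs}" using x True by auto
      then show ?thesis using Cons x True fin by simp
    next
      case False
      have "{t. (v, t) \<in> set (x # xs)} = {t. (v, t) \<in> set xs}" using x False by auto
      then show ?thesis using Cons x False by simp
    qed
  qed simp
  have "mset w = M"
  proof (rule multiset_eqI)
    fix v
    have "{t. (v, t) \<in> A} = {1..count M v}" unfolding A_def by (auto simp flip: count_greater_zero_iff)
    then show "count (mset w) v = count M v" unfolding w_def cnt[OF ys(2)] ys(1) by simp
  qed
  then have len: "length ys = N" unfolding N_def w_def by (metis length_map size_mset)
  have main: "real (N * count (mset (take k w)) v) \<le> real (k * count M v + K * N) \<and>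
      real (k * count M v) \<le> real (N * count (mset (take k w)) v + K * N)" if k: "k \<le> N" for k v
  proof (cases "k = 0 \<or> v \<notin># M")
    case True
    moreover have "?thesis" if nv: "v \<notin># M"
    proof -
      have "count (mset (take k w)) v = 0"
        using nv \<open>mset w = M\<close> in_set_takeD[of v k w] by (auto simp: count_eq_zero_iff)
      moreover have "count M v = 0" using nv by (simp add: not_in_iff)
      ultimately show ?thesis by (simp only: mult_0_right) simp
    qed
    ultimately show ?thesis by auto
  next
    case False
    then have k0: "0 < k" and v: "v \<in># M" by auto
    \<comment> \<open>The last key of the prefix. Every copy with a smaller key has been placed and
      none with a larger one, so each kind \<open>u\<close> has been placed
      \<open>\<theta> * count M u\<close> times up to an error of one.\<close>
    define \<theta> where "\<theta> = key (ys ! (k - 1))"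
    have kl: "k - 1 < length ys" using k k0 len by simp
    have "ys ! (k - 1) \<in> A" using kl ys(1) nth_mem by blast
    then have \<theta>: "0 < \<theta>" "\<theta> \<le> 1" unfolding \<theta>_def key_def A_def by (auto simp: divide_le_eq)
    define C where "C u = count (mset (take k w)) u" for u
    have C: "C u = card {t. (u, t) \<in> set (take k ys)}" for u
      unfolding C_def w_def take_map using cnt[of "take k ys"] ys(2) by simp
    have before: "key y \<le> \<theta>" if y: "y \<in> set (take k ys)" for y
    proof -
      obtain j where "j < k" "y = ys ! j" "j < length ys" using y by (auto simp: in_set_conv_nth)
      then show ?thesis unfolding \<theta>_def using sorted_nth_mono[OF ys(3), of j "k - 1"] kl by simp
    qed
    have after: "\<theta> \<le> key y" if y: "y \<in> A" "y \<notin> set (take k ys)" for y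
    proof -
      obtain j where j: "j < length ys" "y = ys ! j" using y ys(1) by (metis in_set_conv_nth)
      then have "k \<le> j" using y(2) by (metis in_set_conv_nth length_take min_less_iff_conj not_less nth_take)
      then show ?thesis unfolding \<theta>_def using sorted_nth_mono[OF ys(3), of "k - 1" j] kl j by simp
    qed
    have up: "real (C u) \<le> \<theta> * count M u" if u: "u \<in># M" for u
    proof -
      have cu: "0 < count M u" using u by simp
      have "{t. (u, t) \<in> set (take k ys)} \<subseteq> {1..nat \<lfloor>\<theta> * count M u\<rfloor>}"
      proof
        fix t assume "t \<in> {t. (u, t) \<in> set (take k ys)}"
        then have t: "(u, t) \<in> set (take k ys)" by simp
        then have "1 \<le> t" using ys(1) set_take_subset[of k ys] unfolding A_def by auto
        moreover have "real t \<le> \<theta> * count M u" using before[OF t] cu by (simp add: key_def divide_le_eq)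
        ultimately show "t \<in> {1..nat \<lfloor>\<theta> * count M u\<rfloor>}" by (simp add: le_nat_floor)
      qed
      then have "C u \<le> nat \<lfloor>\<theta> * count M u\<rfloor>" unfolding C using card_mono[of "{1..nat \<lfloor>\<theta> * count M u\<rfloor>}"] by force
      then show ?thesis using \<theta>(1) by (smt (verit) of_nat_0_le_iff mult_nonneg_nonneg of_nat_floor of_nat_mono)
    qed
    have lo: "\<theta> * count M u - 1 \<le> real (C u)" if u: "u \<in># M" for u
    proof -
      have cu: "0 < count M u" using u by simp
      have "{1..<nat \<lceil>\<theta> * count M u\<rceil>} \<subseteq> {t. (u, t) \<in> set (take k ys)}"
      proof
        fix t assume t: "t \<in> {1..<nat \<lceil>\<theta> * count M u\<rceil>}"
        then have lt: "real t < \<theta> * count M u" by (simp add: less_ceiling_iff zless_nat_eq_int_zless)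
        also have "\<dots> \<le> count M u" using \<theta> by (simp add: mult_left_le_one_le)
        finally have "(u, t) \<in> A" using t u unfolding A_def by simp
        moreover have "key (u, t) < \<theta>" using lt cu by (simp add: key_def divide_less_eq)
        ultimately show "t \<in> {t. (u, t) \<in> set (take k ys)}" using after by fastforce
      qed
      moreover have "finite {t. (u, t) \<in> set (take k ys)}"
        by (rule finite_subset[of _ "snd ` set (take k ys)"]) force+
      ultimately have "nat \<lceil>\<theta> * count M u\<rceil> - 1 \<le> C u" unfolding C by (metis card_atLeastLessThan card_mono)
      then show ?thesis by linarith
    qed
    have size: "(\<Sum>u\<in>set_mset M. C u) = k"
    proof -
      have "(\<Sum>u\<in>set_mset M. C u) = size (mset (take k w))"
      proof (subst size_multiset_overloaded_eq, rule sum.mono_neutral_cong_right)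
        show "set_mset (mset (take k w)) \<subseteq> set_mset M" using \<open>mset w = M\<close> by (auto dest: in_set_takeD)
      qed (auto simp: C_def count_eq_zero_iff)
      then show ?thesis using k len by (simp add: w_def)
    qed
    have tot: "(\<Sum>u\<in>set_mset M. \<theta> * count M u) = \<theta> * N"
      unfolding N_def size_multiset_overloaded_eq by (simp add: sum_distrib_left)
    \<comment> \<open>Adding up the counts of all \<open>K\<close> kinds pins
      \<open>\<theta> * N\<close> to the interval from \<open>k\<close> to \<open>k + K\<close>, so
      that the unknown key can be eliminated in favour of \<open>k\<close>.\<close>
    have "real k \<le> \<theta> * N"
      unfolding tot[symmetric] size[symmetric] of_nat_sum by (intro sum_mono up) auto
    moreover have "\<theta> * N - K \<le> k"
    proof -
      have "(\<Sum>u\<in>set_mset M. \<theta> * count M u - 1) \<le> (\<Sum>u\<in>set_mset M. real (C u))"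
        by (intro sum_mono lo) auto
      then show ?thesis using tot size by (simp add: sum_subtractf K_def flip: of_nat_sum)
    qed
    ultimately have k_bounds: "real k \<le> \<theta> * N" "\<theta> * N \<le> k + K" by auto
    have cN: "count M v \<le> N" unfolding N_def by (rule count_le_size)
    have K1: "1 \<le> K" unfolding K_def using v by (metis Suc_leI card_gt_0_iff empty_iff finite_set_mset One_nat_def)
    have "N * C v \<le> \<theta> * N * count M v" using mult_left_mono[OF up[OF v], of "real N"] by (simp add: algebra_simps)
    also have "\<dots> \<le> (k + K) * real (count M v)" using k_bounds(2) by (intro mult_right_mono) auto
    also have "\<dots> \<le> k * count M v + K * real N" using cN by (simp add: distrib_right mult_left_mono)
    finally have 1: "real N * real (C v) \<le> k * count M v + K * real N" by simp
    have "real k * count M v \<le> \<theta> * N * count M v" using k_bounds(1) by (intro mult_right_mono) auto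
    also have "\<dots> \<le> N * (C v + 1)" using mult_left_mono[OF lo[OF v], of "real N"] by (simp add: algebra_simps)
    also have "\<dots> \<le> N * C v + K * real N" using K1 mult_right_mono[of 1 "real K" "real N"] by (simp add: distrib_left)
    finally have 2: "real k * real (count M v) \<le> N * C v + K * real N" by simp
    show ?thesis using 1 2 unfolding C_def by simp
  qed
  show ?thesis using that[OF \<open>mset w = M\<close>] main of_nat_le_iff by blast
qed

section \<open>Sequences in which every prefix is nearly proportional\<close>

definition bag :: "nat \<Rightarrow> (nat \<Rightarrow> nat) \<Rightarrow> nat multiset" where
  "bag P r = (\<Sum>j\<in>{1..P}. replicate_mset (r j) j)"

lemma count_bag: "count (bag P r) j = (if j \<in> {1..P} then r j else 0)"
proof -
  have "count (bag P r) j = (\<Sum>l\<in>{1..P}. if l = j then r l else 0)"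
    unfolding bag_def count_sum by (intro sum.cong) auto
  then show ?thesis by (simp add: sum.delta)
qed

lemma size_bag: "size (bag P r) = (\<Sum>j\<in>{1..P}. r j)"
proof -
  have "size (\<Sum>j\<in>A. replicate_mset (r j) j) = (\<Sum>j\<in>A. r j)" if "finite A" for A
    using that by (induction A) auto
  then show ?thesis unfolding bag_def by simp
qed

lemma sum_mset_bag: "sum_mset (bag P r) = (\<Sum>j\<in>{1..P}. j * r j)"
proof -
  have "sum_mset (\<Sum>j\<in>A. replicate_mset (r j) j) = (\<Sum>j\<in>A. j * r j)" if "finite A" for A
    using that by (induction A) (auto simp: sum_mset_replicate_mset)
  then show ?thesis unfolding bag_def by simp
qed

lemma card_set_bag: "card (set_mset (bag P r)) \<le> P"
proof -
  have "set_mset (bag P r) \<subseteq> {1..P}"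
    by (auto simp: count_bag simp flip: count_greater_zero_iff split: if_splits)
  from card_mono[OF _ this] show ?thesis by simp
qed

lemma size_eq_sum_count:
  assumes "set_mset M \<subseteq> A" "finite A"
  shows "size M = (\<Sum>a\<in>A. count M a)"
  unfolding size_multiset_overloaded_eq
  by (rule sum.mono_neutral_left) (use assms in \<open>auto simp: not_in_iff\<close>)

text \<open>A prefix of the job sequence consists of complete machines and a part of one further
  machine; the two parts are estimated separately.\<close>

lemma take_concat:
  "k \<le> length (concat xss) \<Longrightarrow> xss \<noteq> [] \<Longrightarrow> \<exists>i k'. i < length xss \<and> k' \<le> length (xss ! i) \<and>
    take k (concat xss) = concat (take i xss) @ take k' (xss ! i)"
proof (induction xss arbitrary: k)
  case (Cons xs xss)
  show ?case
  proof (cases "k \<le> length xs")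
    case True
    then show ?thesis by (intro exI[of _ 0] exI[of _ k]) simp
  next
    case False
    then have "xss \<noteq> []" "k - length xs \<le> length (concat xss)" using Cons.prems by auto
    then obtain i k' where "i < length xss" "k' \<le> length (xss ! i)"
      "take (k - length xs) (concat xss) = concat (take i xss) @ take k' (xss ! i)"
      using Cons.IH by blast
    then show ?thesis using False by (intro exI[of _ "Suc i"] exI[of _ k']) simp
  qed
qed simp

text \<open>Here \<open>q l\<close> is the average number of jobs of size \<open>l\<close> per
  machine, \<open>U l\<close> their number on the \<open>i\<close> complete machines of the prefix,
  \<open>r\<close> the row of the machine that the prefix cuts, and \<open>s\<close> counts size
  \<open>j\<close> among the \<open>k'\<close> jobs taken from it. The complete machines contribute
  an error of \<open>(P + 1) * E\<close>, the deviation of \<open>r\<close> from the average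
  contributes \<open>(P + 1) * g\<close>, and the order within the machine contributes
  \<open>P\<close>.\<close>

lemma window_arith:
  fixes q r U :: "nat \<Rightarrow> real" and P j :: nat and i E g s k' Q R :: real
  defines "Q \<equiv> \<Sum>l\<in>{1..P}. q l" and "R \<equiv> \<Sum>l\<in>{1..P}. r l"
  assumes q: "\<And>l. 0 \<le> q l" "0 < Q" and j: "j \<in> {1..P}"
    and U: "\<And>l. l \<in> {1..P} \<Longrightarrow> \<bar>U l - i * q l\<bar> \<le> E"
    and r: "\<And>l. l \<in> {1..P} \<Longrightarrow> \<bar>r l - q l\<bar> \<le> g" "\<And>l. 0 \<le> r l"
    and s: "R * s \<le> k' * r j + P * R" "0 \<le> k'" "k' \<le> R" "s \<le> k'" and E: "0 \<le> E" "0 \<le> g"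
  shows "(U j + s) * Q \<le> ((\<Sum>l\<in>{1..P}. U l) + k') * q j + ((real P + 1) * (E + g) + P) * Q"
proof -
  \<comment> \<open>The share of size \<open>j\<close> among all jobs. Each part is compared with
    \<open>\<beta>\<close> times its number of jobs; an error per size counts once directly and up
    to \<open>P\<close> times through that number, which explains the factor
    \<open>P + 1\<close>.\<close>
  define \<beta> where "\<beta> = q j / Q"
  have "q j \<le> Q" unfolding Q_def by (rule member_le_sum[OF j]) (use q in auto)
  then have \<beta>: "0 \<le> \<beta>" "\<beta> \<le> 1" "q j = \<beta> * Q" using q unfolding \<beta>_def by auto
  have dev: "\<bar>(\<Sum>l\<in>{1..P}. f l) - c * Q\<bar> \<le> P * e" if "\<And>l. l \<in> {1..P} \<Longrightarrow> \<bar>f l - c * q l\<bar> \<le> e"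
    for f :: "nat \<Rightarrow> real" and c e :: real
  proof -
    have "\<bar>\<Sum>l\<in>{1..P}. f l - c * q l\<bar> \<le> (\<Sum>l\<in>{1..P}. e)"
      using that by (intro order_trans[OF sum_abs] sum_mono) auto
    then show ?thesis by (simp add: sum_subtractf Q_def sum_distrib_left)
  qed
  have prod_le: "\<bar>\<beta> * y\<bar> \<le> z" if "\<bar>y\<bar> \<le> z" for y z
    using mult_mono[OF \<beta>(2) that] \<beta>(1) by (simp add: abs_mult)
  have 1: "U j - \<beta> * (\<Sum>l\<in>{1..P}. U l) \<le> E + P * E"
    using U[OF j] prod_le[OF dev[of U i E, OF U]] \<beta>(3) by (simp add: algebra_simps abs_le_iff)
  have 2: "r j - \<beta> * R \<le> g + P * g"
    using r(1)[OF j] prod_le[OF dev[of r 1 g]] r(1) \<beta>(3) unfolding R_def by (simp add: algebra_simps abs_le_iff)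
  have 3: "s - \<beta> * k' \<le> P + (g + P * g)"
  proof (cases "R = 0")
    case True
    then have "k' = 0" using s by simp
    then show ?thesis using s E by (simp add: add_nonneg_nonneg order_trans[of s 0])
  next
    case False
    then have R: "0 < R" using s by simp
    have "R * (s - \<beta> * k') \<le> k' * (r j - \<beta> * R) + P * R" using s(1) by (simp add: algebra_simps)
    also have "\<dots> \<le> k' * (g + P * g) + P * R" using 2 s(2) by (intro add_right_mono mult_left_mono)
    also have "\<dots> \<le> R * (g + P * g) + P * R" using E s(3) by (intro add_right_mono mult_right_mono) auto
    finally have "R * (s - \<beta> * k') \<le> R * (P + (g + P * g))" by (simp add: algebra_simps)
    then show ?thesis using R by simp
  qed
  have "U j + s \<le> \<beta> * ((\<Sum>l\<in>{1..P}. U l) + k') + ((real P + 1) * (E + g) + P)"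
    using 1 3 by (simp add: algebra_simps)
  then have "(U j + s) * Q \<le> (\<beta> * ((\<Sum>l\<in>{1..P}. U l) + k') + ((real P + 1) * (E + g) + P)) * Q"
    using q(2) by (intro mult_right_mono) auto
  then show ?thesis unfolding \<beta>(3) by (simp add: algebra_simps)
qed

text \<open>The number of kinds of machines: after balancing, each of the \<open>P\<close> entries
  of a row ranges over \<open>gap P + 1\<close> values.\<close>

definition rows_bound :: "nat \<Rightarrow> nat" where "rows_bound P = (gap P + 1) ^ P"

text \<open>With \<open>K = rows_bound P\<close>, a proportional order of the machines misplaces
  each of the \<open>K\<close> kinds by at most \<open>K\<close> copies, and rows differ by at most
  \<open>gap P\<close> in each entry; this gives \<open>K * K * gap P\<close> for the complete
  machines. The other \<open>gap P\<close> and the final \<open>P\<close> come from the machine that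
  the prefix cuts, as in \<open>window_arith\<close>.\<close>

definition window :: "nat \<Rightarrow> nat" where
  "window P = (P + 1) * (rows_bound P * rows_bound P * gap P + gap P) + P"

text \<open>Used twice: for the kinds of balanced machines and for the job multisets that fit the
  windows.\<close>

lemma card_box:
  fixes lo :: "nat \<Rightarrow> nat"
  shows "finite {f. (\<forall>j\<in>{1..P}. lo j \<le> f j \<and> f j \<le> lo j + g) \<and> (\<forall>j. j \<notin> {1..P} \<longrightarrow> f j = (0::nat))}"
    "card {f. (\<forall>j\<in>{1..P}. lo j \<le> f j \<and> f j \<le> lo j + g) \<and> (\<forall>j. j \<notin> {1..P} \<longrightarrow> f j = (0::nat))} \<le> (g + 1) ^ P"
proof -
  let ?S = "{f. (\<forall>j\<in>{1..P}. lo j \<le> f j \<and> f j \<le> lo j + g) \<and> (\<forall>j. j \<notin> {1..P} \<longrightarrow> f j = (0::nat))}"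
  let ?T = "PiE {1..P} (\<lambda>j. {lo j..lo j + g})"
  have fin: "finite ?T" by (intro finite_PiE) auto
  have sub: "?S \<subseteq> (\<lambda>h j. if j \<in> {1..P} then h j else 0) ` ?T"
  proof
    fix f assume f: "f \<in> ?S"
    then have "restrict f {1..P} \<in> ?T" by auto
    moreover have "f = (\<lambda>j. if j \<in> {1..P} then restrict f {1..P} j else 0)" using f by auto
    ultimately show "f \<in> (\<lambda>h j. if j \<in> {1..P} then h j else 0) ` ?T" by blast
  qed
  show "finite ?S" using sub fin finite_surj by blast
  have "card ?S \<le> card ?T" using surj_card_le[OF fin sub] .
  then show "card ?S \<le> (g + 1) ^ P" by (simp add: card_PiE)
qed

text \<open>\<open>proportional_order\<close> is applied on two levels, to the multiset of rows and
  to the jobs of each row. The order \<open>jl\<close> within a machine depends on its row alone, so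
  machines of one kind contribute identical blocks and the prefix counts reduce to counting
  kinds.\<close>

lemma balanced_sequence:
  fixes x :: "nat \<Rightarrow> nat \<Rightarrow> nat"
  assumes m: "1 \<le> m"
    and bal: "\<And>i i' j. i < m \<Longrightarrow> i' < m \<Longrightarrow> j \<in> {1..P} \<Longrightarrow> x i j \<le> x i' j + gap P"
    and load: "\<And>i. i < m \<Longrightarrow> (\<Sum>j\<in>{1..P}. j * x i j) \<le> T"
  obtains css where "length css = m" "\<And>c. c \<in> set css \<Longrightarrow> sum_list c \<le> T"
    "\<And>j. count (mset (concat css)) j = (if j \<in> {1..P} then (\<Sum>i<m. x i j) else 0)"
    "\<And>k j. k \<le> length (concat css) \<Longrightarrow> length (concat css) * count (mset (take k (concat css))) j
       \<le> k * count (mset (concat css)) j + window P * length (concat css)"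
proof -
  define row where "row i = (\<lambda>j. if j \<in> {1..P} then x i j else 0)" for i
  define M where "M = image_mset row (mset_set {..<m})"
  have sizeM: "size M = m" unfolding M_def by simp
  have setM: "set_mset M = row ` {..<m}" unfolding M_def by simp
  define K where "K = card (set_mset M)"
  obtain w where w: "mset w = M"
    "\<And>k v. k \<le> m \<Longrightarrow> m * count (mset (take k w)) v \<le> k * count M v + K * m"
    "\<And>k v. k \<le> m \<Longrightarrow> k * count M v \<le> m * count (mset (take k w)) v + K * m"
    using proportional_order[of M] unfolding sizeM K_def by metis
  have K: "K \<le> rows_bound P"
  proof -
    define lo where "lo j = Min ((\<lambda>i. x i j) ` {..<m})" for j
    have lo: "lo j \<le> x i j" "x i j \<le> lo j + gap P" if "i < m" "j \<in> {1..P}" for i j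
    proof -
      show "lo j \<le> x i j" unfolding lo_def using that by (intro Min_le) auto
      have "lo j \<in> (\<lambda>i. x i j) ` {..<m}" unfolding lo_def using m by (intro Min_in) (auto simp: lessThan_empty_iff bot_nat_def)
      then show "x i j \<le> lo j + gap P" using bal that by auto
    qed
    have "set_mset M \<subseteq> {f. (\<forall>j\<in>{1..P}. lo j \<le> f j \<and> f j \<le> lo j + gap P) \<and> (\<forall>j. j \<notin> {1..P} \<longrightarrow> f j = 0)}"
      unfolding setM row_def using lo by auto
    then show ?thesis unfolding K_def rows_bound_def using card_box card_mono le_trans by meson
  qed
  have "\<exists>l. mset l = bag P r \<and> (\<forall>k j. k \<le> size (bag P r) \<longrightarrow>
      size (bag P r) * count (mset (take k l)) j \<le> k * count (bag P r) j + P * size (bag P r))" for r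
  proof -
    obtain l where "mset l = bag P r" and l: "\<And>k j. k \<le> size (bag P r) \<Longrightarrow>
       size (bag P r) * count (mset (take k l)) j \<le> k * count (bag P r) j + card (set_mset (bag P r)) * size (bag P r)"
      using proportional_order[of "bag P r"] by metis
    moreover have "card (set_mset (bag P r)) * size (bag P r) \<le> P * size (bag P r)"
      using card_set_bag by (intro mult_le_mono1)
    ultimately show ?thesis by (meson add_left_mono le_trans)
  qed
  then obtain jl where jl: "\<And>r. mset (jl r) = bag P r"
    "\<And>r k j. k \<le> size (bag P r) \<Longrightarrow>
      size (bag P r) * count (mset (take k (jl r))) j \<le> k * count (bag P r) j + P * size (bag P r)"
    by metis
  define css where "css = map jl w"
  have lw: "length w = m" using w(1) sizeM by (metis size_mset)
  have setw: "set w = row ` {..<m}" using w(1) setM by (metis set_mset_mset)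
  have sum_w: "count (mset (concat (map jl ws))) j = (\<Sum>v\<in>set_mset M. count (mset ws) v * (if j \<in> {1..P} then v j else 0))"
    if "set ws \<subseteq> set_mset M" for ws j
    using that
  proof (induction ws)
    case (Cons v ws)
    have "(\<Sum>u\<in>set_mset M. count (mset (v # ws)) u * (if j \<in> {1..P} then u j else 0)) =
      (\<Sum>u\<in>set_mset M. (if u = v then (if j \<in> {1..P} then u j else 0) else 0) +
          count (mset ws) u * (if j \<in> {1..P} then u j else 0))"
      by (intro sum.cong) auto
    then show ?case using Cons by (simp add: sum.distrib sum.delta jl(1) count_bag)
  qed simp
  have cnt: "count (mset (concat css)) j = (if j \<in> {1..P} then (\<Sum>i<m. x i j) else 0)" for j
  proof -
    have "count (mset (concat (map jl ws))) j = (\<Sum>v\<in>#mset ws. count (bag P v) j)" for ws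
      by (induction ws) (simp_all add: jl(1))
    then have "count (mset (concat css)) j = (\<Sum>i\<in>#mset_set {..<m}. count (bag P (row i)) j)"
      unfolding css_def using w(1) by (simp add: M_def multiset.map_comp comp_def del: mset_concat)
    then show ?thesis by (simp add: count_bag row_def sum_unfold_sum_mset)
  qed
  let ?n = "length (concat css)"
  have win: "?n * count (mset (take k (concat css))) j \<le> k * count (mset (concat css)) j + window P * ?n"
    if k: "k \<le> ?n" for k j
  proof (cases "j \<in> {1..P} \<and> 0 < ?n")
    case False
    have "count (mset (take k (concat css))) j = 0" if "j \<notin> {1..P}"
      using cnt[of j] that in_set_takeD[of j k "concat css"] by (auto simp: count_eq_zero_iff simp del: set_concat)
    then have "?n = 0 \<or> count (mset (take k (concat css))) j = 0" using False by (meson neq0_conv)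
    then show ?thesis using k by (elim disjE) (simp_all only: mult_0_right mult_0 le0 le_0_eq take_0 mset.simps count_empty)
  next
    case True
    then have j: "j \<in> {1..P}" and n0: "0 < ?n" by auto
    obtain i k' where ik: "i < m" "k' \<le> length (jl (w ! i))"
      "take k (concat css) = concat (map jl (take i w)) @ take k' (jl (w ! i))"
    proof -
      have "css \<noteq> []" "length css = m" using m lw unfolding css_def by auto
      then obtain i k' where "i < m" "k' \<le> length (css ! i)"
        "take k (concat css) = concat (take i css) @ take k' (css ! i)"
        using take_concat[OF k] by metis
      then show ?thesis using that[of i k'] lw unfolding css_def by (simp add: take_map)
    qed
    define r where "r = w ! i"
    have rM: "r \<in># M" using ik(1) lw w(1) unfolding r_def by (metis nth_mem set_mset_mset)
    have tw: "set (take i w) \<subseteq> set_mset M" using w(1) by (auto dest: in_set_takeD)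
    define C where "C v = count (mset (take i w)) v" for v
    define U where "U l = (\<Sum>v\<in>set_mset M. C v * v l)" for l
    define c where "c l = (\<Sum>v\<in>set_mset M. count M v * v l)" for l
    define s where "s = count (mset (take k' (jl r))) j"
    have cc: "count (mset (concat css)) l = c l" if "l \<in> {1..P}" for l
      unfolding css_def c_def using sum_w[of w l] w(1) that by (auto simp del: mset_concat)
    have uu: "count (mset (take k (concat css))) l = U l + count (mset (take k' (jl r))) l" if "l \<in> {1..P}" for l
      unfolding ik(3) U_def C_def r_def[symmetric] using sum_w[OF tw, of l] that by simp
    have sub: "set (concat css) \<subseteq> {1..P}" using cnt by (metis (no_types, lifting) count_mset_0_iff subsetI)
    have "?n = (\<Sum>l\<in>{1..P}. count (mset (concat css)) l)"
      using size_eq_sum_count[of "mset (concat css)" "{1..P}"] sub by (simp del: set_concat)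
    then have n_sum: "?n = (\<Sum>l\<in>{1..P}. c l)" using cc by simp
    have "k = length (take k (concat css))" using k by simp
    also have "\<dots> = length (concat (map jl (take i w))) + k'"
      unfolding ik(3) using ik(2) by simp
    also have "length (concat (map jl (take i w))) =
        (\<Sum>l\<in>{1..P}. count (mset (concat (map jl (take i w)))) l)"
    proof -
      have "set (concat (map jl (take i w))) \<subseteq> {1..P}"
        using order_trans[OF set_take_subset[of k "concat css"] sub] unfolding ik(3) set_append by blast
      then show ?thesis
        using size_eq_sum_count[of "mset (concat (map jl (take i w)))" "{1..P}"] by (simp del: set_concat)
    qed
    also have "\<dots> = (\<Sum>l\<in>{1..P}. U l)"
      unfolding U_def C_def by (intro sum.cong refl) (simp add: sum_w[OF tw])
    finally have k_sum: "k = (\<Sum>l\<in>{1..P}. U l) + k'" .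
    have diffs: "\<bar>real (v l) - real (u l)\<bar> \<le> gap P" if "v \<in># M" "u \<in># M" "l \<in> {1..P}" for u v l
      using that bal unfolding setM row_def by (fastforce simp: abs_le_iff)
    have sumC: "(\<Sum>v\<in>set_mset M. C v) = i"
      unfolding C_def using size_eq_sum_count[of "mset (take i w)" "set_mset M"] tw ik(1) lw by simp
    have sumM: "(\<Sum>v\<in>set_mset M. count M v) = m"
      using size_eq_sum_count[of M "set_mset M"] sizeM by simp
    have m0: "0 < real m" using m by simp
    have devU: "\<bar>real (U l) - real i * (real (c l) / m)\<bar> \<le> K * K * gap P" if l: "l \<in> {1..P}" for l
    proof -
      define D where "D v = real m * C v - real i * count M v" for v
      have D: "\<bar>D v\<bar> \<le> K * m" for v
      proof -
        have "real (m * C v) \<le> real (i * count M v + K * m)" "real (i * count M v) \<le> real (m * C v + K * m)"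
          using w(2,3)[of i v] ik(1) unfolding C_def of_nat_le_iff by simp_all
        then show ?thesis unfolding D_def by (simp add: abs_le_iff)
      qed
      \<comment> \<open>As the deviations sum to 0, the row \<open>r\<close> may be subtracted from
        every \<open>v\<close> below. This replaces the entries, which can be large, by differences
        of at most \<open>gap P\<close>.\<close>
      have D0: "(\<Sum>v\<in>set_mset M. D v) = 0"
        unfolding D_def sum_subtractf sum_distrib_left[symmetric] of_nat_sum[symmetric] sumC sumM by simp
      have "real m * U l - real i * c l = (\<Sum>v\<in>set_mset M. D v * v l)"
        unfolding U_def c_def D_def by (simp add: sum_distrib_left sum_subtractf algebra_simps)
      also have "\<dots> = (\<Sum>v\<in>set_mset M. D v * (real (v l) - real (r l)))"
        using D0 by (simp add: right_diff_distrib sum_subtractf flip: sum_distrib_right)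
      also have "\<bar>\<dots>\<bar> \<le> (\<Sum>v\<in>set_mset M. real (K * m) * gap P)"
      proof (intro order_trans[OF sum_abs] sum_mono)
        fix v assume "v \<in> set_mset M"
        then show "\<bar>D v * (real (v l) - real (r l))\<bar> \<le> real (K * m) * gap P"
          unfolding abs_mult using D[of v] diffs[OF _ rM l] by (intro mult_mono) auto
      qed
      also have "\<dots> = m * (K * K * gap P)" unfolding K_def by simp
      finally have "\<bar>real m * U l - real i * c l\<bar> \<le> real m * (K * K * gap P)" by simp
      moreover have "real m * U l - real i * c l = m * (real (U l) - real i * (real (c l) / m))"
        using m0 by (simp add: field_simps)
      ultimately show ?thesis using m0 by (simp add: abs_mult)
    qed
    have devr: "\<bar>real (r l) - real (c l) / m\<bar> \<le> gap P" if l: "l \<in> {1..P}" for l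
    proof -
      have "real m * (real (r l) - real (c l) / m) = real m * r l - c l" using m0 by (simp add: field_simps)
      also have "\<dots> = (\<Sum>v\<in>set_mset M. count M v * (real (r l) - real (v l)))"
        unfolding c_def sumM[symmetric] by (simp add: sum_distrib_right sum_subtractf right_diff_distrib)
      also have "\<bar>\<dots>\<bar> \<le> (\<Sum>v\<in>set_mset M. real (count M v) * gap P)"
      proof (intro order_trans[OF sum_abs] sum_mono)
        fix v assume "v \<in> set_mset M"
        then show "\<bar>count M v * (real (r l) - real (v l))\<bar> \<le> real (count M v) * gap P"
          unfolding abs_mult using diffs[OF rM _ l, of v] by (intro mult_mono) auto
      qed
      also have "\<dots> = m * gap P" unfolding sumM[symmetric] by (simp add: sum_distrib_right)
      finally show ?thesis using m0 by (simp add: abs_mult)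
    qed
    have Q: "(\<Sum>l\<in>{1..P}. real (c l) / m) = ?n / m"
      unfolding n_sum by (simp add: sum_divide_distrib)
    have rsum: "size (bag P r) = (\<Sum>l\<in>{1..P}. r l)" by (rule size_bag)
    have kl: "k' \<le> size (bag P r)" using ik(2) jl(1) unfolding r_def by (metis size_mset)
    have s1: "(\<Sum>l\<in>{1..P}. real (r l)) * s \<le> real k' * r j + real P * (\<Sum>l\<in>{1..P}. real (r l))"
    proof -
      have "real (size (bag P r) * s) \<le> real (k' * r j + P * size (bag P r))"
        using jl(2)[OF kl, of j] j unfolding s_def of_nat_le_iff by (simp add: count_bag)
      then show ?thesis unfolding rsum by simp
    qed
    have s2: "s \<le> k'"
      unfolding s_def by (rule le_trans[OF count_le_size]) simp
    have "(real (U j) + s) * (\<Sum>l\<in>{1..P}. real (c l) / m) \<le>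
       ((\<Sum>l\<in>{1..P}. real (U l)) + k') * (real (c j) / m) +
       ((real P + 1) * (real (K * K * gap P) + gap P) + P) * (\<Sum>l\<in>{1..P}. real (c l) / m)"
    proof (rule window_arith[where r = "\<lambda>l. real (r l)" and i = "real i", OF _ _ j])
      show "0 < (\<Sum>l\<in>{1..P}. real (c l) / m)" unfolding Q using n0 m0 by simp
      show "real k' \<le> (\<Sum>l\<in>{1..P}. real (r l))" using kl unfolding rsum by (simp flip: of_nat_sum)
    qed (use devU devr s1 s2 in auto)
    then have "(real (U j) + s) * ?n \<le> k * c j +
       ((real P + 1) * (real (K * K * gap P) + gap P) + P) * ?n"
      using m0 unfolding Q k_sum by (simp add: divide_simps flip: of_nat_sum)
    also have "\<dots> \<le> k * c j + window P * ?n"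
    proof -
      have "(P + 1) * (K * K * gap P + gap P) + P \<le> window P"
        unfolding window_def using K by (intro add_right_mono mult_le_mono2 mult_le_mono1 mult_le_mono)
      then have "real ((P + 1) * (K * K * gap P + gap P) + P) \<le> window P" by (simp only: of_nat_le_iff)
      then have "((real P + 1) * (real (K * K * gap P) + gap P) + P) \<le> window P"
        by (simp only: of_nat_add of_nat_mult of_nat_1)
      then show ?thesis using add_left_mono[OF mult_right_mono] by fastforce
    qed
    finally have "real (?n * (U j + s)) \<le> real (k * c j + window P * ?n)" by (simp add: mult.commute)
    then show ?thesis unfolding cc[OF j] uu[OF j] s_def of_nat_le_iff .
  qed
  show ?thesis
  proof (rule that[of css])
    show "sum_list c \<le> T" if c: "c \<in> set css" for c
    proof -
      obtain i where "i < m" "c = jl (row i)" using c setw unfolding css_def by auto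
      moreover have "sum_list (jl (row i)) = (\<Sum>j\<in>{1..P}. j * x i j)"
        using jl(1) sum_mset_bag[of P "row i"] unfolding row_def by (simp flip: sum_mset_sum_list)
      ultimately show ?thesis using load by simp
    qed
  qed (use lw css_def cnt win in auto)
qed

section \<open>From schedules to balanced job sequences\<close>

definition job_count :: "nat list \<Rightarrow> (nat \<Rightarrow> nat) \<Rightarrow> nat \<Rightarrow> nat \<Rightarrow> nat" where
  "job_count p \<sigma> i j = card {q. q < length p \<and> \<sigma> q = i \<and> p ! q = j}"

lemma job_count_load:
  assumes "set p \<subseteq> {1..P}"
  shows "load p \<sigma> i = (\<Sum>j\<in>{1..P}. j * job_count p \<sigma> i j)"
proof -
  have "(\<Sum>j\<in>{1..P}. \<Sum>q\<in>{q \<in> {q. q < length p \<and> \<sigma> q = i}. p ! q = j}. p ! q) = load p \<sigma> i"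
    unfolding load_def using assms by (intro sum.group) auto
  moreover have eq: "(\<Sum>q\<in>{q \<in> {q. q < length p \<and> \<sigma> q = i}. p ! q = j}. p ! q) = j * job_count p \<sigma> i j" for j
  proof -
    have "(\<Sum>q\<in>{q \<in> {q. q < length p \<and> \<sigma> q = i}. p ! q = j}. p ! q) =
        (\<Sum>q\<in>{q. q < length p \<and> \<sigma> q = i \<and> p ! q = j}. j)" by (rule sum.cong) auto
    then show ?thesis by (simp add: job_count_def)
  qed
  ultimately show ?thesis unfolding eq by simp
qed

lemma job_count_total:
  assumes "valid_schedule m p \<sigma>"
  shows "(\<Sum>i<m. job_count p \<sigma> i j) = count (mset p) j"
proof -
  have "(\<Sum>i<m. \<Sum>q\<in>{q \<in> {q. q < length p \<and> p ! q = j}. \<sigma> q = i}. 1) = (\<Sum>q\<in>{q. q < length p \<and> p ! q = j}. 1::nat)"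
    using assms unfolding valid_schedule_def by (intro sum.group) auto
  moreover have "{q \<in> {q. q < length p \<and> p ! q = j}. \<sigma> q = i} = {q. q < length p \<and> \<sigma> q = i \<and> p ! q = j}" for i
    by auto
  moreover have "card {q. q < length p \<and> p ! q = j} = count (mset p) j"
  proof -
    have "count (mset p) j = length (filter (\<lambda>x. x = j) p)" by (induction p) auto
    then show ?thesis by (simp only: length_filter_conv_card)
  qed
  ultimately show ?thesis by (simp add: job_count_def)
qed

lemma load_le_makespan: "i < m \<Longrightarrow> load p \<sigma> i \<le> makespan m p \<sigma>"
  unfolding makespan_def by (intro Max_ge) auto

text \<open>Machines without jobs are dropped from the sequence because the search opens a new
  machine only by placing a job on it. This also limits the number of machines to the number of
  jobs.\<close>

theorem balanced_schedule:
  assumes m: "1 \<le> m" and p: "set p \<subseteq> {1..P}" and \<sigma>: "valid_schedule m p \<sigma>"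
  obtains css where "length css \<le> m" "[] \<notin> set css" "\<And>c. c \<in> set css \<Longrightarrow> sum_list c \<le> makespan m p \<sigma>"
    "mset (concat css) = mset p"
    "\<And>k j. k \<le> length p \<Longrightarrow> length p * count (mset (take k (concat css))) j
       \<le> k * count (mset p) j + window P * length p"
proof -
  have "feasible m P (count (mset p)) (makespan m p \<sigma>) (job_count p \<sigma>)"
    unfolding feasible_def using job_count_total[OF \<sigma>] job_count_load[OF p] load_le_makespan by metis
  then obtain x where x: "feasible m P (count (mset p)) (makespan m p \<sigma>) x"
    "\<And>i i' j. i < m \<Longrightarrow> i' < m \<Longrightarrow> j \<in> {1..P} \<Longrightarrow> x i j \<le> x i' j + gap P"
    using balanced_feasible by blast
  have load: "\<And>i. i < m \<Longrightarrow> (\<Sum>j\<in>{1..P}. j * x i j) \<le> makespan m p \<sigma>"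
    using x(1) unfolding feasible_def by blast
  obtain css where css: "length css = m" "\<And>c. c \<in> set css \<Longrightarrow> sum_list c \<le> makespan m p \<sigma>"
    "\<And>j. count (mset (concat css)) j = (if j \<in> {1..P} then (\<Sum>i<m. x i j) else 0)"
    "\<And>k j. k \<le> length (concat css) \<Longrightarrow> length (concat css) * count (mset (take k (concat css))) j
       \<le> k * count (mset (concat css)) j + window P * length (concat css)"
  proof (rule balanced_sequence[OF m, of P x "makespan m p \<sigma>"])
    show "x i j \<le> x i' j + gap P" if "i < m" "i' < m" "j \<in> {1..P}" for i i' j
      using x(2) that by blast
    show "(\<Sum>j\<in>{1..P}. j * x i j) \<le> makespan m p \<sigma>" if "i < m" for i
      using load that by blast
  qed (rule that)
  have mset: "mset (concat css) = mset p"
  proof (rule multiset_eqI)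
    fix j
    have "count (mset p) j = 0" if "j \<notin> {1..P}" using p that by (auto simp: count_eq_zero_iff)
    then show "count (mset (concat css)) j = count (mset p) j"
      using css(3)[of j] x(1) unfolding feasible_def by auto
  qed
  then have len: "length (concat css) = length p" by (metis size_mset)
  have conc: "concat (filter (\<lambda>c. c \<noteq> []) css) = concat css"
    by (induction css) auto
  show ?thesis
  proof (rule that[of "filter (\<lambda>c. c \<noteq> []) css", unfolded conc])
    show "length (filter (\<lambda>c. c \<noteq> []) css) \<le> m" using css(1) length_filter_le by metis
    show "length p * count (mset (take k (concat css))) j \<le> k * count (mset p) j + window P * length p"
      if "k \<le> length p" for k j
      using css(4)[of k j] that unfolding len mset .
  qed (use css(2) mset in auto)
qed

section \<open>Beam search over balanced job sequences\<close>

text \<open>The components are the makespan so far, load and index of the current machine, and the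
  remaining jobs. A candidate adds a history of pairs (job size, machine), latest first.\<close>

type_synonym key = "nat \<times> nat \<times> nat \<times> nat list"
type_synonym cand = "key \<times> (nat \<times> nat) list"

text \<open>\<open>rem\<close> lists the jobs left after \<open>e\<close> has been placed. The
  numbers of placed jobs are expressed through it because the history is not part of the
  key.\<close>

definition in_window :: "nat \<Rightarrow> nat list \<Rightarrow> nat \<Rightarrow> nat list \<Rightarrow> bool" where
  "in_window E p e rem \<longleftrightarrow> (count_list p e - count_list rem e) * length p
     \<le> (length p - length rem) * count_list p e + E * length p"

definition place :: "nat \<Rightarrow> nat list \<Rightarrow> nat \<Rightarrow> cand \<Rightarrow> nat \<Rightarrow> cand list" where
  "place E p M c e = (case c of ((mx, l, i, rem), h) \<Rightarrow>
     if in_window E p e (remove1 e rem)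
     then ((max mx (l + e), l + e, i, remove1 e rem), (e, i) # h) #
       (if Suc i < M then [((max mx e, e, Suc i, remove1 e rem), (e, Suc i) # h)] else [])
     else [])"

text \<open>The first history found for a key is kept. Any other one would have the same
  continuations and the same makespan.\<close>

definition insert_cand :: "cand list \<Rightarrow> cand \<Rightarrow> cand list" where
  "insert_cand L c = (if fst c \<in> fst ` set L then L else c # L)"

definition remaining :: "cand \<Rightarrow> nat list" where
  "remaining c = snd (snd (snd (fst c)))"

definition extend_all :: "nat \<Rightarrow> nat list \<Rightarrow> nat \<Rightarrow> cand list \<Rightarrow> cand \<Rightarrow> cand list" where
  "extend_all E p M acc c = foldl (\<lambda>acc e. foldl insert_cand acc (place E p M c e)) acc (remaining c)"

definition layer_step :: "nat \<Rightarrow> nat list \<Rightarrow> nat \<Rightarrow> cand list \<Rightarrow> cand list" where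
  "layer_step E p M L = foldl (extend_all E p M) [] L"

definition layer :: "nat \<Rightarrow> nat list \<Rightarrow> nat \<Rightarrow> nat \<Rightarrow> cand list" where
  "layer E p M k = (layer_step E p M ^^ k) [((0, 0, 0, p), [])]"

lemma layer_0: "layer E p M 0 = [((0, 0, 0, p), [])]"
  by (simp add: layer_def)

lemma layer_Suc: "layer E p M (Suc k) = layer_step E p M (layer E p M k)"
  by (simp add: layer_def)

lemma foldl_concat: "foldl f a (concat xss) = foldl (foldl f) a xss"
  by (induction xss arbitrary: a) auto

definition successors :: "nat \<Rightarrow> nat list \<Rightarrow> nat \<Rightarrow> cand \<Rightarrow> cand list" where
  "successors E p M c = concat (map (place E p M c) (remaining c))"

lemma foldl_map': "foldl f a (map g xs) = foldl (\<lambda>a x. f a (g x)) a xs"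
  by (induction xs arbitrary: a) auto

lemma extend_all_eq: "extend_all E p M acc c = foldl insert_cand acc (successors E p M c)"
  unfolding extend_all_def successors_def foldl_concat foldl_map' ..

text \<open>All nested loops amount to one fold of \<open>insert_cand\<close>; hence the keys of a
  new layer are exactly the keys of all successors.\<close>

lemma layer_step_eq:
  "layer_step E p M L = foldl insert_cand [] (concat (map (successors E p M) L))"
  unfolding layer_step_def foldl_concat foldl_map' extend_all_eq[abs_def] ..

lemma insert_cand_keys: "fst ` set (insert_cand L c) = insert (fst c) (fst ` set L)"
  unfolding insert_cand_def by (cases "fst c \<in> fst ` set L") (simp_all add: insert_absorb)

lemma insert_all_keys: "fst ` set (foldl insert_cand acc cs) = fst ` set acc \<union> fst ` set cs"
  by (induction cs arbitrary: acc) (simp_all add: insert_cand_keys)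

lemma insert_all_subset: "set (foldl insert_cand acc cs) \<subseteq> set acc \<union> set cs"
proof (induction cs arbitrary: acc)
  case (Cons c cs)
  show ?case using Cons[of "insert_cand acc c"] by (auto simp: insert_cand_def split: if_splits)
qed simp

lemma insert_all_distinct:
  "distinct (map fst acc) \<Longrightarrow> distinct (map fst (foldl insert_cand acc cs))"
  by (induction cs arbitrary: acc) (auto simp: insert_cand_def)

lemma distinct_layer: "distinct (map fst (layer E p M k))"
  by (cases k) (simp_all add: layer_0 layer_Suc layer_step_eq insert_all_distinct)

lemma layer_Suc_keys:
  "fst ` set (layer E p M (Suc k)) = (\<Union>c\<in>set (layer E p M k). fst ` set (successors E p M c))"
  unfolding layer_Suc layer_step_eq insert_all_keys by auto

lemma layer_Suc_subset:
  "set (layer E p M (Suc k)) \<subseteq> (\<Union>c\<in>set (layer E p M k). set (successors E p M c))"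
  unfolding layer_Suc layer_step_eq using insert_all_subset[of "[]"] by fastforce

definition machine_load :: "(nat \<times> nat) list \<Rightarrow> nat \<Rightarrow> nat" where
  "machine_load h q = sum_list (map fst (filter (\<lambda>x. snd x = q) h))"

definition windowed :: "nat \<Rightarrow> nat list \<Rightarrow> nat list \<Rightarrow> bool" where
  "windowed E p js \<longleftrightarrow> (\<forall>j. length p * count (mset js) j \<le> length js * count (mset p) j + E * length p)"

text \<open>The equation for \<open>rem\<close> fixes the order of the remaining list: it is
  \<open>p\<close> with jobs deleted, determined by the multiset of placed jobs. Without it, keys
  could multiply by permutations. That machines above \<open>i\<close> are empty justifies starting
  the next one with load \<open>e\<close>.\<close>

fun sound_cand :: "nat \<Rightarrow> nat list \<Rightarrow> nat \<Rightarrow> nat \<Rightarrow> cand \<Rightarrow> bool" where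
  "sound_cand E p M k ((mx, l, i, rem), h) \<longleftrightarrow> length h = k \<and> mset (map fst h) + mset rem = mset p \<and>
     rem = fold remove1 (rev (map fst h)) p \<and> i < M \<and> i \<le> k \<and> l \<le> mx \<and> mx \<le> sum_list (map fst h) \<and>
     machine_load h i = l \<and> (\<forall>q. machine_load h q \<le> mx) \<and> (\<forall>q>i. machine_load h q = 0) \<and>
     (\<forall>x\<in>set h. snd x \<le> i) \<and> windowed E p (map fst h)"

lemma count_mset_list: "count (mset xs) x = count_list xs x"
  by (induction xs) auto

lemma in_window_iff:
  assumes "mset js + mset rem = mset p"
  shows "in_window E p e rem \<longleftrightarrow>
    length p * count (mset js) e \<le> length js * count (mset p) e + E * length p"
proof -
  have "count_list p e = count (mset js) e + count_list rem e"
    using arg_cong[OF assms, of "\<lambda>M. count M e"] by (simp add: count_mset_list)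
  moreover have "length p = length js + length rem"
    using arg_cong[OF assms, of size] by simp
  ultimately show ?thesis unfolding in_window_def count_mset_list[symmetric]
    by (simp add: mult.commute)
qed

text \<open>Only the size just placed has to be checked: for every other size the left side stays
  the same while the right side does not decrease.\<close>

lemma windowed_snoc:
  assumes "windowed E p js" "in_window E p e rem" "mset (e # js) + mset rem = mset p"
  shows "windowed E p (e # js)"
  unfolding windowed_def
proof
  fix j
  show "length p * count (mset (e # js)) j \<le> length (e # js) * count (mset p) j + E * length p"
  proof (cases "j = e")
    case True
    then show ?thesis using assms(2) in_window_iff[OF assms(3)] by blast
  next
    case False
    then have "length p * count (mset (e # js)) j \<le> length js * count (mset p) j + E * length p"
      using assms(1) unfolding windowed_def by simp
    then show ?thesis by (rule order_trans) simp
  qed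
qed

lemma sound_place:
  assumes s: "sound_cand E p M k ((mx, l, i, rem), h)" and e: "e \<in> set rem"
    and c: "c \<in> set (place E p M ((mx, l, i, rem), h) e)"
  shows "sound_cand E p M (Suc k) c"
proof -
  have win: "in_window E p e (remove1 e rem)" using c by (auto simp: place_def split: if_splits)
  have ms: "mset (e # map fst h) + mset (remove1 e rem) = mset p"
  proof -
    have "mset rem = add_mset e (mset (remove1 e rem))" using e by simp
    moreover have "mset (map fst h) + mset rem = mset p" using s unfolding sound_cand.simps by blast
    ultimately show ?thesis by (simp del: mset_remove1)
  qed
  have w: "windowed E p (e # map fst h)" using windowed_snoc[OF _ win ms] s by simp
  have r: "remove1 e rem = fold remove1 (rev (map fst h) @ [e]) p" using s by simp
  have c': "c = ((max mx (l + e), l + e, i, remove1 e rem), (e, i) # h) \<or>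
      Suc i < M \<and> c = ((max mx e, e, Suc i, remove1 e rem), (e, Suc i) # h)"
    using c by (auto simp: place_def split: if_splits)
  from c' show ?thesis
  proof (elim disjE conjE)
    assume c: "c = ((max mx (l + e), l + e, i, remove1 e rem), (e, i) # h)"
    have "machine_load ((e, i) # h) q = (if q = i then e else 0) + machine_load h q" for q
      by (simp add: machine_load_def)
    then show ?thesis unfolding c sound_cand.simps using s ms w r by (auto simp: max_def intro: le_trans[of _ mx])
  next
    assume M: "Suc i < M" and c: "c = ((max mx e, e, Suc i, remove1 e rem), (e, Suc i) # h)"
    have "machine_load ((e, Suc i) # h) q = (if q = Suc i then e else 0) + machine_load h q" for q
      by (simp add: machine_load_def)
    then show ?thesis unfolding c sound_cand.simps using s ms w r M
      by (auto simp: max_def le_SucI intro: le_trans[of _ mx])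
  qed
qed

lemma sound_layer:
  assumes "0 < M"
  shows "c \<in> set (layer E p M k) \<Longrightarrow> sound_cand E p M k c"
proof (induction k arbitrary: c)
  case 0
  then show ?case using assms by (simp add: layer_0 machine_load_def windowed_def)
next
  case (Suc k)
  then obtain c' where c': "c' \<in> set (layer E p M k)" "c \<in> set (successors E p M c')"
    using layer_Suc_subset by blast
  obtain mx l i rem h where eq: "c' = ((mx, l, i, rem), h)" by (metis prod.collapse)
  obtain e where "e \<in> set rem" "c \<in> set (place E p M c' e)"
    using c'(2) unfolding successors_def remaining_def eq by auto
  then show ?case using sound_place Suc.IH[OF c'(1)] unfolding eq by blast
qed

lemma mset_fold_remove1: "mset (fold remove1 js p) = mset p - mset js"
  by (induction js arbitrary: p) auto

text \<open>Completeness is traced through keys. The stored history may differ from the sequence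
  \<open>pre\<close>, but the keys of successors do not depend on it.\<close>

lemma layer_advance:
  assumes key: "(mx, l, i, fold remove1 pre p) \<in> fst ` set (layer E p M (length pre))"
    and sub: "mset (pre @ [e]) \<subseteq># mset p" and w: "windowed E p (pre @ [e])"
  shows "(max mx (l + e), l + e, i, fold remove1 (pre @ [e]) p) \<in> fst ` set (layer E p M (length (pre @ [e])))"
    and "Suc i < M \<Longrightarrow>
      (max mx e, e, Suc i, fold remove1 (pre @ [e]) p) \<in> fst ` set (layer E p M (length (pre @ [e])))"
proof -
  obtain h where c: "((mx, l, i, fold remove1 pre p), h) \<in> set (layer E p M (length pre))"
    using key by force
  let ?c = "((mx, l, i, fold remove1 pre p), h)" and ?rem = "fold remove1 (pre @ [e]) p"
  have "e \<in># mset p - mset pre"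
    using mset_subset_eq_count[OF sub, of e] by (simp add: in_diff_count)
  then have e: "e \<in> set (fold remove1 pre p)" by (metis mset_fold_remove1 set_mset_mset)
  have "mset (pre @ [e]) + mset ?rem = mset p"
    unfolding mset_fold_remove1 by (rule subset_mset.add_diff_inverse[OF sub])
  then have "in_window E p e ?rem" using in_window_iff w unfolding windowed_def by blast
  then have pl: "place E p M ?c e = ((max mx (l + e), l + e, i, ?rem), (e, i) # h) #
       (if Suc i < M then [((max mx e, e, Suc i, ?rem), (e, Suc i) # h)] else [])"
    by (simp add: place_def)
  have "fst ` set (place E p M ?c e) \<subseteq> fst ` set (layer E p M (length (pre @ [e])))"
    using e c unfolding length_append list.size add_Suc_right add_0_right layer_Suc_keys successors_def remaining_def
    by fastforce
  then show "(max mx (l + e), l + e, i, ?rem) \<in> fst ` set (layer E p M (length (pre @ [e])))"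
    "Suc i < M \<Longrightarrow> (max mx e, e, Suc i, ?rem) \<in> fst ` set (layer E p M (length (pre @ [e])))"
    unfolding pl by auto
qed

lemma mset_prefix_subset: "mset (xs @ ys) \<subseteq># X \<Longrightarrow> mset xs \<subseteq># X"
  by (metis mset_append mset_subset_eq_add_left subset_mset.order_trans)

lemma take_prefix_eq: "take q xs = take (min q (length xs)) (xs @ ys)"
  by (simp add: min_def)

lemma layer_machine:
  assumes "(mx, l, i, fold remove1 pre p) \<in> fst ` set (layer E p M (length pre))" "mx \<le> T"
    "l + sum_list cs \<le> T" "mset (pre @ cs) \<subseteq># mset p" "\<And>q. windowed E p (take q (pre @ cs))"
  shows "\<exists>mx'\<le>T. (mx', l + sum_list cs, i, fold remove1 (pre @ cs) p) \<in> fst ` set (layer E p M (length (pre @ cs)))"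
  using assms
proof (induction cs arbitrary: pre mx l)
  case (Cons e cs)
  have 1: "mset (pre @ [e]) \<subseteq># mset p"
    using Cons.prems(4) by (intro mset_prefix_subset[of "pre @ [e]" cs]) simp
  have 2: "windowed E p (pre @ [e])" using Cons.prems(5)[of "length pre + 1"] by simp
  have "\<exists>mx'\<le>T. (mx', (l + e) + sum_list cs, i, fold remove1 ((pre @ [e]) @ cs) p)
      \<in> fst ` set (layer E p M (length ((pre @ [e]) @ cs)))"
    by (rule Cons.IH[OF layer_advance(1)[OF Cons.prems(1) 1 2]]) (use Cons.prems(2-5) in auto)
  then show ?case by (simp add: add.assoc)
qed auto

text \<open>The first job of each list opens the machine, whence the exclusion of empty lists;
  \<open>layer_machine\<close> then adds the rest to it.\<close>

lemma layer_machines: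
  assumes "(mx, l, i, fold remove1 pre p) \<in> fst ` set (layer E p M (length pre))" "mx \<le> T"
    "i + length css < M" "[] \<notin> set css" "\<And>c. c \<in> set css \<Longrightarrow> sum_list c \<le> T"
    "mset (pre @ concat css) \<subseteq># mset p" "\<And>q. windowed E p (take q (pre @ concat css))"
  shows "\<exists>mx' l' i'. mx' \<le> T \<and> (mx', l', i', fold remove1 (pre @ concat css) p)
    \<in> fst ` set (layer E p M (length (pre @ concat css)))"
  using assms
proof (induction css arbitrary: pre mx l i)
  case (Cons c css)
  obtain e cs where c: "c = e # cs" using Cons.prems(4) by (cases c) auto
  have sum: "e + sum_list cs \<le> T" using Cons.prems(5)[of c] c by simp
  have 1: "mset (pre @ [e]) \<subseteq># mset p"
    using Cons.prems(6) c by (intro mset_prefix_subset[of "pre @ [e]" "cs @ concat css"]) simp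
  have 2: "windowed E p (pre @ [e])" using Cons.prems(7)[of "length pre + 1"] c by simp
  have 3: "mset ((pre @ [e]) @ cs) \<subseteq># mset p"
    using Cons.prems(6) c by (intro mset_prefix_subset[of "(pre @ [e]) @ cs" "concat css"]) simp
  have 4: "windowed E p (take q ((pre @ [e]) @ cs))" for q
  proof -
    have "pre @ concat (c # css) = ((pre @ [e]) @ cs) @ concat css" using c by simp
    then show ?thesis using Cons.prems(7) take_prefix_eq by metis
  qed
  obtain mx' where "mx' \<le> T" "(mx', e + sum_list cs, Suc i, fold remove1 ((pre @ [e]) @ cs) p)
      \<in> fst ` set (layer E p M (length ((pre @ [e]) @ cs)))"
    using layer_machine[OF layer_advance(2)[OF Cons.prems(1) 1 2] _ sum 3 4] Cons.prems(2,3) sum by auto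
  then have "\<exists>mx' l' i'. mx' \<le> T \<and> (mx', l', i', fold remove1 (((pre @ [e]) @ cs) @ concat css) p)
    \<in> fst ` set (layer E p M (length (((pre @ [e]) @ cs) @ concat css)))"
    by (intro Cons.IH) (use Cons.prems(3-7) c in auto)
  then show ?case using c by simp
qed auto

text \<open>Machine 0 is open from the start, so the first list is handled by
  \<open>layer_machine\<close> and only the others count as newly opened.\<close>

lemma layer_complete:
  assumes "length css \<le> M" "0 < M" "[] \<notin> set css" "\<And>c. c \<in> set css \<Longrightarrow> sum_list c \<le> T"
    "mset (concat css) = mset p" "\<And>q. windowed E p (take q (concat css))"
  shows "\<exists>c\<in>set (layer E p M (length p)). fst (fst c) \<le> T"
proof (cases css)
  case Nil
  then show ?thesis using assms(5) by (simp add: layer_0)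
next
  case (Cons c css')
  have "\<exists>mx'\<le>T. (mx', 0 + sum_list c, 0, fold remove1 ([] @ c) p) \<in> fst ` set (layer E p M (length ([] @ c)))"
  proof (rule layer_machine[where mx = 0])
    show "mset ([] @ c) \<subseteq># mset p" using assms(5) Cons by (intro mset_prefix_subset[of "[] @ c" "concat css'"]) simp
    show "windowed E p (take q ([] @ c))" for q
      using assms(6) Cons take_prefix_eq[of q c "concat css'"] by (metis append_Nil concat.simps(2))
  qed (use assms(4) Cons in \<open>auto simp: layer_0\<close>)
  then obtain mx where mx: "mx \<le> T" "(mx, sum_list c, 0, fold remove1 c p) \<in> fst ` set (layer E p M (length c))" by auto
  have "\<exists>mx' l' i'. mx' \<le> T \<and> (mx', l', i', fold remove1 (c @ concat css') p) \<in> fst ` set (layer E p M (length (c @ concat css')))"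
    by (rule layer_machines[OF mx(2,1)]) (use assms Cons in auto)
  moreover have "length (c @ concat css') = length p" using assms(5) Cons by (metis concat.simps(2) size_mset)
  ultimately show ?thesis by force
qed

section \<open>The number of keys in a layer\<close>

lemma fold_remove1_cong: "mset xs = mset ys \<Longrightarrow> fold remove1 xs p = fold remove1 ys p"
  using fold_multiset_equiv[of xs remove1 ys] by (auto simp: fun_eq_iff remove1_commute)

text \<open>The counts of all sizes add up to the number of placed jobs, so the upper windows imply lower ones.\<close>

lemma window_box:
  assumes "windowed E p js" "mset js \<subseteq># mset p" "set p \<subseteq> {1..P}" "p \<noteq> []" and j: "j \<in> {1..P}"
  defines "a \<equiv> length js * count (mset p) j div length p"
  shows "a - (P - 1) * E \<le> count (mset js) j \<and> count (mset js) j \<le> a - (P - 1) * E + P * E"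
proof -
  let ?n = "length p" and ?k = "length js"
  have n0: "0 < ?n" using assms(4) by simp
  have up: "?n * count (mset js) l \<le> ?k * count (mset p) l + E * ?n" for l
    using assms(1) unfolding windowed_def by blast
  have "set js \<subseteq> {1..P}" using assms(2,3) by (metis order_trans set_mset_mono set_mset_mset)
  then have k_sum: "?k = (\<Sum>l\<in>{1..P}. count (mset js) l)"
    using size_eq_sum_count[of "mset js" "{1..P}"] by simp
  have n_sum: "?n = (\<Sum>l\<in>{1..P}. count (mset p) l)"
    using size_eq_sum_count[of "mset p" "{1..P}"] assms(3) by simp
  have "(count (mset js) j - E) * ?n \<le> ?k * count (mset p) j"
  proof -
    have "count (mset js) j * ?n \<le> ?k * count (mset p) j + E * ?n" using up[of j] by (simp only: mult.commute)
    then show ?thesis unfolding diff_mult_distrib by linarith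
  qed
  then have upper: "count (mset js) j \<le> a + E"
    unfolding a_def using less_eq_div_iff_mult_less_eq[OF n0] by (metis le_diff_conv)
  have "(\<Sum>l\<in>{1..P} - {j}. ?n * count (mset js) l) \<le> (\<Sum>l\<in>{1..P} - {j}. ?k * count (mset p) l + E * ?n)"
    by (intro sum_mono up)
  also have "\<dots> = ?k * (\<Sum>l\<in>{1..P} - {j}. count (mset p) l) + (P - 1) * E * ?n"
    using j by (simp add: sum.distrib sum_distrib_left)
  finally have 1: "?n * (\<Sum>l\<in>{1..P} - {j}. count (mset js) l) \<le>
      ?k * (\<Sum>l\<in>{1..P} - {j}. count (mset p) l) + (P - 1) * E * ?n"
    by (simp add: sum_distrib_left)
  have "?n = count (mset p) j + (\<Sum>l\<in>{1..P} - {j}. count (mset p) l)"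
    using n_sum sum.remove[of "{1..P}" j "count (mset p)"] j by simp
  then have 2: "?k * ?n = ?k * count (mset p) j + ?k * (\<Sum>l\<in>{1..P} - {j}. count (mset p) l)"
    by (metis distrib_left)
  have "?k = count (mset js) j + (\<Sum>l\<in>{1..P} - {j}. count (mset js) l)"
    using k_sum sum.remove[of "{1..P}" j "count (mset js)"] j by simp
  then have 3: "?n * ?k = ?n * count (mset js) j + ?n * (\<Sum>l\<in>{1..P} - {j}. count (mset js) l)"
    by (metis distrib_left)
  have "?k * count (mset p) j \<le> ?n * count (mset js) j + (P - 1) * E * ?n"
    using 1 2 3 by (simp add: mult.commute[of ?n ?k])
  then have "?k * count (mset p) j \<le> (count (mset js) j + (P - 1) * E) * ?n"
    by (simp add: algebra_simps)
  then have "a \<le> count (mset js) j + (P - 1) * E"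
    unfolding a_def by (metis div_le_mono n0 div_mult_self_is_m)
  \<comment> \<open>The box extends \<open>(P - 1) * E\<close> below \<open>a\<close> and
    \<open>E\<close> above it. Where the truncated subtraction raises the lower end, the upper end
    rises with it.\<close>
  moreover have "P * E = (P - 1) * E + E" using j by (cases P) auto
  ultimately show ?thesis using upper by linarith
qed

text \<open>A remaining list is determined by the counts of the placed jobs, and
  \<open>window_box\<close> confines these counts to a box whose corner depends on \<open>k\<close>
  only.\<close>

lemma card_remaining:
  fixes k E :: nat
  assumes "set p \<subseteq> {1..P}" "p \<noteq> []"
  defines "R \<equiv> {fold remove1 js p |js. length js = k \<and> windowed E p js \<and> mset js \<subseteq># mset p}"
  shows "finite R \<and> card R \<le> (P * E + 1) ^ P"
proof -
  define lo where "lo j = k * count (mset p) j div length p - (P - 1) * E" for j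
  let ?B = "{f. (\<forall>j\<in>{1..P}. lo j \<le> f j \<and> f j \<le> lo j + P * E) \<and> (\<forall>j. j \<notin> {1..P} \<longrightarrow> f j = (0::nat))}"
  define G where "G f = fold remove1 (SOME js. mset js = bag P f) p" for f
  have "R \<subseteq> G ` ?B"
  proof
    fix r assume "r \<in> R"
    then obtain js where js: "r = fold remove1 js p" "length js = k" "windowed E p js" "mset js \<subseteq># mset p"
      unfolding R_def by blast
    let ?f = "count (mset js)"
    have out: "?f j = 0" if "j \<notin> {1..P}" for j
    proof -
      have "count (mset p) j = 0" using that assms(1) by (auto simp: count_eq_zero_iff)
      then show ?thesis using mset_subset_eq_count[OF js(4), of j] by (metis le_0_eq)
    qed
    have "mset js = bag P ?f" by (rule multiset_eqI) (auto simp: count_bag out)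
    then have "mset (SOME js'. mset js' = bag P ?f) = mset js" by (metis (mono_tags, lifting) someI)
    then have "r = G ?f" unfolding G_def js(1) by (metis fold_remove1_cong)
    moreover have "?f \<in> ?B"
      using window_box[OF js(3,4) assms(1,2)] out unfolding js(2) lo_def by auto
    ultimately show "r \<in> G ` ?B" by blast
  qed
  from finite_surj[OF card_box(1) this] surj_card_le[OF card_box(1) this]
  have "finite R" "card R \<le> card ?B" .
  then show ?thesis using card_box(2)[of P lo "P * E"] by (meson le_trans)
qed

text \<open>The factors count makespans, loads, machine indices and remaining lists. Only the last
  factor is exponential, and it depends on \<open>P\<close> and \<open>E\<close> alone.\<close>

definition layer_bound :: "nat \<Rightarrow> nat \<Rightarrow> nat \<Rightarrow> nat \<Rightarrow> nat" where
  "layer_bound P E S n = (S + 1) * ((S + 1) * ((n + 1) * (P * E + 1) ^ P))"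

lemma length_layer:
  assumes "set p \<subseteq> {1..P}" "p \<noteq> []" "0 < M" "k \<le> length p"
  shows "length (layer E p M k) \<le> layer_bound P E (sum_list p) (length p)"
proof -
  define R where "R = {fold remove1 js p |js. length js = k \<and> windowed E p js \<and> mset js \<subseteq># mset p}"
  let ?K = "{..sum_list p} \<times> {..sum_list p} \<times> {..length p} \<times> R"
  have card_R: "finite R" "card R \<le> (P * E + 1) ^ P"
    using card_remaining[OF assms(1,2), of k E] unfolding R_def by blast+
  have "fst ` set (layer E p M k) \<subseteq> ?K"
  proof
    fix key assume "key \<in> fst ` set (layer E p M k)"
    then obtain h where c: "(key, h) \<in> set (layer E p M k)" by force
    obtain mx l i rem where key: "key = (mx, l, i, rem)" by (metis prod.collapse)
    have s: "length h = k" "mset (map fst h) + mset rem = mset p" "rem = fold remove1 (rev (map fst h)) p"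
      "i \<le> k" "l \<le> mx" "mx \<le> sum_list (map fst h)" "windowed E p (map fst h)"
      using sound_layer[OF assms(3) c] unfolding key sound_cand.simps by blast+
    have "sum_list (map fst h) \<le> sum_list p"
      using arg_cong[OF s(2), of sum_mset] unfolding sum_mset.union sum_mset_sum_list by simp
    moreover have "rem \<in> R"
    proof -
      have "windowed E p (rev (map fst h))" using s(7) unfolding windowed_def by simp
      moreover have "mset (rev (map fst h)) \<subseteq># mset p" using s(2) by (metis mset_rev mset_subset_eq_add_left)
      ultimately show ?thesis using s(1,3) unfolding R_def by (intro CollectI exI[of _ "rev (map fst h)"]) simp
    qed
    ultimately show "key \<in> ?K" using s assms(4) unfolding key by auto
  qed
  moreover have "finite ?K" using card_R(1) by simp
  ultimately have "card (fst ` set (layer E p M k)) \<le> card ?K" by (intro card_mono)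
  also have "\<dots> \<le> layer_bound P E (sum_list p) (length p)"
    using card_R(2) unfolding layer_bound_def card_cartesian_product by (intro mult_le_mono) auto
  finally show ?thesis using distinct_card[OF distinct_layer[of E p M k]] by simp
qed

section \<open>Reading off an optimal schedule\<close>

definition best :: "cand list \<Rightarrow> cand" where
  "best L = foldl (\<lambda>b c. if fst (fst c) < fst (fst b) then c else b) (hd L) L"

lemma best_props:
  assumes "L \<noteq> []"
  shows "best L \<in> set L" "c \<in> set L \<Longrightarrow> fst (fst (best L)) \<le> fst (fst c)"
proof -
  define f :: "cand \<Rightarrow> cand \<Rightarrow> cand" where "f b c = (if fst (fst c) < fst (fst b) then c else b)" for b c
  have "foldl f b xs \<in> insert b (set xs) \<and> (\<forall>c\<in>insert b (set xs). fst (fst (foldl f b xs)) \<le> fst (fst c))" for b xs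
  proof (induction xs arbitrary: b)
    case (Cons x xs)
    have "f b x = b \<or> f b x = x" "fst (fst (f b x)) \<le> fst (fst b)" "fst (fst (f b x)) \<le> fst (fst x)"
      unfolding f_def by auto
    then show ?case using Cons[of "f b x"] by (auto intro: order_trans)
  qed simp
  from this[of "hd L" L] assms show "best L \<in> set L" "c \<in> set L \<Longrightarrow> fst (fst (best L)) \<le> fst (fst c)"
    unfolding best_def f_def[abs_def, symmetric] by (auto simp: insert_absorb)
qed

definition take_job :: "nat \<Rightarrow> (nat \<times> nat) list \<Rightarrow> nat option \<times> (nat \<times> nat) list" where
  "take_job e h = foldl (\<lambda>(r, kept) x. if r = None \<and> fst x = e then (Some (snd x), kept) else (r, x # kept)) (None, []) h"

fun assign :: "nat list \<Rightarrow> (nat \<times> nat) list \<Rightarrow> nat list" where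
  "assign [] h = []"
| "assign (e # p) h = the (fst (take_job e h)) # assign p (snd (take_job e h))"

lemma take_job_props:
  assumes "e \<in> fst ` set h"
  obtains i kept where "take_job e h = (Some i, kept)" "mset h = add_mset (e, i) (mset kept)"
proof -
  define f where "f = (\<lambda>(r, kept) (x :: nat \<times> nat). if r = None \<and> fst x = e then (Some (snd x), kept) else (r, x # kept))"
  have 1: "foldl f (Some i, kept) xs = (Some i, rev xs @ kept)" for i kept xs
    by (induction xs arbitrary: kept) (auto simp: f_def)
  have "\<exists>i kept'. foldl f (None, kept) xs = (Some i, kept') \<and> mset xs + mset kept = add_mset (e, i) (mset kept')"
    if "e \<in> fst ` set xs" for kept xs
    using that
  proof (induction xs arbitrary: kept)
    case (Cons x xs)
    show ?case
    proof (cases "fst x = e")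
      case True
      then have "foldl f (None, kept) (x # xs) = (Some (snd x), rev xs @ kept)" using 1 by (simp add: f_def)
      then show ?thesis using True by auto
    next
      case False
      then have "f (None, kept) x = (None, x # kept)" "e \<in> fst ` set xs" using Cons.prems by (auto simp: f_def)
      then show ?thesis using Cons.IH[of "x # kept"] by simp
    qed
  qed simp
  from this[OF assms, of "[]"] show ?thesis using that unfolding take_job_def f_def by auto
qed

lemma assign_props:
  "mset (map fst h) = mset p \<Longrightarrow> length (assign p h) = length p \<and> mset (zip p (assign p h)) = mset h"
proof (induction p arbitrary: h)
  case (Cons e p)
  have "e \<in> fst ` set h" using arg_cong[OF Cons.prems, of set_mset] by auto
  then obtain i kept where tj: "take_job e h = (Some i, kept)" "mset h = add_mset (e, i) (mset kept)"
    by (rule take_job_props)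
  then have "mset (map fst kept) = mset p" using Cons.prems by simp
  then show ?case using Cons.IH[of kept] tj by simp
qed simp

lemma load_assign:
  assumes "mset (map fst h) = mset p"
  shows "load p (\<lambda>j. assign p h ! j) q = machine_load h q"
proof -
  note a = assign_props[OF assms]
  have zip_load: "load p (\<lambda>j. ys ! j) q = sum_list (map fst (filter (\<lambda>x. snd x = q) (zip p ys)))" if "length ys = length p" for ys
  proof -
    let ?zs = "zip p ys"
    have "sum_list (map fst (filter (\<lambda>x. snd x = q) ?zs)) = (\<Sum>x\<leftarrow>?zs. if snd x = q then fst x else 0)"
      by (simp add: sum_list_map_filter')
    also have "\<dots> = (\<Sum>j<length p. if ys ! j = q then p ! j else 0)"
      using that by (auto simp: sum_list_sum_nth atLeast0LessThan intro!: sum.cong)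
    also have "\<dots> = (\<Sum>j\<in>{j \<in> {..<length p}. ys ! j = q}. p ! j)" by (simp add: sum.If_cases Int_def)
    finally show ?thesis unfolding load_def by simp
  qed
  have conv: "sum_list (map fst (filter (\<lambda>x. snd x = q) xs)) =
      sum_mset (image_mset fst (filter_mset (\<lambda>x. snd x = q) (mset xs)))" for xs :: "(nat \<times> nat) list"
    by (metis mset_filter mset_map sum_mset_sum_list)
  show ?thesis
    unfolding zip_load[OF conjunct1[OF a]] machine_load_def conv conjunct2[OF a] ..
qed

text \<open>\<open>L\<close> will be the length of the input. Limiting the machines to
  \<open>L\<close> loses nothing, as the sequences in question consist of at most
  \<open>length p\<close> nonempty machines; \<open>1 <= L\<close> keeps machine 0 available even
  without jobs.\<close>

theorem search_optimal:
  assumes inst: "valid_instance m p" and P: "set p \<subseteq> {1..P}" and L: "length p \<le> L" "1 \<le> L"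
  defines "h \<equiv> snd (best (layer (window P) p (min m L) (length p)))"
  shows "optimal_schedule m p (\<lambda>j. assign p h ! j)" "length (assign p h) = length p"
    "layer (window P) p (min m L) (length p) \<noteq> []" "mset (map fst h) = mset p"
proof -
  let ?M = "min m L" let ?L = "layer (window P) p ?M (length p)"
  have m: "1 \<le> m" using inst unfolding valid_instance_def by simp
  have M: "0 < ?M" using m L by simp
  have ex: "\<exists>c\<in>set ?L. fst (fst c) \<le> makespan m p \<tau>" if \<tau>: "valid_schedule m p \<tau>" for \<tau>
  proof -
    obtain css where css: "length css \<le> m" "[] \<notin> set css" "\<And>c. c \<in> set css \<Longrightarrow> sum_list c \<le> makespan m p \<tau>"
      "mset (concat css) = mset p"
      "\<And>k j. k \<le> length p \<Longrightarrow> length p * count (mset (take k (concat css))) j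
         \<le> k * count (mset p) j + window P * length p"
      by (rule balanced_schedule[OF m P \<tau>]) (rule that)
    have len: "length (concat css) = length p" using css(4) by (metis size_mset)
    have "length css \<le> length (concat css)"
      using css(2)
    proof (induction css)
      case (Cons c css)
      then have "1 \<le> length c" by (cases c) auto
      then show ?case using Cons by simp
    qed simp
    then have "length css \<le> ?M" using css(1) L(1) len by simp
    moreover have "windowed (window P) p (take q (concat css))" for q
    proof -
      have "take q (concat css) = take (min q (length p)) (concat css)"
        using len by (metis min.commute take_all_iff take_take order_refl)
      moreover have "length (take q (concat css)) = min q (length p)" using len by (simp only: length_take min.commute)
      ultimately show ?thesis unfolding windowed_def using css(5)[of "min q (length p)"] by simp
    qed
    ultimately show ?thesis using layer_complete[OF _ M css(2) css(3) css(4)] by blast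
  qed
  have "valid_schedule m p (\<lambda>_. 0)" using m unfolding valid_schedule_def by simp
  then show ne: "?L \<noteq> []" using ex by fastforce
  obtain mx l i rem where b: "best ?L = ((mx, l, i, rem), h)"
    unfolding h_def by (metis prod.collapse)
  have "sound_cand (window P) p ?M (length p) ((mx, l, i, rem), h)"
    using sound_layer[OF M best_props(1)[OF ne]] unfolding b .
  then have s: "length h = length p" "mset (map fst h) + mset rem = mset p" "i < ?M" "\<And>q. machine_load h q \<le> mx"
    "\<And>x. x \<in> set h \<Longrightarrow> snd x \<le> i"
    unfolding sound_cand.simps by blast+
  have "length rem = 0" using arg_cong[OF s(2), of size] s(1) by simp
  then show ms: "mset (map fst h) = mset p" using s(2) by simp
  then show len: "length (assign p h) = length p" using assign_props by blast
  have "assign p h ! j < m" if "j < length p" for j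
  proof -
    have "(p ! j, assign p h ! j) \<in> set (zip p (assign p h))" using that len by (auto simp: in_set_zip)
    then have "(p ! j, assign p h ! j) \<in> set h" using assign_props[OF ms] by (metis set_mset_mset)
    then show ?thesis using s(3,5) by fastforce
  qed
  then have "valid_schedule m p (\<lambda>j. assign p h ! j)" unfolding valid_schedule_def by simp
  moreover have "makespan m p (\<lambda>j. assign p h ! j) \<le> makespan m p \<tau>" if \<tau>: "valid_schedule m p \<tau>" for \<tau>
  proof -
    have "makespan m p (\<lambda>j. assign p h ! j) \<le> mx"
      unfolding makespan_def load_assign[OF ms] using m s(4) by (subst Max_le_iff) (auto simp: lessThan_empty_iff bot_nat_def)
    also have "mx \<le> makespan m p \<tau>"
      using ex[OF \<tau>] best_props(2)[OF ne] unfolding b by fastforce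
    finally show ?thesis .
  qed
  ultimately show "optimal_schedule m p (\<lambda>j. assign p h ! j)" unfolding optimal_schedule_def by blast
qed

section \<open>The search as a tree function\<close>

lemma sz_lst: "sz (lst xs) = 1 + sum_list (map (\<lambda>x. 1 + sz x) xs)"
  by (induction xs) auto

lemma num_simps [simp]: "num 0 = Lf" "num (Suc n) = Nd Lf (num n)"
  by (simp_all add: num_def)

lemma sz_num [simp]: "sz (num n) = 2 * n + 1"
  by (induction n) auto

lemma num_inj [simp]: "num a = num b \<longleftrightarrow> a = b"
proof
  assume "num a = num b"
  then have "sz (num a) = sz (num b)" by simp
  then show "a = b" by simp
qed simp

lemma num_eq_Lf [simp]: "num a = Lf \<longleftrightarrow> a = 0" "Lf = num a \<longleftrightarrow> a = 0"
  by (cases a; simp)+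

lemma lst_inj [simp]: "lst xs = lst ys \<longleftrightarrow> xs = ys"
  by (metis elems_lst)

lemma elems_num [simp]: "elems (num n) = replicate n Lf"
  by (simp add: num_def)

lemma boolt_simps [simp]: "boolt b = Lf \<longleftrightarrow> \<not> b"
  by (simp add: boolt_def)

text \<open>A loop rule whose invariant also sees the elements still to come, so that room for them
  can be reserved in advance.\<close>

lemma fold_okI:
  assumes "I acc es"
    and "\<And>acc e es'. e \<in> set es \<Longrightarrow> I acc (e # es') \<Longrightarrow>
      P (Nd acc (Nd e v)) \<and> sz (F (Nd acc (Nd e v))) \<le> N \<and> I (F (Nd acc (Nd e v))) es'"
  shows "fold_ok N P F v acc es"
proof -
  have "fold_ok N P F v acc ds" if "I acc ds" "set ds \<subseteq> set es" for acc ds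
    using that
  proof (induction ds arbitrary: acc)
    case (Cons d ds)
    then show ?case using assms(2)[of d acc ds] by (simp add: Let_def)
  qed simp
  then show ?thesis using assms(1) by simp
qed

text \<open>On right-nested tuples, counted from 0, \<open>Xi\<close> selects component
  \<open>i\<close> and \<open>Ti\<close> drops the first \<open>i\<close> components.\<close>

abbreviation "X1 \<equiv> Hd \<diamondop> Tl"
abbreviation "T2 \<equiv> Tl \<diamondop> Tl"
abbreviation "X2 \<equiv> Hd \<diamondop> T2"
abbreviation "T3 \<equiv> Tl \<diamondop> T2"
abbreviation "X3 \<equiv> Hd \<diamondop> T3"
abbreviation "T4 \<equiv> Tl \<diamondop> T3"
abbreviation "X4 \<equiv> Hd \<diamondop> T4"
abbreviation "T5 \<equiv> Tl \<diamondop> T4"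
abbreviation "X5 \<equiv> Hd \<diamondop> T5"

text \<open>Prepends a reversed list. On unary numbers this is addition.\<close>

definition "REVAPP = Fold Hd Tl (PairF X1 Hd)"

lemma eval_REVAPP_lst [simp]: "eval REVAPP (Nd (lst xs) (lst ys)) = lst (rev xs @ ys)"
proof -
  have "foldl (\<lambda>acc e. Nd e acc) (lst ys) xs = lst (rev xs @ ys)"
    by (induction xs arbitrary: ys) (auto simp flip: lst_simps)
  then show ?thesis by (simp add: REVAPP_def)
qed

lemma eval_REVAPP_num [simp]: "eval REVAPP (Nd (num a) (num b)) = num (a + b)"
  using eval_REVAPP_lst[of "replicate a Lf" "replicate b Lf"] by (simp add: num_def replicate_add)

lemma eval_REVAPP_Lf [simp]: "eval REVAPP (Nd (lst xs) Lf) = lst (rev xs)"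
  using eval_REVAPP_lst[of xs "[]"] by simp

lemma ok_REVAPP: "sz a + sz b \<le> N \<Longrightarrow> ok N REVAPP (Nd a b)"
proof -
  assume N: "sz a + sz b \<le> N"
  have "fold_ok N (ok N (PairF X1 Hd)) (eval (PairF X1 Hd)) (Nd a b) b (elems a)"
    by (rule fold_okI[where I = "\<lambda>acc es. sz acc + sz (lst es) \<le> N"]) (use N in auto)
  then show ?thesis by (simp add: REVAPP_def)
qed

text \<open>Truncated subtraction on unary numbers. A result \<open>Lf\<close> means less or equal,
  so it is also the comparison used in conditions.\<close>

definition "DROP = Fold Tl Hd (Tl \<diamondop> Hd)"

lemma tl_tree_lst [simp]: "tl_tree (lst xs) = lst (tl xs)"
  by (cases xs) auto

lemma eval_DROP_lst: "eval DROP (Nd (lst xs) b) = lst (drop (length (elems b)) xs)"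
proof -
  have "foldl (\<lambda>acc e. tl_tree acc) (lst xs) es = lst (drop (length es) xs)" for es :: "tree list"
    by (induction es arbitrary: xs) (auto simp: drop_Suc)
  then show ?thesis by (simp add: DROP_def)
qed

lemma eval_DROP_num [simp]: "eval DROP (Nd (num a) b) = num (a - length (elems b))"
  using eval_DROP_lst[of "replicate a Lf" b] by (simp add: num_def)

lemma ok_DROP: "sz a \<le> N \<Longrightarrow> ok N DROP (Nd a b)"
proof -
  assume N: "sz a \<le> N"
  have "fold_ok N (ok N (Tl \<diamondop> Hd)) (eval (Tl \<diamondop> Hd)) (Nd a b) a (elems b)"
    by (rule fold_okI[where I = "\<lambda>acc es. sz acc \<le> N"]) (use N sz_hd_tl in \<open>auto intro: le_trans\<close>)
  then show ?thesis by (simp add: DROP_def)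
qed

definition "MUL = Fold Hd LfC (REVAPP \<diamondop> PairF T3 Hd)"

lemma foldl_num_add: "foldl (\<lambda>acc e. F acc) (num a) (replicate k x) = num (a + k * b)"
  if "\<And>c. F (num c) = num (b + c)" for F
  using that by (induction k arbitrary: a) (auto simp del: num_simps simp: algebra_simps)

lemma eval_MUL [simp]: "eval MUL (Nd (num a) (num b)) = num (a * b)"
proof -
  have "foldl (\<lambda>acc e. eval REVAPP (Nd (num b) acc)) (num 0) (replicate a Lf) = num (0 + a * b)"
    by (rule foldl_num_add) simp
  then show ?thesis by (simp add: MUL_def)
qed

lemma ok_MUL: "2 * (a * b) + 2 \<le> N \<Longrightarrow> ok N MUL (Nd (num a) (num b))"
proof -
  assume N: "2 * (a * b) + 2 \<le> N"
  have "fold_ok N (ok N (REVAPP \<diamondop> PairF T3 Hd)) (eval (REVAPP \<diamondop> PairF T3 Hd)) (Nd (num a) (num b)) Lf (replicate a Lf)"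
  proof (rule fold_okI[where I = "\<lambda>acc es. \<exists>k. acc = num (k * b) \<and> k + length es = a"])
    fix acc e and es' :: "tree list"
    assume "\<exists>k. acc = num (k * b) \<and> k + length (e # es') = a"
    then obtain k where k: "acc = num (k * b)" "Suc k + length es' = a" by auto
    then have "Suc k * b \<le> a * b" by (intro mult_le_mono1) simp
    then have le: "sz (num b) + sz (num (k * b)) \<le> N" using N by simp
    then show "ok N (REVAPP \<diamondop> PairF T3 Hd) (Nd acc (Nd e (Nd (num a) (num b)))) \<and>
       sz (eval (REVAPP \<diamondop> PairF T3 Hd) (Nd acc (Nd e (Nd (num a) (num b))))) \<le> N \<and>
       (\<exists>k. eval (REVAPP \<diamondop> PairF T3 Hd) (Nd acc (Nd e (Nd (num a) (num b)))) = num (k * b) \<and> k + length es' = a)"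
      using k ok_REVAPP[OF le] by (auto intro!: exI[of _ "Suc k"])
  qed (auto intro!: exI[of _ 0])
  then show ?thesis by (simp add: MUL_def)
qed

definition "ONE = PairF LfC LfC"

lemma eval_ONE [simp]: "eval ONE v = num 1" and ok_ONE [simp]: "ok N ONE v"
  by (simp_all add: ONE_def)

definition "POW = Fold Tl ONE (MUL \<diamondop> PairF Hd X2)"

lemma eval_POW [simp]: "eval POW (Nd (num g) (num P)) = num (g ^ P)"
proof -
  have "foldl (\<lambda>acc e. eval MUL (Nd acc (num g))) (num a) (replicate k Lf) = num (a * g ^ k)" for a k
    by (induction k arbitrary: a) (auto simp del: num_simps simp: algebra_simps)
  from this[of 1] show ?thesis by (simp add: POW_def del: num_simps)
qed

lemma ok_POW: "1 \<le> g \<Longrightarrow> 2 * g ^ P + 2 \<le> N \<Longrightarrow> ok N POW (Nd (num g) (num P))"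
proof -
  assume g: "1 \<le> g" and N: "2 * g ^ P + 2 \<le> N"
  have "fold_ok N (ok N (MUL \<diamondop> PairF Hd X2)) (eval (MUL \<diamondop> PairF Hd X2)) (Nd (num g) (num P)) (num 1) (replicate P Lf)"
  proof (rule fold_okI[where I = "\<lambda>acc es. \<exists>k. acc = num (g ^ k) \<and> k + length es = P"])
    fix acc e and es' :: "tree list"
    assume "\<exists>k. acc = num (g ^ k) \<and> k + length (e # es') = P"
    then obtain k where k: "acc = num (g ^ k)" "Suc k + length es' = P" by auto
    then have "g ^ Suc k \<le> g ^ P" using g by (intro power_increasing) auto
    then have le: "2 * (g ^ k * g) + 2 \<le> N" using N by (simp add: mult.commute)
    show "ok N (MUL \<diamondop> PairF Hd X2) (Nd acc (Nd e (Nd (num g) (num P)))) \<and>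
       sz (eval (MUL \<diamondop> PairF Hd X2) (Nd acc (Nd e (Nd (num g) (num P))))) \<le> N \<and>
       (\<exists>k. eval (MUL \<diamondop> PairF Hd X2) (Nd acc (Nd e (Nd (num g) (num P)))) = num (g ^ k) \<and> k + length es' = P)"
      using k ok_MUL[OF le] le by (auto intro!: exI[of _ "Suc k"] simp: mult.commute)
  qed (auto intro!: exI[of _ 0])
  then show ?thesis by (simp add: POW_def del: num_simps)
qed

definition "COUNT = Fold Tl LfC (Cond (Eqf X1 X2) (PairF LfC Hd) Hd)"

lemma eval_COUNT [simp]: "eval COUNT (Nd x (lst ys)) = num (count_list ys x)"
proof -
  have "foldl (\<lambda>acc e. if e = x then Nd Lf acc else acc) (num a) ys = num (a + count_list ys x)" for a
  proof (induction ys arbitrary: a)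
    case (Cons y ys)
    show ?case using Cons[of "Suc a"] Cons[of a] by simp
  qed simp
  from this[of 0] show ?thesis by (simp add: COUNT_def cong: if_cong)
qed

lemma ok_COUNT: "2 * length ys + 1 \<le> N \<Longrightarrow> ok N COUNT (Nd x (lst ys))"
proof -
  assume N: "2 * length ys + 1 \<le> N"
  have "fold_ok N (ok N (Cond (Eqf X1 X2) (PairF LfC Hd) Hd)) (eval (Cond (Eqf X1 X2) (PairF LfC Hd) Hd)) (Nd x (lst ys)) Lf ys"
    by (rule fold_okI[where I = "\<lambda>acc es. sz acc + 2 * length es \<le> N"]) (use N in auto)
  then show ?thesis by (simp add: COUNT_def)
qed

definition "LEN = Fold IdF LfC (PairF LfC Hd)"

lemma eval_LEN [simp]: "eval LEN (lst ys) = num (length ys)"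
proof -
  have "foldl (\<lambda>acc e. Nd Lf acc) (num a) ys = num (a + length ys)" for a
  proof (induction ys arbitrary: a)
    case (Cons y ys)
    show ?case using Cons[of "Suc a"] by simp
  qed simp
  from this[of 0] show ?thesis by (simp add: LEN_def)
qed

lemma ok_LEN: "2 * length ys + 1 \<le> N \<Longrightarrow> ok N LEN (lst ys)"
proof -
  assume N: "2 * length ys + 1 \<le> N"
  have "fold_ok N (ok N (PairF LfC Hd)) (eval (PairF LfC Hd)) (lst ys) Lf ys"
    by (rule fold_okI[where I = "\<lambda>acc es. sz acc + 2 * length es \<le> N"]) (use N in auto)
  then show ?thesis by (simp add: LEN_def)
qed

text \<open>Uses max a b = a + (b - a) with truncated subtraction.\<close>

definition "MAXN = REVAPP \<diamondop> PairF Hd (DROP \<diamondop> PairF Tl Hd)"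

lemma eval_MAXN [simp]: "eval MAXN (Nd (num a) (num b)) = num (max a b)"
  by (simp add: MAXN_def max_def)

lemma ok_MAXN: "2 * a + 2 * b + 2 \<le> N \<Longrightarrow> ok N MAXN (Nd (num a) (num b))"
  unfolding MAXN_def by (auto intro!: ok_REVAPP ok_DROP)

definition "KEEP = PairF (Hd \<diamondop> Hd) (PairF X1 (Tl \<diamondop> Hd))"

text \<open>The accumulator pairs a flag, set once \<open>x\<close> has been found, with the
  elements kept so far in reverse; the outer \<open>REVAPP\<close> restores their order.\<close>

definition "REM1 = REVAPP \<diamondop> PairF (Tl \<diamondop> Fold Tl (PairF LfC LfC)
  (Cond (Hd \<diamondop> Hd) KEEP (Cond (Eqf X1 X2) (PairF ONE (Tl \<diamondop> Hd)) KEEP))) LfC"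

lemma eval_REM1 [simp]: "eval REM1 (Nd x (lst ys)) = lst (remove1 x ys)"
proof -
  define f where "f acc e = (if hd_tree acc \<noteq> Lf then Nd (hd_tree acc) (Nd e (tl_tree acc))
      else if e = x then Nd (num 1) (tl_tree acc) else Nd (hd_tree acc) (Nd e (tl_tree acc)))" for acc e
  have 1: "foldl f (Nd (num 1) (lst ks)) zs = Nd (num 1) (lst (rev zs @ ks))" for zs ks
  proof (induction zs arbitrary: ks)
    case (Cons z zs)
    show ?case using Cons[of "z # ks"] by (simp add: f_def)
  qed simp
  have "tl_tree (foldl f (Nd Lf (lst ks)) ys) = lst (rev (remove1 x ys) @ ks)" for ks
  proof (induction ys arbitrary: ks)
    case (Cons y ys)
    show ?case
    proof (cases "y = x")
      case True
      then have "f (Nd Lf (lst ks)) y = Nd (num 1) (lst ks)" by (simp add: f_def)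
      then show ?thesis using 1[of ks ys] True by simp
    next
      case False
      then have "f (Nd Lf (lst ks)) y = Nd Lf (lst (y # ks))" by (simp add: f_def)
      then show ?thesis using Cons[of "y # ks"] False by simp
    qed
  qed simp
  from this[of "[]"] show ?thesis
    by (simp add: REM1_def KEEP_def f_def[abs_def] del: num_simps cong: if_cong)
qed

lemma ok_REM1: "sz (lst ys) + 5 \<le> N \<Longrightarrow> ok N REM1 (Nd x (lst ys))"
proof -
  assume N: "sz (lst ys) + 5 \<le> N"
  let ?b = "Cond (Hd \<diamondop> Hd) KEEP (Cond (Eqf X1 X2) (PairF ONE (Tl \<diamondop> Hd)) KEEP)"
  define f where "f acc e = eval ?b (Nd acc (Nd e (Nd x (lst ys))))" for acc e
  let ?I = "\<lambda>acc es. sz (hd_tree acc) \<le> 3 \<and> 1 + sz (tl_tree acc) + sz (lst es) + 3 \<le> N \<and> acc \<noteq> Lf"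
  have I: "sz (f acc e) \<le> N - 1 \<and> ?I (f acc e) es'" if "?I acc (e # es')" for acc e es'
    using that sz_pos[of "lst es'"] by (cases acc) (auto simp: f_def KEEP_def boolt_def)
  \<comment> \<open>The bound \<open>N - 1\<close> leaves room for the empty list that is the second
    argument of the outer \<open>REVAPP\<close>.\<close>
  have fo: "fold_ok (N - 1) (ok N ?b) (eval ?b) (Nd x (lst ys)) (Nd Lf Lf) ys"
  proof (rule fold_okI[where I = ?I])
    have okb: "ok N ?b w" for w by (simp add: KEEP_def)
    show "ok N ?b (Nd acc (Nd e (Nd x (lst ys)))) \<and> sz (eval ?b (Nd acc (Nd e (Nd x (lst ys))))) \<le> N - 1 \<and>
        ?I (eval ?b (Nd acc (Nd e (Nd x (lst ys))))) es'" if "?I acc (e # es')" for acc e es'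
      using I[OF that] okb unfolding f_def by blast
  qed (use N in auto)
  from fold_ok_sz[OF this _ order_refl] N
  have "sz (foldl (\<lambda>acc e. eval ?b (Nd acc (Nd e (Nd x (lst ys))))) (Nd Lf Lf) ys) \<le> N - 1" by simp
  from le_trans[OF sz_hd_tl(2) this]
  have "ok N REVAPP (Nd (tl_tree (foldl (\<lambda>acc e. eval ?b (Nd acc (Nd e (Nd x (lst ys))))) (Nd Lf Lf) ys)) Lf)"
    using N by (intro ok_REVAPP) simp
  with fold_ok_mono[OF _ _ fo, of N "ok N ?b"] show ?thesis
    by (simp add: REM1_def del: eval.simps(7))
qed

definition nums :: "nat list \<Rightarrow> tree" where "nums xs = lst (map num xs)"

lemma count_list_map_num [simp]: "count_list (map num xs) (num e) = count_list xs e"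
  by (induction xs) auto

lemma remove1_map_num [simp]: "remove1 (num e) (map num xs) = map num (remove1 e xs)"
  by (induction xs) auto

lemma length_elems_nums [simp]: "length (elems (nums xs)) = length xs"
  by (simp add: nums_def)

lemma nums_inj [simp]: "nums xs = nums ys \<longleftrightarrow> xs = ys"
proof -
  have "inj num" by (rule injI) simp
  then show ?thesis unfolding nums_def by (simp add: inj_map_eq_map)
qed

lemma sz_nums: "sz (nums xs) = 1 + (\<Sum>x\<leftarrow>xs. 2 * x + 2)"
  unfolding nums_def sz_lst by (simp add: comp_def)

lemma eval_REM1_nums [simp]: "eval REM1 (Nd (num e) (nums xs)) = nums (remove1 e xs)"
  unfolding nums_def by simp

lemma eval_COUNT_nums [simp]: "eval COUNT (Nd (num e) (nums xs)) = num (count_list xs e)"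
  unfolding nums_def by simp

lemma eval_LEN_nums [simp]: "eval LEN (nums xs) = num (length xs)"
  unfolding nums_def by simp

lemma ok_REM1_nums: "sz (nums ys) + 5 \<le> N \<Longrightarrow> ok N REM1 (Nd x (nums ys))"
  unfolding nums_def by (rule ok_REM1)

lemma ok_COUNT_nums: "2 * length ys + 1 \<le> N \<Longrightarrow> ok N COUNT (Nd x (nums ys))"
  unfolding nums_def by (rule ok_COUNT) simp

lemma ok_LEN_nums: "2 * length ys + 1 \<le> N \<Longrightarrow> ok N LEN (nums ys)"
  unfolding nums_def by (rule ok_LEN) simp

text \<open>Input: \<open>(e, (rem, context))\<close> with \<open>rem\<close> the jobs left after placing \<open>e\<close> and context \<open>(E, (M, p))\<close>.
  The result is \<open>Lf\<close> iff the window is respected.\<close>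

definition "WIN = DROP \<diamondop> PairF
   (MUL \<diamondop> PairF (DROP \<diamondop> PairF (COUNT \<diamondop> PairF Hd T4) (COUNT \<diamondop> PairF Hd X1)) (LEN \<diamondop> T4))
   (REVAPP \<diamondop> PairF
     (MUL \<diamondop> PairF (DROP \<diamondop> PairF (LEN \<diamondop> T4) (LEN \<diamondop> X1)) (COUNT \<diamondop> PairF Hd T4))
     (MUL \<diamondop> PairF X2 (LEN \<diamondop> T4)))"

definition context_tree :: "nat \<Rightarrow> nat \<Rightarrow> nat list \<Rightarrow> tree" where
  "context_tree E M p = Nd (num E) (Nd (num M) (nums p))"

lemma eval_WIN [simp]:
  "eval WIN (Nd (num e) (Nd (nums rem) (context_tree E M p))) = Lf \<longleftrightarrow> in_window E p e rem"
  by (simp add: WIN_def context_tree_def in_window_def)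

lemma ok_WIN:
  assumes "2 * (length p * length p) + 2 * (E * length p) + 2 * length p + 4 \<le> N" "length rem \<le> length p"
  shows "ok N WIN (Nd (num e) (Nd (nums rem) (context_tree E M p)))"
proof -
  let ?n = "length p"
  have 1: "(count_list p e - count_list rem e) * ?n \<le> ?n * ?n"
    by (intro mult_le_mono1) (meson count_le_length diff_le_self le_trans)
  have 2: "(?n - length rem) * count_list p e \<le> ?n * ?n"
    by (intro mult_le_mono) (auto intro: count_le_length)
  have 3: "count_list p e \<le> ?n" by (rule count_le_length)
  have 4: "Suc (Suc (2 * ((count_list p e - count_list rem e) * ?n))) \<le> N" using 1 assms(1) by linarith
  show ?thesis
    unfolding WIN_def context_tree_def
    using assms 4 2 3 by (auto intro!: ok_DROP ok_MUL ok_COUNT_nums ok_LEN_nums ok_REVAPP)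
qed

section \<open>Search states as trees\<close>

definition key_tree :: "key \<Rightarrow> tree" where
  "key_tree k = (case k of (mx, l, i, rem) \<Rightarrow> Nd (num mx) (Nd (num l) (Nd (num i) (nums rem))))"

definition hist_tree :: "(nat \<times> nat) list \<Rightarrow> tree" where
  "hist_tree h = lst (map (\<lambda>x. Nd (num (fst x)) (num (snd x))) h)"

definition cand_tree :: "cand \<Rightarrow> tree" where
  "cand_tree c = Nd (key_tree (fst c)) (hist_tree (snd c))"

definition layer_tree :: "cand list \<Rightarrow> tree" where
  "layer_tree L = lst (map cand_tree L)"

lemma key_tree_inj [simp]: "key_tree k = key_tree k' \<longleftrightarrow> k = k'"
  by (cases k; cases k') (simp add: key_tree_def)

lemma hist_tree_simps [simp]: "hist_tree [] = Lf"
  "hist_tree (x # h) = Nd (Nd (num (fst x)) (num (snd x))) (hist_tree h)"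
  by (simp_all add: hist_tree_def)

lemma layer_tree_simps [simp]: "layer_tree [] = Lf" "layer_tree (c # L) = Nd (cand_tree c) (layer_tree L)"
  by (simp_all add: layer_tree_def)

definition "INS = Cond (Fold Tl LfC (Cond (Eqf (Hd \<diamondop> X1) (Hd \<diamondop> X2)) ONE Hd)) Tl IdF"

lemma eval_INS [simp]: "eval INS (Nd (cand_tree c) (layer_tree L)) = layer_tree (insert_cand L c)"
proof -
  have "foldl (\<lambda>acc e. if hd_tree e = key_tree (fst c) then num 1 else acc) a (map cand_tree L) =
      (if fst c \<in> fst ` set L then num 1 else a)" for a
    by (induction L arbitrary: a) (auto simp: cand_tree_def)
  from this[of Lf] show ?thesis
    by (simp add: INS_def insert_cand_def layer_tree_def cand_tree_def[of c] cong: if_cong)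
qed

lemma ok_INS: "3 \<le> N \<Longrightarrow> ok N INS (Nd c (layer_tree L))"
proof -
  assume N: "3 \<le> N"
  let ?b = "Cond (Eqf (Hd \<diamondop> X1) (Hd \<diamondop> X2)) ONE Hd"
  have "fold_ok N (ok N ?b) (eval ?b) (Nd c (layer_tree L)) Lf es" for es
    by (rule fold_okI[where I = "\<lambda>acc es. sz acc \<le> 3"]) (use N in auto)
  then show ?thesis by (simp add: INS_def)
qed

text \<open>Input: \<open>(l, (i, (mx, (rem, (e, h)))))\<close>.\<close>

definition "MK = PairF (PairF (MAXN \<diamondop> PairF X2 Hd) (PairF Hd (PairF X1 X3))) (PairF (PairF X4 X1) T5)"

lemma eval_MK [simp]:
  "eval MK (Nd (num l) (Nd (num i) (Nd (num mx) (Nd (nums rem) (Nd (num e) (hist_tree h)))))) =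
    cand_tree ((max mx l, l, i, rem), (e, i) # h)"
  by (simp add: MK_def cand_tree_def key_tree_def)

lemma ok_MK: "2 * mx + 2 * l + 2 \<le> N \<Longrightarrow> ok N MK (Nd (num l) (Nd i (Nd (num mx) t)))"
  by (auto simp: MK_def intro!: ok_MAXN)

text \<open>Input of \<open>EXT\<close>: \<open>(layer, (e, (c, context)))\<close>; \<open>SAME\<close> and \<open>NEW\<close> get the jobs remaining after placing
  \<open>e\<close> as an additional first component.\<close>

definition "SAME = INS \<diamondop> PairF (MK \<diamondop> PairF (REVAPP \<diamondop> PairF (X1 \<diamondop> Hd \<diamondop> X3) X2)
    (PairF (X2 \<diamondop> Hd \<diamondop> X3) (PairF (Hd \<diamondop> Hd \<diamondop> X3) (PairF Hd (PairF X2 (Tl \<diamondop> X3)))))) X1"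

definition "NEW = Cond (DROP \<diamondop> PairF X5 (PairF LfC (X2 \<diamondop> Hd \<diamondop> X3)))
    (INS \<diamondop> PairF (MK \<diamondop> PairF X2
      (PairF (PairF LfC (X2 \<diamondop> Hd \<diamondop> X3)) (PairF (Hd \<diamondop> Hd \<diamondop> X3) (PairF Hd (PairF X2 (Tl \<diamondop> X3)))))) SAME)
    SAME"

definition "EXT = Cond (WIN \<diamondop> PairF X2 (PairF Hd T4)) X1 NEW \<diamondop> PairF (REM1 \<diamondop> PairF X1 (T3 \<diamondop> Hd \<diamondop> X2)) IdF"

lemma hd_cand_tree [simp]: "hd_tree (cand_tree ((mx, l, i, rem), h)) = Nd (num mx) (Nd (num l) (Nd (num i) (nums rem)))"
  "tl_tree (cand_tree ((mx, l, i, rem), h)) = hist_tree h"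
  by (simp_all add: cand_tree_def key_tree_def)

lemma eval_SAME:
  "eval SAME (Nd (nums rem') (Nd (layer_tree L) (Nd (num e) (Nd (cand_tree ((mx, l, i, rem), h)) v)))) =
    layer_tree (insert_cand L ((max mx (l + e), l + e, i, rem'), (e, i) # h))"
  by (simp add: SAME_def)

lemma eval_EXT [simp]:
  "eval EXT (Nd (layer_tree L) (Nd (num e) (Nd (cand_tree c) (context_tree E M p)))) =
    layer_tree (foldl insert_cand L (place E p M c e))"
proof -
  obtain mx l i rem h where c: "c = ((mx, l, i, rem), h)" by (metis prod.collapse)
  have m: "Nd Lf (num i) = num (Suc i)" by simp
  have w: "eval WIN (Nd (num e) (Nd (nums (remove1 e rem)) (Nd (num E) (Nd (num M) (nums p))))) = Lf
      \<longleftrightarrow> in_window E p e (remove1 e rem)"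
    using eval_WIN unfolding context_tree_def by blast
  show ?thesis
    unfolding c EXT_def NEW_def place_def context_tree_def
    by (simp add: eval_SAME w m del: num_simps)
qed

text \<open>Room for the unary products compared in \<open>WIN\<close> and for the numeral
  \<open>M\<close>.\<close>

definition params_ok :: "nat \<Rightarrow> nat \<Rightarrow> nat \<Rightarrow> nat list \<Rightarrow> bool" where
  "params_ok N E M p \<longleftrightarrow> 2 * (length p * length p) + 2 * (E * length p) + 2 * length p + 4 \<le> N \<and> 2 * M + 1 \<le> N"

definition cand_ok :: "nat \<Rightarrow> nat list \<Rightarrow> cand \<Rightarrow> bool" where
  "cand_ok N p c \<longleftrightarrow> (case c of ((mx, l, i, rem), h) \<Rightarrow> length rem \<le> length p \<and> sz (nums rem) + 5 \<le> N \<and>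
     (\<forall>e\<in>set rem. 2 * mx + 2 * l + 2 * e + 2 \<le> N))"

lemma ok_EXT:
  assumes "params_ok N E M p" "cand_ok N p c" "e \<in> set (remaining c)"
  shows "ok N EXT (Nd (layer_tree L) (Nd (num e) (Nd (cand_tree c) (context_tree E M p))))"
proof -
  obtain mx l i rem h where c: "c = ((mx, l, i, rem), h)" by (metis prod.collapse)
  have e: "2 * mx + 2 * l + 2 * e + 2 \<le> N" "sz (nums rem) + 5 \<le> N" "length rem \<le> length p"
    using assms(2,3) unfolding c cand_ok_def remaining_def by auto
  have M: "2 * M + 1 \<le> N" and N3: "3 \<le> N" using assms(1) unfolding params_ok_def by auto
  have win: "ok N WIN (Nd (num e) (Nd (nums (remove1 e rem)) (context_tree E M p)))"
    using assms(1) e(3) unfolding params_ok_def by (intro ok_WIN) (auto simp: length_remove1)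
  let ?v = "Nd (nums (remove1 e rem)) (Nd (layer_tree L) (Nd (num e) (Nd (cand_tree c) (context_tree E M p))))"
  have same: "ok N SAME ?v"
    unfolding c SAME_def using e N3 by (auto intro!: ok_INS ok_MK ok_REVAPP)
  have "ok N NEW ?v"
    unfolding NEW_def using same e M N3 unfolding c
    by (auto simp: eval_SAME context_tree_def intro!: ok_INS ok_MK ok_DROP)
  then show ?thesis
    unfolding EXT_def using win e(2) unfolding c by (auto intro!: ok_REM1_nums)
qed

text \<open>Insertion only adds at the front, so every intermediate accumulator is a suffix of the
  finished layer. A size bound for the finished layers therefore covers all accumulators of the
  nested loops.\<close>

lemma insert_all_suffix: "\<exists>ys. foldl insert_cand acc cs = ys @ acc"
  by (induction cs arbitrary: acc) (auto simp: insert_cand_def, metis append.assoc append_Cons append_Nil)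

lemma sz_layer_suffix: "sz (layer_tree acc) \<le> sz (layer_tree (ys @ acc))"
  by (induction ys) auto

lemma sz_insert_all: "sz (layer_tree acc) \<le> sz (layer_tree (foldl insert_cand acc cs))"
  using insert_all_suffix[of acc cs] sz_layer_suffix by metis

text \<open>Input: \<open>(layer, (c, context))\<close>.\<close>

definition "EXTALL = Fold (T3 \<diamondop> Hd \<diamondop> X1) Hd (EXT \<diamondop> PairF Hd (PairF X1 T3))"

lemma foldl_layer_tree:
  assumes "\<And>L x. F (layer_tree L) (g x) = layer_tree (G L x)"
  shows "foldl F (layer_tree L) (map g xs) = layer_tree (foldl G L xs)"
  using assms by (induction xs arbitrary: L) auto

lemma eval_EXTALL [simp]:
  "eval EXTALL (Nd (layer_tree L) (Nd (cand_tree c) (context_tree E M p))) = layer_tree (extend_all E p M L c)"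
proof -
  obtain mx l i rem h where c: "c = ((mx, l, i, rem), h)" by (metis prod.collapse)
  show ?thesis
    using foldl_layer_tree[of "\<lambda>acc e. eval EXT (Nd acc (Nd e (Nd (cand_tree c) (context_tree E M p))))" num
        "\<lambda>L e. foldl insert_cand L (place E p M c e)" L rem]
    unfolding EXTALL_def extend_all_def by (simp add: c remaining_def nums_def)
qed

text \<open>The invariant says that running the rest of the loop on the current accumulator yields
  the final list; by \<open>sz_insert_all\<close> the accumulator is then no larger than that
  list.\<close>

lemma ok_EXTALL:
  assumes "params_ok N E M p" "cand_ok N p c" "sz (layer_tree (extend_all E p M L c)) \<le> N"
  shows "ok N EXTALL (Nd (layer_tree L) (Nd (cand_tree c) (context_tree E M p)))"
proof -
  obtain mx l i rem h where c: "c = ((mx, l, i, rem), h)" by (metis prod.collapse)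
  let ?v = "Nd (layer_tree L) (Nd (cand_tree c) (context_tree E M p))"
  let ?b = "EXT \<diamondop> PairF Hd (PairF X1 T3)"
  let ?G = "\<lambda>L e. foldl insert_cand L (place E p M c e)"
  have "fold_ok N (ok N ?b) (eval ?b) ?v (layer_tree L) (map num rem)"
  proof (rule fold_okI[where I = "\<lambda>acc es. \<exists>L' es'. acc = layer_tree L' \<and> es = map num es' \<and> set es' \<subseteq> set rem \<and>
        foldl ?G L' es' = extend_all E p M L c"])
    show "\<exists>L' es'. layer_tree L = layer_tree L' \<and> map num rem = map num es' \<and> set es' \<subseteq> set rem \<and>
        foldl ?G L' es' = extend_all E p M L c"
      by (intro exI[of _ L] exI[of _ rem]) (simp add: extend_all_def remaining_def c)
    fix acc e es'
    assume "\<exists>L' ds. acc = layer_tree L' \<and> e # es' = map num ds \<and> set ds \<subseteq> set rem \<and>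
        foldl ?G L' ds = extend_all E p M L c"
    then obtain L' d ds where d: "acc = layer_tree L'" "e = num d" "es' = map num ds" "set (d # ds) \<subseteq> set rem"
      "foldl ?G (?G L' d) ds = extend_all E p M L c" by (auto simp: Cons_eq_map_conv)
    have "foldl ?G (?G L' d) ds = foldl insert_cand (?G L' d) (concat (map (place E p M c) ds))"
      unfolding foldl_concat foldl_map' ..
    then have "sz (layer_tree (?G L' d)) \<le> N"
      using sz_insert_all[of "?G L' d" "concat (map (place E p M c) ds)"] d(5) assms(3) by simp
    moreover have "ok N EXT (Nd acc (Nd e (Nd (cand_tree c) (context_tree E M p))))"
      unfolding d(1,2) using d(4) by (intro ok_EXT[OF assms(1,2)]) (simp add: remaining_def c)
    ultimately show "ok N ?b (Nd acc (Nd e ?v)) \<and> sz (eval ?b (Nd acc (Nd e ?v))) \<le> N \<and>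
       (\<exists>L' ds. eval ?b (Nd acc (Nd e ?v)) = layer_tree L' \<and> es' = map num ds \<and> set ds \<subseteq> set rem \<and>
        foldl ?G L' ds = extend_all E p M L c)"
      using d by (auto intro!: exI[of _ "?G L' d"] exI[of _ ds])
  qed
  then show ?thesis by (simp add: EXTALL_def c nums_def)
qed

definition "STEP = Fold Hd LfC (EXTALL \<diamondop> PairF Hd (PairF X1 T3))"

lemma eval_STEP [simp]:
  "eval STEP (Nd (layer_tree L) (context_tree E M p)) = layer_tree (layer_step E p M L)"
  using foldl_layer_tree[of "\<lambda>acc e. eval EXTALL (Nd acc (Nd e (context_tree E M p)))" cand_tree
      "\<lambda>L c. extend_all E p M L c" "[]" L]
  unfolding STEP_def layer_step_def by (simp add: layer_tree_def[of L])

lemma sz_extend_all: "sz (layer_tree L) \<le> sz (layer_tree (foldl (extend_all E p M) L cs))"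
proof (induction cs arbitrary: L)
  case (Cons c cs)
  have "sz (layer_tree L) \<le> sz (layer_tree (extend_all E p M L c))"
    unfolding extend_all_eq by (rule sz_insert_all)
  also note Cons
  finally show ?case by simp
qed simp

lemma ok_STEP:
  assumes "params_ok N E M p" "\<And>c. c \<in> set L \<Longrightarrow> cand_ok N p c" "sz (layer_tree (layer_step E p M L)) \<le> N"
  shows "ok N STEP (Nd (layer_tree L) (context_tree E M p))"
proof -
  let ?v = "Nd (layer_tree L) (context_tree E M p)"
  let ?b = "EXTALL \<diamondop> PairF Hd (PairF X1 T3)"
  let ?G = "extend_all E p M"
  have "fold_ok N (ok N ?b) (eval ?b) ?v Lf (map cand_tree L)"
  proof (rule fold_okI[where I = "\<lambda>acc es. \<exists>L' cs. acc = layer_tree L' \<and> es = map cand_tree cs \<and> set cs \<subseteq> set L \<and>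
        foldl ?G L' cs = layer_step E p M L"])
    show "\<exists>L' cs. Lf = layer_tree L' \<and> map cand_tree L = map cand_tree cs \<and> set cs \<subseteq> set L \<and>
        foldl ?G L' cs = layer_step E p M L"
      by (intro exI[of _ "[]"] exI[of _ L]) (simp add: layer_step_def)
    fix acc e es'
    assume "\<exists>L' cs. acc = layer_tree L' \<and> e # es' = map cand_tree cs \<and> set cs \<subseteq> set L \<and>
        foldl ?G L' cs = layer_step E p M L"
    then obtain L' c cs where d: "acc = layer_tree L'" "e = cand_tree c" "es' = map cand_tree cs"
      "set (c # cs) \<subseteq> set L" "foldl ?G (?G L' c) cs = layer_step E p M L" by (auto simp: Cons_eq_map_conv)
    have sz: "sz (layer_tree (?G L' c)) \<le> N"
      using sz_extend_all[of "?G L' c" E p M cs] d(5) assms(3) by simp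
    have "ok N EXTALL (Nd acc (Nd e (context_tree E M p)))"
      unfolding d(1,2) using d(4) by (intro ok_EXTALL[OF assms(1,2) sz]) auto
    then show "ok N ?b (Nd acc (Nd e ?v)) \<and> sz (eval ?b (Nd acc (Nd e ?v))) \<le> N \<and>
       (\<exists>L' cs. eval ?b (Nd acc (Nd e ?v)) = layer_tree L' \<and> es' = map cand_tree cs \<and> set cs \<subseteq> set L \<and>
        foldl ?G L' cs = layer_step E p M L)"
      using d sz by (intro conjI exI[of _ "?G L' c"] exI[of _ cs]) auto
  qed
  then show ?thesis by (simp add: STEP_def layer_tree_def)
qed

text \<open>The fold runs over the jobs merely to count \<open>length p\<close> rounds. Its start
  value is the list with the single candidate \<open>((0, 0, 0, p), [])\<close>.\<close>

definition "LAYERS = Fold T2 (PairF (PairF (PairF LfC (PairF LfC (PairF LfC T2))) LfC) LfC) (STEP \<diamondop> PairF Hd T2)"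

lemma eval_LAYERS [simp]:
  "eval LAYERS (context_tree E M p) = layer_tree (layer E p M (length p))"
proof -
  have 1: "foldl (\<lambda>acc e. eval STEP (Nd acc (context_tree E M p))) (layer_tree L) (map num ds) =
      layer_tree ((layer_step E p M ^^ length ds) L)" for L and ds :: "nat list"
    by (induction ds arbitrary: L) (auto simp: funpow_swap1)
  have 2: "cand_tree ((0, 0, 0, p), []) = Nd (Nd Lf (Nd Lf (Nd Lf (nums p)))) Lf"
    by (simp add: cand_tree_def key_tree_def)
  show ?thesis
    using 1[of "[((0, 0, 0, p), [])]" p] unfolding layer_def LAYERS_def
    by (simp add: context_tree_def 2 nums_def)
qed

lemma ok_LAYERS:
  assumes "params_ok N E M p" "\<And>k c. k < length p \<Longrightarrow> c \<in> set (layer E p M k) \<Longrightarrow> cand_ok N p c"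
    "\<And>k. k \<le> length p \<Longrightarrow> sz (layer_tree (layer E p M k)) \<le> N"
  shows "ok N LAYERS (context_tree E M p)"
proof -
  let ?b = "STEP \<diamondop> PairF Hd T2" and ?v = "context_tree E M p"
  have init: "Nd (Nd (Nd Lf (Nd Lf (Nd Lf (nums p)))) Lf) Lf = layer_tree (layer E p M 0)"
    by (simp add: cand_tree_def key_tree_def layer_0)
  have "fold_ok N (ok N ?b) (eval ?b) ?v (layer_tree (layer E p M 0)) (map num p)"
  proof (rule fold_okI[where I = "\<lambda>acc es. \<exists>k. acc = layer_tree (layer E p M k) \<and> k + length es = length p"])
    fix acc e and es' :: "tree list"
    assume "\<exists>k. acc = layer_tree (layer E p M k) \<and> k + length (e # es') = length p"
    then obtain k where k: "acc = layer_tree (layer E p M k)" "k < length p" "Suc k + length es' = length p" by auto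
    have "ok N STEP (Nd acc (context_tree E M p))"
      unfolding k(1) using assms(2)[OF k(2)] assms(3)[of "Suc k"] k(2)
      by (intro ok_STEP assms(1)) (auto simp: layer_Suc)
    then show "ok N ?b (Nd acc (Nd e ?v)) \<and> sz (eval ?b (Nd acc (Nd e ?v))) \<le> N \<and>
       (\<exists>k. eval ?b (Nd acc (Nd e ?v)) = layer_tree (layer E p M k) \<and> k + length es' = length p)"
      using k assms(3)[of "Suc k"] by (auto simp flip: layer_Suc intro!: exI[of _ "Suc k"])
  qed (auto intro!: exI[of _ 0])
  then show ?thesis
    unfolding LAYERS_def by (simp add: context_tree_def nums_def init[unfolded nums_def])
qed

definition "BEST = Fold IdF Hd (Cond (DROP \<diamondop> PairF (Hd \<diamondop> Hd \<diamondop> Hd) (Hd \<diamondop> Hd \<diamondop> X1)) X1 Hd)"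

lemma hd_hd_cand_tree: "hd_tree (hd_tree (cand_tree c)) = num (fst (fst c))"
  by (cases c) (auto simp: cand_tree_def key_tree_def)

lemma eval_BEST [simp]: "L \<noteq> [] \<Longrightarrow> eval BEST (layer_tree L) = cand_tree (best L)"
proof -
  assume L: "L \<noteq> []"
  let ?F = "\<lambda>acc e. if eval DROP (Nd (hd_tree (hd_tree acc)) (hd_tree (hd_tree e))) \<noteq> Lf then e else acc"
  have "foldl ?F (cand_tree b) (map cand_tree cs) =
      cand_tree (foldl (\<lambda>b c. if fst (fst c) < fst (fst b) then c else b) b cs)" for b cs
  proof (induction cs arbitrary: b)
    case (Cons c cs)
    have "?F (cand_tree b) (cand_tree c) = cand_tree (if fst (fst c) < fst (fst b) then c else b)"
      by (simp add: hd_hd_cand_tree)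
    then show ?case using Cons[of "if fst (fst c) < fst (fst b) then c else b"] by simp
  qed simp
  moreover have "hd_tree (layer_tree L) = cand_tree (hd L)" using L by (cases L) auto
  ultimately show ?thesis by (simp add: BEST_def best_def layer_tree_def cong: if_cong)
qed

lemma ok_BEST: "sz v \<le> N \<Longrightarrow> ok N BEST v"
proof -
  assume N: "sz v \<le> N"
  let ?b = "Cond (DROP \<diamondop> PairF (Hd \<diamondop> Hd \<diamondop> Hd) (Hd \<diamondop> Hd \<diamondop> X1)) X1 Hd"
  have el: "sz x \<le> sz w" if "x \<in> set (elems w)" for x w
    using that by (induction w) auto
  have "fold_ok N (ok N ?b) (eval ?b) v (hd_tree v) (elems v)"
  proof (rule fold_okI[where I = "\<lambda>acc es. sz acc \<le> N"])
    show "sz (hd_tree v) \<le> N" using N sz_hd_tl(1) le_trans by blast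
    fix acc e es' assume e: "e \<in> set (elems v)" and acc: "sz acc \<le> N"
    have "sz (hd_tree (hd_tree acc)) \<le> N" using acc sz_hd_tl(1) le_trans by blast
    then show "ok N ?b (Nd acc (Nd e v)) \<and> sz (eval ?b (Nd acc (Nd e v))) \<le> N \<and> sz (eval ?b (Nd acc (Nd e v))) \<le> N"
      using acc el[OF e] N by (auto intro!: ok_DROP)
  qed
  then show ?thesis by (simp add: BEST_def)
qed

section \<open>Writing the schedule\<close>

definition "TAKEJ = Fold Tl (PairF LfC LfC)
  (Cond (Hd \<diamondop> Hd) KEEP (Cond (Eqf (Hd \<diamondop> X1) X2) (PairF (PairF (Tl \<diamondop> X1) LfC) (Tl \<diamondop> Hd)) KEEP))"

text \<open>The extra node around the machine index separates \<open>Some 0\<close> from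
  \<open>None\<close>, because \<open>num 0\<close> is \<open>Lf\<close>.\<close>

definition taken_tree :: "nat option \<times> (nat \<times> nat) list \<Rightarrow> tree" where
  "taken_tree x = Nd (case fst x of None \<Rightarrow> Lf | Some i \<Rightarrow> Nd (num i) Lf) (hist_tree (snd x))"

lemma eval_TAKEJ [simp]: "eval TAKEJ (Nd (num e) (hist_tree h)) = taken_tree (take_job e h)"
proof -
  let ?F = "\<lambda>acc x. if hd_tree acc \<noteq> Lf then Nd (hd_tree acc) (Nd x (tl_tree acc))
      else if hd_tree x = num e then Nd (Nd (tl_tree x) Lf) (tl_tree acc) else Nd (hd_tree acc) (Nd x (tl_tree acc))"
  let ?f = "\<lambda>(r, kept) x. if r = None \<and> fst x = e then (Some (snd x), kept) else (r, x # kept)"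
  have "foldl ?F (taken_tree a) (map (\<lambda>x. Nd (num (fst x)) (num (snd x))) h) = taken_tree (foldl ?f a h)" for a
  proof (induction h arbitrary: a)
    case (Cons x h)
    have "?F (taken_tree a) (Nd (num (fst x)) (num (snd x))) = taken_tree (?f a x)"
      by (cases a) (auto simp: taken_tree_def split: option.splits)
    then show ?case using Cons[of "?f a x"] by simp
  qed simp
  from this[of "(None, [])"] show ?thesis
    by (simp add: TAKEJ_def KEEP_def take_job_def hist_tree_def taken_tree_def[of "(None, [])"] cong: if_cong)
qed

lemma ok_TAKEJ: "sz (hist_tree h) + 2 \<le> N \<Longrightarrow> ok N TAKEJ (Nd e (hist_tree h))"
proof -
  assume N: "sz (hist_tree h) + 2 \<le> N"
  let ?b = "Cond (Hd \<diamondop> Hd) KEEP (Cond (Eqf (Hd \<diamondop> X1) X2) (PairF (PairF (Tl \<diamondop> X1) LfC) (Tl \<diamondop> Hd)) KEEP)"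
  have "fold_ok N (ok N ?b) (eval ?b) (Nd e (hist_tree h)) (Nd Lf Lf) (elems (hist_tree h))"
  proof (rule fold_okI[where I = "\<lambda>acc es. sz (hd_tree acc) + sz (tl_tree acc) + sz (lst es) \<le> N \<and> acc \<noteq> Lf"])
    fix acc x es'
    assume x: "x \<in> set (elems (hist_tree h))" and I: "sz (hd_tree acc) + sz (tl_tree acc) + sz (lst (x # es')) \<le> N \<and> acc \<noteq> Lf"
    obtain y z where "x = Nd y z" using x unfolding hist_tree_def by auto
    then show "ok N ?b (Nd acc (Nd x (Nd e (hist_tree h)))) \<and> sz (eval ?b (Nd acc (Nd x (Nd e (hist_tree h))))) \<le> N \<and>
       sz (hd_tree (eval ?b (Nd acc (Nd x (Nd e (hist_tree h)))))) + sz (tl_tree (eval ?b (Nd acc (Nd x (Nd e (hist_tree h)))))) +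
         sz (lst es') \<le> N \<and> eval ?b (Nd acc (Nd x (Nd e (hist_tree h)))) \<noteq> Lf"
      using I sz_pos[of "lst es'"] sz_pos[of y] by (cases acc) (auto simp: KEEP_def)
  qed (use N in auto)
  then show ?thesis by (simp add: TAKEJ_def)
qed

text \<open>Walks along the unary number with a toggling bit and increases the quotient at every
  second element.\<close>

definition "HALF = Fold IdF (PairF LfC LfC)
  (Cond (Hd \<diamondop> Hd) (PairF LfC (PairF LfC (Tl \<diamondop> Hd))) (PairF ONE (Tl \<diamondop> Hd)))"

lemma eval_HALF [simp]: "eval HALF (num n) = Nd (num (n mod 2)) (num (n div 2))"
proof -
  let ?F = "\<lambda>acc e. if hd_tree acc \<noteq> Lf then Nd Lf (Nd Lf (tl_tree acc)) else Nd (num 1) (tl_tree acc)"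
  have "foldl ?F (Nd (num (a mod 2)) (num (a div 2))) (replicate k Lf) = Nd (num ((a + k) mod 2)) (num ((a + k) div 2))" for a k
  proof (induction k arbitrary: a)
    case (Suc k)
    have "?F (Nd (num (a mod 2)) (num (a div 2))) Lf = Nd (num (Suc a mod 2)) (num (Suc a div 2))"
      by (cases "a mod 2 = 0") (auto simp: mod_Suc div_Suc)
    then show ?case using Suc[of "Suc a"] by simp
  qed simp
  from this[of 0 n] show ?thesis by (simp add: HALF_def del: num_simps cong: if_cong) (simp add: num_simps)
qed

lemma ok_HALF: "2 * n + 5 \<le> N \<Longrightarrow> ok N HALF (num n)"
proof -
  assume N: "2 * n + 5 \<le> N"
  let ?b = "Cond (Hd \<diamondop> Hd) (PairF LfC (PairF LfC (Tl \<diamondop> Hd))) (PairF ONE (Tl \<diamondop> Hd))"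
  have "fold_ok N (ok N ?b) (eval ?b) (num n) (Nd Lf Lf) (replicate n Lf)"
    by (rule fold_okI[where I = "\<lambda>acc es. sz (tl_tree acc) + 2 * length es + 4 \<le> N"]) (use N in auto)
  then show ?thesis by (simp add: HALF_def)
qed

text \<open>The accumulator holds the part still to be converted and the bits found so far, lowest
  last. The \<open>n\<close> rounds are more than enough; once the first component is 0, a round
  changes nothing.\<close>

definition "BIN = Tl \<diamondop> Fold IdF (PairF IdF LfC)
  (Cond (Hd \<diamondop> Hd) (PairF (Tl \<diamondop> Hd) (PairF (Hd \<diamondop> Hd) Tl) \<diamondop> PairF (HALF \<diamondop> (Hd \<diamondop> Hd)) (Tl \<diamondop> Hd)) Hd)"

lemma eval_BIN [simp]: "eval BIN (num n) = lst (map symt (bin n))"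
proof -
  let ?F = "\<lambda>acc e. if hd_tree acc \<noteq> Lf then Nd (tl_tree (eval HALF (hd_tree acc))) (Nd (hd_tree (eval HALF (hd_tree acc))) (tl_tree acc)) else acc"
  have "foldl ?F (Nd (num c) (lst bits)) (replicate k Lf) = Nd Lf (lst (map symt (bin c) @ bits))" if "c \<le> k" for c k bits
    using that
  proof (induction k arbitrary: c bits)
    case (Suc k)
    show ?case
    proof (cases "c = 0")
      case True
      have "foldl ?F (Nd Lf (lst bits)) (replicate j Lf) = Nd Lf (lst bits)" for j by (induction j) auto
      then show ?thesis using True by simp
    next
      case False
      then have "?F (Nd (num c) (lst bits)) Lf = Nd (num (c div 2)) (lst (symt (c mod 2 + 1) # bits))"
        by (simp add: symt_def)
      moreover have "map symt (bin c) @ bits = map symt (bin (c div 2)) @ symt (c mod 2 + 1) # bits"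
        using False by (subst bin.simps) (simp del: bin.simps)
      moreover have "c div 2 \<le> k" using Suc.prems False by linarith
      ultimately show ?thesis using Suc.IH[of "c div 2" "symt (c mod 2 + 1) # bits"] by (simp del: bin.simps)
    qed
  qed simp
  from this[of n n "[]"] show ?thesis by (simp add: BIN_def del: bin.simps cong: if_cong)
qed

lemma ok_BIN: "6 * n + 5 \<le> N \<Longrightarrow> ok N BIN (num n)"
proof -
  assume N: "6 * n + 5 \<le> N"
  let ?b = "Cond (Hd \<diamondop> Hd) (PairF (Tl \<diamondop> Hd) (PairF (Hd \<diamondop> Hd) Tl) \<diamondop> PairF (HALF \<diamondop> (Hd \<diamondop> Hd)) (Tl \<diamondop> Hd)) Hd"
  have "fold_ok N (ok N ?b) (eval ?b) (num n) (Nd (num n) Lf) (replicate n Lf)"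
  proof (rule fold_okI[where I = "\<lambda>acc es. \<exists>c. hd_tree acc = num c \<and> c \<le> n \<and> acc \<noteq> Lf \<and> sz (tl_tree acc) + 4 * length es \<le> 4 * n + 1"])
    fix acc e and es' :: "tree list"
    assume "\<exists>c. hd_tree acc = num c \<and> c \<le> n \<and> acc \<noteq> Lf \<and> sz (tl_tree acc) + 4 * length (e # es') \<le> 4 * n + 1"
    then obtain c bits where c: "acc = Nd (num c) bits" "c \<le> n" "sz bits + 4 * length es' + 4 \<le> 4 * n + 1" by (cases acc) auto
    have "c mod 2 \<le> 1" by simp
    then have "ok N HALF (num c)" "sz (num (c mod 2)) \<le> 3" "c div 2 \<le> n" using N c(2) by (auto intro!: ok_HALF simp del: num_simps)
    then show "ok N ?b (Nd acc (Nd e (num n))) \<and> sz (eval ?b (Nd acc (Nd e (num n)))) \<le> N \<and>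
       (\<exists>c. hd_tree (eval ?b (Nd acc (Nd e (num n)))) = num c \<and> c \<le> n \<and> eval ?b (Nd acc (Nd e (num n))) \<noteq> Lf \<and>
         sz (tl_tree (eval ?b (Nd acc (Nd e (num n))))) + 4 * length es' \<le> 4 * n + 1)"
      using c N by (cases "c = 0") auto
  qed auto
  then show ?thesis by (simp add: BIN_def)
qed

declare bin.simps [simp del]

definition out_syms :: "nat list \<Rightarrow> nat list" where
  "out_syms is = concat (map (\<lambda>i. bin i @ [3]) is)"

lemma out_syms_simps [simp]: "out_syms [] = []" "out_syms (i # is) = bin i @ 3 # out_syms is"
  by (simp_all add: out_syms_def)

text \<open>The output is collected in reverse: the bits are put in front by \<open>REVAPP\<close>,
  followed by the separator, whose tree is \<open>PairF LfC ONE\<close>.\<close>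

definition "EMIT = PairF (PairF (PairF LfC ONE) (REVAPP \<diamondop> PairF (BIN \<diamondop> (Hd \<diamondop> Hd \<diamondop> Hd)) Tl)) (Tl \<diamondop> Hd)"

definition "OUT = REVAPP \<diamondop> PairF (Hd \<diamondop> Fold Tl (PairF LfC Hd)
   (EMIT \<diamondop> PairF (TAKEJ \<diamondop> PairF X1 (Tl \<diamondop> Hd)) (Hd \<diamondop> Hd))) LfC"

lemma eval_EMIT [simp]:
  "eval EMIT (Nd (taken_tree (Some i, h)) (lst os)) = Nd (lst (rev (map symt (bin i @ [3])) @ os)) (hist_tree h)"
  by (simp add: EMIT_def taken_tree_def symt_def eval_nat_numeral)

abbreviation "OUTBODY \<equiv> EMIT \<diamondop> PairF (TAKEJ \<diamondop> PairF X1 (Tl \<diamondop> Hd)) (Hd \<diamondop> Hd)"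

lemma eval_OUTBODY:
  assumes "take_job e h = (Some i, kept)"
  shows "eval OUTBODY (Nd (Nd (lst os) (hist_tree h)) (Nd (num e) v)) =
    Nd (lst (rev (map symt (bin i @ [3])) @ os)) (hist_tree kept)"
  by (simp add: assms)

lemma eval_OUT_fold:
  assumes "mset (map fst h) = mset p"
  shows "\<exists>h'. foldl (\<lambda>acc e. eval OUTBODY (Nd acc (Nd e v))) (Nd (lst os) (hist_tree h)) (map num p) =
    Nd (lst (rev (map symt (out_syms (assign p h))) @ os)) (hist_tree h')"
  using assms
proof (induction p arbitrary: h os)
  case (Cons e p)
  have "e \<in> fst ` set h" using arg_cong[OF Cons.prems, of set_mset] by auto
  then obtain i kept where tj: "take_job e h = (Some i, kept)" "mset h = add_mset (e, i) (mset kept)"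
    by (rule take_job_props)
  then have "mset (map fst kept) = mset p" using Cons.prems by simp
  from Cons.IH[OF this, of "rev (map symt (bin i @ [3])) @ os"] show ?case
    using eval_OUTBODY[OF tj(1), of os v] tj(1) by (simp del: eval.simps)
next
  case Nil
  show ?case by (intro exI[of _ h]) simp
qed

lemma eval_OUT [simp]:
  assumes "mset (map fst h) = mset p"
  shows "eval OUT (Nd (hist_tree h) (nums p)) = lst (map symt (out_syms (assign p h)))"
proof -
  obtain h' where "foldl (\<lambda>acc e. eval OUTBODY (Nd acc (Nd e (Nd (hist_tree h) (nums p))))) (Nd (lst []) (hist_tree h)) (map num p) =
    Nd (lst (rev (map symt (out_syms (assign p h))) @ [])) (hist_tree h')"
    using eval_OUT_fold[OF assms] by blast
  then show ?thesis by (simp add: OUT_def nums_def)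
qed

lemma length_bin_le: "length (bin n) \<le> n"
proof (induction n rule: less_induct)
  case (less n)
  show ?case
  proof (cases "n = 0")
    case True
    then show ?thesis by (simp add: bin.simps)
  next
    case False
    then have "length (bin (n div 2)) \<le> n div 2" using less by simp
    then show ?thesis using False by (subst bin.simps) simp
  qed
qed

lemma set_bin: "set (bin n) \<subseteq> {1, 2}"
proof (induction n rule: less_induct)
  case (less n)
  show ?case
  proof (cases "n = 0")
    case True
    then show ?thesis by (simp add: bin.simps)
  next
    case False
    then have "set (bin (n div 2)) \<subseteq> {1, 2}" using less by simp
    moreover have "n mod 2 + 1 \<in> {1, 2}" by auto
    ultimately show ?thesis using False by (subst bin.simps) simp
  qed
qed

lemma sz_symts: "set w \<subseteq> {1, 2, 3} \<Longrightarrow> sz (lst (map symt w)) \<le> 6 * length w + 1"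
proof (induction w)
  case (Cons a w)
  then show ?case using sz_symt[of a] by auto
qed simp

text \<open>A job emits at most \<open>I + 1\<close> symbols, each adding at most 6 to the size of
  the output list. The invariant reserves \<open>6 * (I + 1)\<close> of the budget \<open>Q\<close>
  for every job still to come.\<close>

lemma ok_OUT:
  assumes h: "mset (map fst h) = mset p" and I: "\<And>x. x \<in> set h \<Longrightarrow> snd x \<le> I"
    and N: "6 * (I + 1) * length p + 6 * I + sz (hist_tree h) + 10 \<le> N"
  shows "ok N OUT (Nd (hist_tree h) (nums p))"
proof -
  let ?v = "Nd (hist_tree h) (nums p)"
  let ?F = "\<lambda>acc e. eval OUTBODY (Nd acc (Nd e ?v))"
  define Q where "Q = 6 * (I + 1) * length p + 1"
  have fo: "fold_ok (N - 1) (ok N OUTBODY) (eval OUTBODY) ?v (Nd Lf (hist_tree h)) (map num p)"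
  proof (rule fold_okI[where I = "\<lambda>acc es. \<exists>os h' ds. acc = Nd (lst os) (hist_tree h') \<and> es = map num ds \<and>
      mset (map fst h') = mset ds \<and> (\<forall>x\<in>set h'. snd x \<le> I) \<and> sz (hist_tree h') \<le> sz (hist_tree h) \<and>
      sz (lst os) + 6 * (I + 1) * length ds \<le> Q"])
    show "\<exists>os h' ds. Nd Lf (hist_tree h) = Nd (lst os) (hist_tree h') \<and> map num p = map num ds \<and>
      mset (map fst h') = mset ds \<and> (\<forall>x\<in>set h'. snd x \<le> I) \<and> sz (hist_tree h') \<le> sz (hist_tree h) \<and>
      sz (lst os) + 6 * (I + 1) * length ds \<le> Q"
      using h I by (intro exI[of _ "[]"] exI[of _ h] exI[of _ p]) (simp add: Q_def)
    fix acc e es'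
    assume "\<exists>os h' ds. acc = Nd (lst os) (hist_tree h') \<and> e # es' = map num ds \<and>
      mset (map fst h') = mset ds \<and> (\<forall>x\<in>set h'. snd x \<le> I) \<and> sz (hist_tree h') \<le> sz (hist_tree h) \<and>
      sz (lst os) + 6 * (I + 1) * length ds \<le> Q"
    then obtain os h' cs where c: "acc = Nd (lst os) (hist_tree h')" "e # es' = map num cs"
      "mset (map fst h') = mset cs" "\<forall>x\<in>set h'. snd x \<le> I" "sz (hist_tree h') \<le> sz (hist_tree h)"
      "sz (lst os) + 6 * (I + 1) * length cs \<le> Q"
      by (elim exE conjE) (rule that)
    obtain d ds where ds: "cs = d # ds" "e = num d" "es' = map num ds"
      using c(2) by (auto simp: Cons_eq_map_conv)
    have d: "acc = Nd (lst os) (hist_tree h')" "e = num d" "es' = map num ds"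
      "mset (map fst h') = mset (d # ds)" "\<And>x. x \<in> set h' \<Longrightarrow> snd x \<le> I" "sz (hist_tree h') \<le> sz (hist_tree h)"
      "sz (lst os) + (6 * (I + 1) + 6 * (I + 1) * length ds) \<le> Q"
      using c ds by simp_all
    have "d \<in> fst ` set h'" using arg_cong[OF d(4), of set_mset] by auto
    then obtain i kept where tj: "take_job d h' = (Some i, kept)" "mset h' = add_mset (d, i) (mset kept)"
      by (rule take_job_props)
    have set_h': "set h' = insert (d, i) (set kept)" using arg_cong[OF tj(2), of set_mset] by simp
    have i: "i \<le> I" using d(5)[of "(d, i)"] set_h' by simp
    have szk: "sz (hist_tree kept) \<le> sz (hist_tree h')"
    proof -
      have "sz (hist_tree g) = 1 + sum_mset (image_mset (\<lambda>x. 1 + sz (Nd (num (fst x)) (num (snd x)))) (mset g))" for g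
        unfolding hist_tree_def sz_lst by (simp add: comp_def flip: sum_mset_sum_list)
      then show ?thesis using tj(2) by simp
    qed
    let ?os = "rev (map symt (bin i @ [3])) @ os"
    have "sz (lst (xs @ ys)) + 1 = sz (lst xs) + sz (lst ys)" for xs ys unfolding sz_lst by simp
    from this[of "rev (map symt (bin i @ [3]))" os]
    have "sz (lst ?os) + 1 = sz (lst (map symt (bin i @ [3]))) + sz (lst os)"
      unfolding sz_lst by (simp add: rev_map[symmetric] sum_list_rev del: map_append)
    moreover have "sz (lst (map symt (bin i @ [3]))) \<le> 6 * length (bin i @ [3]) + 1"
      using set_bin[of i] by (intro sz_symts) auto
    ultimately have szo: "sz (lst ?os) \<le> sz (lst os) + 6 * (I + 1)"
      using length_bin_le[of i] i by simp
    show "ok N OUTBODY (Nd acc (Nd e ?v)) \<and> sz (eval OUTBODY (Nd acc (Nd e ?v))) \<le> N - 1 \<and>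
      (\<exists>os h' ds. eval OUTBODY (Nd acc (Nd e ?v)) = Nd (lst os) (hist_tree h') \<and> es' = map num ds \<and>
      mset (map fst h') = mset ds \<and> (\<forall>x\<in>set h'. snd x \<le> I) \<and> sz (hist_tree h') \<le> sz (hist_tree h) \<and>
      sz (lst os) + 6 * (I + 1) * length ds \<le> Q)"
    proof (intro conjI)
      have "ok N BIN (num i)" using N i by (intro ok_BIN) simp
      moreover have "sz (lst (map symt (bin i))) + sz (lst os) \<le> N"
      proof -
        have "set (bin i) \<subseteq> {1, 2, 3}" using set_bin[of i] by auto
        from sz_symts[OF this] length_bin_le[of i] i d(7) N show ?thesis unfolding Q_def by simp
      qed
      moreover have "sz (hist_tree h') + 2 \<le> N" using d(6) N by simp
      ultimately show "ok N OUTBODY (Nd acc (Nd e ?v))"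
        unfolding d(1,2) by (auto simp: tj(1) EMIT_def taken_tree_def intro!: ok_TAKEJ ok_REVAPP)
      show "sz (eval OUTBODY (Nd acc (Nd e ?v))) \<le> N - 1"
        unfolding d(1,2) eval_OUTBODY[OF tj(1)] using szo szk d(6,7) N unfolding Q_def by simp
      show "\<exists>os h' ds. eval OUTBODY (Nd acc (Nd e ?v)) = Nd (lst os) (hist_tree h') \<and> es' = map num ds \<and>
      mset (map fst h') = mset ds \<and> (\<forall>x\<in>set h'. snd x \<le> I) \<and> sz (hist_tree h') \<le> sz (hist_tree h) \<and>
      sz (lst os) + 6 * (I + 1) * length ds \<le> Q"
        unfolding d(1,2) eval_OUTBODY[OF tj(1)]
        using szo szk d tj(2) set_h' by (intro exI[of _ ?os] exI[of _ kept] exI[of _ ds]) auto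
    qed
  qed
  obtain h' where fin: "foldl ?F (Nd Lf (hist_tree h)) (map num p) =
    Nd (lst (rev (map symt (out_syms (assign p h))))) (hist_tree h')"
    using eval_OUT_fold[OF h, of ?v "[]"] by auto
  have "sz (foldl ?F (Nd Lf (hist_tree h)) (map num p)) \<le> N - 1"
    using fold_ok_sz[OF fo, of "N - 1"] N by simp
  then have "ok N REVAPP (Nd (lst (rev (map symt (out_syms (assign p h))))) Lf)"
    unfolding fin by (intro ok_REVAPP) simp
  moreover have "fold_ok N (ok N OUTBODY) (eval OUTBODY) ?v (Nd Lf (hist_tree h)) (map num p)"
    by (rule fold_ok_mono[OF _ _ fo]) auto
  ultimately show ?thesis using fin by (simp add: OUT_def nums_def)
qed

text \<open>The accumulator is \<open>(current number, finished numbers)\<close>. The first number, \<open>m\<close>, is truncated at the length of the input, because its unary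
  representation could be too long.\<close>

definition "DOUBLE = REVAPP \<diamondop> PairF (Hd \<diamondop> Hd) (REVAPP \<diamondop> PairF (Hd \<diamondop> Hd) X1)"

text \<open>Only the separator has a nonempty tail of length one, since its tree is the numeral 2.
  While no number is finished, the current one is \<open>m\<close>; subtracting from the doubled
  value its excess over the input length then yields the minimum of the two.\<close>

definition "PARSEBODY = Cond (Tl \<diamondop> X1) (PairF LfC Hd)
   (PairF (Cond (Tl \<diamondop> Hd) DOUBLE (DROP \<diamondop> PairF DOUBLE (DROP \<diamondop> PairF DOUBLE T2))) (Tl \<diamondop> Hd))"

definition "PARSE = REVAPP \<diamondop> PairF (Fold IdF (PairF LfC LfC) PARSEBODY) LfC"

lemma eval_DOUBLE: "eval DOUBLE (Nd (Nd (num c) d) (Nd (num b) v)) = num (2 * c + b)"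
  by (simp add: DOUBLE_def)

lemma ok_DOUBLE: "4 * c + 2 * b + 2 \<le> N \<Longrightarrow> ok N DOUBLE (Nd (Nd (num c) d) (Nd (num b) v))"
  by (auto simp: DOUBLE_def intro!: ok_REVAPP)

lemma eval_PARSEBODY_bit:
  assumes "b \<le> 1"
  shows "eval PARSEBODY (Nd (Nd (num c) d) (Nd (symt (b + 1)) v)) =
    Nd (num (if d = Lf then min (2 * c + b) (length (elems v)) else 2 * c + b)) d"
proof -
  have "tl_tree (num b) = Lf" using assms by (cases b) auto
  then show ?thesis
    by (simp add: PARSEBODY_def symt_def eval_DOUBLE min_def del: num_simps)
qed

lemma eval_PARSEBODY_sep:
  "eval PARSEBODY (Nd (Nd (num c) d) (Nd (symt 3) v)) = Nd Lf (Nd (num c) d)"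
  by (simp add: PARSEBODY_def symt_def eval_nat_numeral)

lemma ok_PARSEBODY_bit:
  assumes "b \<le> 1" "4 * c + 2 * b + 2 \<le> N" "sz v \<le> N"
  shows "ok N PARSEBODY (Nd (Nd (num c) d) (Nd (symt (b + 1)) v))"
  using assms by (auto simp: PARSEBODY_def symt_def eval_DOUBLE intro!: ok_DOUBLE ok_DROP)

lemma ok_PARSEBODY_sep: "ok N PARSEBODY (Nd (Nd (num c) d) (Nd (symt 3) v))"
  by (simp add: PARSEBODY_def symt_def eval_nat_numeral)

lemma fold_ok_append:
  "fold_ok N P F v acc (xs @ ys) \<longleftrightarrow> fold_ok N P F v acc xs \<and>
    fold_ok N P F v (foldl (\<lambda>acc e. F (Nd acc (Nd e v))) acc xs) ys"
  by (induction xs arbitrary: acc) (auto simp: Let_def)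

lemma parse_bits:
  assumes "sz v \<le> N" "d = Lf \<Longrightarrow> 2 * length (elems v) \<le> Q" "d \<noteq> Lf \<Longrightarrow> x \<le> Q"
    and N: "4 * Q + sz d + 4 \<le> N"
  shows "foldl (\<lambda>acc e. eval PARSEBODY (Nd acc (Nd e v))) (Nd Lf d) (map symt (bin x)) =
      Nd (num (if d = Lf then min x (length (elems v)) else x)) d \<and>
    fold_ok N (ok N PARSEBODY) (eval PARSEBODY) v (Nd Lf d) (map symt (bin x))"
  using assms(3)
proof (induction x rule: less_induct)
  case (less x)
  show ?case
  proof (cases "x = 0")
    case True
    then show ?thesis by (simp add: bin.simps)
  next
    case False
    let ?c = "if d = Lf then min (x div 2) (length (elems v)) else x div 2"
    have lt: "x div 2 < x" using False by simp
    have pr: "d \<noteq> Lf \<Longrightarrow> x div 2 \<le> Q" using less.prems by (meson div_le_dividend le_trans)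
    have IH: "foldl (\<lambda>acc e. eval PARSEBODY (Nd acc (Nd e v))) (Nd Lf d) (map symt (bin (x div 2))) = Nd (num ?c) d"
      "fold_ok N (ok N PARSEBODY) (eval PARSEBODY) v (Nd Lf d) (map symt (bin (x div 2)))"
      using less.IH[OF lt pr] by blast+
    have b: "bin x = bin (x div 2) @ [x mod 2 + 1]" using False by (subst bin.simps) simp
    have ev: "eval PARSEBODY (Nd (Nd (num ?c) d) (Nd (symt (x mod 2 + 1)) v)) =
        Nd (num (if d = Lf then min (2 * ?c + x mod 2) (length (elems v)) else 2 * ?c + x mod 2)) d"
      by (rule eval_PARSEBODY_bit) simp
    \<comment> \<open>Cutting off after every bit has the same effect as cutting off once, because
      doubling a value that has reached the input length cannot bring it below that length
      again.\<close>
    have eq: "(if d = Lf then min (2 * ?c + x mod 2) (length (elems v)) else 2 * ?c + x mod 2) =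
        (if d = Lf then min x (length (elems v)) else x)"
      by (auto simp: min_def)
    have cQ: "2 * ?c \<le> Q" "x mod 2 \<le> 1" using assms(2) less.prems by (cases "d = Lf"; simp)+
    then have "ok N PARSEBODY (Nd (Nd (num ?c) d) (Nd (symt (x mod 2 + 1)) v))"
      using N assms(1) by (intro ok_PARSEBODY_bit) auto
    moreover have "(if d = Lf then min x (length (elems v)) else x) \<le> Q"
      using assms(2) less.prems by (auto simp: min_def)
    then have "sz (Nd (num (if d = Lf then min x (length (elems v)) else x)) d) \<le> N"
      using N by simp
    ultimately show ?thesis
      unfolding b map_append foldl_append fold_ok_append using IH ev unfolding eq by (simp add: Let_def)
  qed
qed

lemma parse_jobs:
  assumes "sz v \<le> N" "\<And>x. x \<in> set p \<Longrightarrow> x \<le> Q" "c \<le> Q"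
    and N: "6 * Q + sz d + length p * (2 * Q + 2) + 10 \<le> N"
  shows "\<exists>c' d'. foldl (\<lambda>acc e. eval PARSEBODY (Nd acc (Nd e v))) (Nd (num c) d) (map symt (concat (map (\<lambda>x. 3 # bin x) p))) =
      Nd c' d' \<and> elems (Nd c' d') = rev (map num (c # p)) @ elems d \<and>
    fold_ok N (ok N PARSEBODY) (eval PARSEBODY) v (Nd (num c) d) (map symt (concat (map (\<lambda>x. 3 # bin x) p)))"
  using assms(2-)
proof (induction p arbitrary: c d)
  case (Cons x p)
  let ?d = "Nd (num c) d"
  let ?F = "\<lambda>acc e. eval PARSEBODY (Nd acc (Nd e v))"
  have szd: "sz ?d \<le> sz d + (2 * Q + 2)" using Cons.prems(2) by simp
  have N': "6 * Q + sz ?d + length p * (2 * Q + 2) + 10 \<le> N"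
    using Cons.prems(3) szd by (simp add: algebra_simps)
  have bits: "foldl ?F (Nd Lf ?d) (map symt (bin x)) = Nd (num x) ?d"
    "fold_ok N (ok N PARSEBODY) (eval PARSEBODY) v (Nd Lf ?d) (map symt (bin x))"
    using parse_bits[OF assms(1), of ?d Q x] Cons.prems(1) N' by auto
  obtain c' d' where IH: "foldl ?F (Nd (num x) ?d) (map symt (concat (map (\<lambda>x. 3 # bin x) p))) = Nd c' d'"
    "elems (Nd c' d') = rev (map num (x # p)) @ elems ?d"
    "fold_ok N (ok N PARSEBODY) (eval PARSEBODY) v (Nd (num x) ?d) (map symt (concat (map (\<lambda>x. 3 # bin x) p)))"
    using Cons.IH[OF _ _ N', of x] Cons.prems(1) by auto
  have sep: "?F (Nd (num c) d) (symt 3) = Nd Lf ?d" by (rule eval_PARSEBODY_sep)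
  have "fold_ok N (ok N PARSEBODY) (eval PARSEBODY) v (Nd (num c) d)
      (symt 3 # map symt (bin x) @ map symt (concat (map (\<lambda>x. 3 # bin x) p)))"
    unfolding fold_ok.simps Let_def sep fold_ok_append bits(1)
    using bits(2) IH(3) N' ok_PARSEBODY_sep by simp
  moreover have "foldl ?F (Nd (num c) d) (symt 3 # map symt (bin x) @ map symt (concat (map (\<lambda>x. 3 # bin x) p))) = Nd c' d'"
    unfolding foldl_Cons sep foldl_append bits(1) IH(1) ..
  ultimately show ?case using IH(2) by (intro exI[of _ c'] exI[of _ d']) simp
qed simp

lemma eval_ok_PARSE:
  fixes m :: nat and p :: "nat list"
  defines "w \<equiv> encode_instance m p"
  assumes Q: "\<And>x. x \<in> set p \<Longrightarrow> x \<le> Q" "2 * length w \<le> Q"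
    and N: "6 * Q + (length p + 1) * (2 * Q + 2) + sz (lst (map symt w)) + 12 \<le> N"
  shows "eval PARSE (lst (map symt w)) = Nd (num (min m (length w))) (nums p)"
    "ok N PARSE (lst (map symt w))"
proof -
  let ?v = "lst (map symt w)" and ?M = "min m (length w)"
  let ?F = "\<lambda>acc e. eval PARSEBODY (Nd acc (Nd e ?v))"
  have bits: "foldl ?F (Nd Lf Lf) (map symt (bin m)) = Nd (num ?M) Lf"
    "fold_ok (N - 1) (ok (N - 1) PARSEBODY) (eval PARSEBODY) ?v (Nd Lf Lf) (map symt (bin m))"
    using parse_bits[of ?v "N - 1" Lf Q m] Q(2) N by auto
  have MQ: "?M \<le> Q" using Q(2) by simp
  have s1: "sz ?v \<le> N - 1" using N by simp
  have s2: "6 * Q + sz Lf + length p * (2 * Q + 2) + 10 \<le> N - 1" using N by (simp add: algebra_simps)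
  obtain c' d' where jobs: "foldl ?F (Nd (num ?M) Lf) (map symt (concat (map (\<lambda>x. 3 # bin x) p))) = Nd c' d'"
    "elems (Nd c' d') = rev (map num (?M # p)) @ elems Lf"
    "fold_ok (N - 1) (ok (N - 1) PARSEBODY) (eval PARSEBODY) ?v (Nd (num ?M) Lf) (map symt (concat (map (\<lambda>x. 3 # bin x) p)))"
    using parse_jobs[OF s1 Q(1) MQ s2] by blast
  have w: "map symt w = map symt (bin m) @ map symt (concat (map (\<lambda>x. 3 # bin x) p))"
    unfolding w_def encode_instance_def by simp
  have fo: "fold_ok (N - 1) (ok (N - 1) PARSEBODY) (eval PARSEBODY) ?v (Nd Lf Lf) (map symt w)"
    unfolding w fold_ok_append bits(1)[unfolded w] using bits(2) jobs(3) unfolding w by simp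
  have fin: "foldl ?F (Nd Lf Lf) (map symt w) = Nd c' d'"
    using bits(1) jobs(1) unfolding w foldl_append by simp
  have cd: "Nd c' d' = lst (rev (map num (?M # p)))"
    using jobs(2) by (metis append_Nil2 elems.simps(1) lst_elems)
  show "eval PARSE ?v = Nd (num ?M) (nums p)"
    using fin cd by (simp add: PARSE_def nums_def)
  have "sz (Nd c' d') \<le> N - 1"
    using fold_ok_sz[OF fo, of "N - 1"] N unfolding fin by simp
  then have "ok N REVAPP (Nd (Nd c' d') Lf)" using N by (intro ok_REVAPP) simp
  moreover have "fold_ok N (ok N PARSEBODY) (eval PARSEBODY) ?v (Nd Lf Lf) (map symt w)"
    by (rule fold_ok_mono[OF _ _ fo]) (auto intro: ok_mono[of "N - 1" N])
  ultimately show "ok N PARSE ?v" using fin by (simp add: PARSE_def)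
qed

section \<open>Computing the window width\<close>

definition "PMAX = Fold IdF LfC (MAXN \<diamondop> PairF Hd X1)"

lemma foldl_max: "foldl max a p = Max (insert (a::nat) (set p))"
proof (induction p arbitrary: a)
  case (Cons x p)
  have "Max (insert a (set (x # p))) = max a (Max (insert x (set p)))" by (simp add: Max_insert)
  moreover have "Max (insert (max a x) (set p)) = max a (Max (insert x (set p)))"
    by (cases "set p = {}") (simp_all add: max.assoc)
  ultimately show ?case using Cons by simp
qed simp

lemma eval_PMAX [simp]: "eval PMAX (nums p) = num (pmax p)"
proof -
  have "foldl (\<lambda>acc e. eval MAXN (Nd acc e)) (num a) (map num p) = num (foldl max a p)" for a
    by (induction p arbitrary: a) auto
  from this[of 0] show ?thesis by (simp add: PMAX_def nums_def pmax_def foldl_max)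
qed

lemma le_pmax: "x \<in> set p \<Longrightarrow> x \<le> pmax p"
  unfolding pmax_def by (intro Max_ge) auto

lemma ok_PMAX: "4 * pmax p + 2 \<le> N \<Longrightarrow> ok N PMAX (nums p)"
proof -
  assume N: "4 * pmax p + 2 \<le> N"
  have "fold_ok N (ok N (MAXN \<diamondop> PairF Hd X1)) (eval (MAXN \<diamondop> PairF Hd X1)) (nums p) Lf (map num p)"
  proof (rule fold_okI[where I = "\<lambda>acc es. \<exists>a\<le>pmax p. acc = num a"])
    fix acc e and es' :: "tree list"
    assume "e \<in> set (map num p)" "\<exists>a\<le>pmax p. acc = num a"
    then obtain a x where "a \<le> pmax p" "acc = num a" "x \<le> pmax p" "e = num x" using le_pmax by auto
    then show "ok N (MAXN \<diamondop> PairF Hd X1) (Nd acc (Nd e (nums p))) \<and>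
       sz (eval (MAXN \<diamondop> PairF Hd X1) (Nd acc (Nd e (nums p)))) \<le> N \<and>
       (\<exists>a\<le>pmax p. eval (MAXN \<diamondop> PairF Hd X1) (Nd acc (Nd e (nums p))) = num a)"
      using N by (auto intro!: ok_MAXN simp: max_def)
  qed (auto intro!: exI[of _ 0])
  then show ?thesis by (simp add: PMAX_def nums_def)
qed

definition "GAP = REVAPP \<diamondop> PairF (MUL \<diamondop> PairF (MUL \<diamondop> PairF IdF IdF) IdF) (PairF LfC IdF)"

text \<open>Read from right to left: \<open>P\<close> becomes \<open>(gap, P)\<close>, then
  \<open>(rows_bound, (gap, P))\<close>, and from these three numbers the width is computed.\<close>

definition "WINDOW =
  REVAPP \<diamondop> PairF (MUL \<diamondop> PairF (PairF LfC T2) (REVAPP \<diamondop> PairF (MUL \<diamondop> PairF (MUL \<diamondop> PairF Hd Hd) X1) X1)) T2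
  \<diamondop> PairF (POW \<diamondop> PairF (PairF LfC Hd) Tl) IdF
  \<diamondop> PairF GAP IdF"

lemma eval_GAP [simp]: "eval GAP (num P) = num (gap P)"
proof -
  have "Nd Lf (num P) = num (Suc P)" by simp
  then show ?thesis by (simp add: GAP_def gap_def del: num_simps)
qed

lemma eval_WINDOW [simp]: "eval WINDOW (num P) = num (window P)"
proof -
  have s: "Nd Lf (num n) = num (n + 1)" for n by simp
  show ?thesis
    unfolding WINDOW_def by (simp add: s window_def rows_bound_def del: num_simps)
qed

lemma ok_WINDOW:
  assumes "4 * window P + 2 * rows_bound P + 2 * (P * P) + 10 \<le> N"
  shows "ok N WINDOW (num P)"
proof -
  have s: "Nd Lf (num n) = num (Suc n)" for n by simp
  define K g where "K = rows_bound P" and "g = gap P"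
  have pw: "Suc g ^ P = K" unfolding K_def g_def rows_bound_def by simp
  have g: "P * P * P \<le> g" "P + 1 \<le> g" unfolding g_def gap_def by auto
  have W: "(P + 1) * (K * K * g + g) + P = window P" unfolding window_def K_def g_def ..
  have KK: "K * K \<le> K * K * g" using g(2) by simp
  have N: "4 * window P + 2 * K + 2 * (P * P) + 10 \<le> N" using assms unfolding K_def .
  have gw: "g \<le> window P" using W by simp
  have 1: "ok N GAP (num P)"
    unfolding GAP_def using N g gw
    by (auto simp: s simp del: num_simps intro!: ok_REVAPP ok_MUL)
  have 2: "ok N POW (Nd (num (Suc g)) (num P))"
    using N pw by (intro ok_POW) auto
  have "K * K * g \<le> window P" using W by simp
  then have 3: "2 * (K * K) + 2 \<le> N" using KK N by linarith
  show ?thesis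
    unfolding WINDOW_def using N 1 2 3 W gw
    by (auto simp: s pw g_def[symmetric] simp del: num_simps intro!: ok_REVAPP ok_MUL)
qed

text \<open>The parsed pair \<open>(M, p)\<close> is extended to the context
  \<open>(E, (M, p))\<close> with \<open>E\<close> computed from \<open>p\<close>; hence one program
  serves all values of the parameter.\<close>

definition "MAIN = OUT \<diamondop> PairF (Tl \<diamondop> BEST \<diamondop> LAYERS) T2 \<diamondop> PairF (WINDOW \<diamondop> PMAX \<diamondop> Tl) IdF \<diamondop> PARSE"

lemma tl_cand_tree [simp]: "tl_tree (cand_tree c) = hist_tree (snd c)"
  by (simp add: cand_tree_def)

lemma eval_MAIN:
  fixes m :: nat and p :: "nat list"
  defines "w \<equiv> encode_instance m p"
  defines "L \<equiv> layer (window (pmax p)) p (min m (length w)) (length p)"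
  assumes parse: "eval PARSE (lst (map symt w)) = Nd (num (min m (length w))) (nums p)"
    and L: "L \<noteq> []" "mset (map fst (snd (best L))) = mset p"
  shows "eval MAIN (lst (map symt w)) = lst (map symt (out_syms (assign p (snd (best L)))))"
proof -
  let ?ctx = "context_tree (window (pmax p)) (min m (length w)) p"
  have c: "Nd (num (window (pmax p))) (Nd (num (min m (length w))) (nums p)) = ?ctx"
    by (simp add: context_tree_def)
  have t: "tl_tree (tl_tree ?ctx) = nums p" by (simp add: context_tree_def)
  show ?thesis
    using L unfolding MAIN_def by (simp add: parse c t L_def)
qed

lemma ok_MAIN:
  fixes m :: nat and p :: "nat list"
  defines "w \<equiv> encode_instance m p"
  defines "M \<equiv> min m (length w)" and "E \<equiv> window (pmax p)"
  assumes parse: "eval PARSE (lst (map symt w)) = Nd (num M) (nums p)" "ok N PARSE (lst (map symt w))"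
    and L: "layer E p M (length p) \<noteq> []" "mset (map fst (snd (best (layer E p M (length p))))) = mset p"
    and p: "ok N PMAX (nums p)" "ok N WINDOW (num (pmax p))" "ok N LAYERS (context_tree E M p)"
    and b: "sz (layer_tree (layer E p M (length p))) \<le> N"
    and o: "ok N OUT (Nd (hist_tree (snd (best (layer E p M (length p))))) (nums p))"
  shows "ok N MAIN (lst (map symt w))"
proof -
  have c: "Nd (num E) (Nd (num M) (nums p)) = context_tree E M p"
    by (simp add: context_tree_def)
  have t: "tl_tree (tl_tree (context_tree E M p)) = nums p" by (simp add: context_tree_def)
  show ?thesis
    using parse L p b o ok_BEST[OF b] unfolding MAIN_def by (simp add: c t flip: E_def)
qed

section \<open>Running time\<close>

definition fpt_bounded :: "(nat \<Rightarrow> nat \<Rightarrow> nat) \<Rightarrow> bool" where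
  "fpt_bounded g \<longleftrightarrow> (\<exists>f c. \<forall>P X. g P X \<le> f P * (X + 1) ^ c)"

lemma fpt_bounded_parameter: "fpt_bounded (\<lambda>P X. h P)"
  unfolding fpt_bounded_def by (intro exI[of _ h] exI[of _ 0]) simp

lemma fpt_bounded_input: "fpt_bounded (\<lambda>P X. X)"
  unfolding fpt_bounded_def by (intro exI[of _ "\<lambda>_. 1"] exI[of _ 1]) simp

lemma fpt_bounded_add:
  assumes "fpt_bounded g" "fpt_bounded h"
  shows "fpt_bounded (\<lambda>P X. g P X + h P X)"
proof -
  obtain f c f' c' where g: "\<And>P X. g P X \<le> f P * (X + 1) ^ c" and h: "\<And>P X. h P X \<le> f' P * (X + 1) ^ c'"
    using assms unfolding fpt_bounded_def by blast
  have "g P X + h P X \<le> (f P + f' P) * (X + 1) ^ (c + c')" for P X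
  proof -
    have "f P * (X + 1) ^ c \<le> f P * (X + 1) ^ (c + c')" "f' P * (X + 1) ^ c' \<le> f' P * (X + 1) ^ (c + c')"
      by (auto intro!: mult_le_mono2 power_increasing simp del: power_Suc)
    then show ?thesis using g[of P X] h[of P X] unfolding add_mult_distrib by linarith
  qed
  then show ?thesis unfolding fpt_bounded_def by (intro exI[of _ "\<lambda>P. f P + f' P"] exI[of _ "c + c'"]) simp
qed

lemma fpt_bounded_mult:
  assumes "fpt_bounded g" "fpt_bounded h"
  shows "fpt_bounded (\<lambda>P X. g P X * h P X)"
proof -
  obtain f c f' c' where g: "\<And>P X. g P X \<le> f P * (X + 1) ^ c" and h: "\<And>P X. h P X \<le> f' P * (X + 1) ^ c'"
    using assms unfolding fpt_bounded_def by blast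
  have "g P X * h P X \<le> (f P * f' P) * (X + 1) ^ (c + c')" for P X
    using mult_le_mono[OF g[of P X] h[of P X]] by (simp add: power_add ac_simps)
  then show ?thesis unfolding fpt_bounded_def by (intro exI[of _ "\<lambda>P. f P * f' P"] exI[of _ "c + c'"]) simp
qed

lemmas fpt_bounded_intros = fpt_bounded_parameter fpt_bounded_input fpt_bounded_add fpt_bounded_mult

lemma fpt_bounded_power: "fpt_bounded g \<Longrightarrow> fpt_bounded (\<lambda>P X. g P X ^ d)"
  by (induction d) (simp_all add: fpt_bounded_intros)

section \<open>Tree sizes in terms of the instance\<close>

lemma sum_list_linear: "(\<Sum>x\<leftarrow>xs. a * f x + b) = a * (\<Sum>x\<leftarrow>xs. f x) + b * length xs" for a b :: nat
  by (induction xs) (auto simp: algebra_simps)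

lemma sz_nums': "sz (nums xs) = 1 + 2 * sum_list xs + 2 * length xs"
  using sum_list_linear[of 2 "\<lambda>x. x" 2 xs] by (simp add: sz_nums)

lemma sz_hist_le:
  assumes "\<And>x. x \<in> set h \<Longrightarrow> snd x \<le> I"
  shows "sz (hist_tree h) \<le> 1 + 2 * sum_list (map fst h) + length h * (2 * I + 4)"
  using assms
proof (induction h)
  case (Cons x h)
  have "snd x \<le> I" "sz (hist_tree h) \<le> 1 + 2 * sum_list (map fst h) + length h * (2 * I + 4)"
    using Cons by auto
  then show ?case by simp
qed simp

definition cand_bound :: "nat \<Rightarrow> nat \<Rightarrow> nat" where
  "cand_bound S n = 8 * S + n * (2 * n + 8) + 9"

lemma sound_cand_sizes:
  assumes s: "sound_cand E p M k c" and k: "k \<le> length p"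
  shows "sz (cand_tree c) \<le> cand_bound (sum_list p) (length p)"
    "sz (hist_tree (snd c)) \<le> 1 + 2 * sum_list p + length p * (2 * length p + 4)"
    "\<And>x. x \<in> set (snd c) \<Longrightarrow> snd x \<le> length p"
    "6 * sum_list p + 2 * length p + 6 \<le> N \<Longrightarrow> cand_ok N p c"
proof -
  obtain mx l i rem h where c: "c = ((mx, l, i, rem), h)" by (metis prod.collapse)
  have f: "length h = k" "mset (map fst h) + mset rem = mset p" "i \<le> k" "l \<le> mx" "mx \<le> sum_list (map fst h)"
    "\<And>x. x \<in> set h \<Longrightarrow> snd x \<le> i"
    using s unfolding c sound_cand.simps by blast+
  have S: "sum_list (map fst h) + sum_list rem = sum_list p"
    using arg_cong[OF f(2), of sum_mset] unfolding sum_mset.union sum_mset_sum_list .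
  have n: "length h + length rem = length p"
    using arg_cong[OF f(2), of size] by simp
  have h: "x \<in> set h \<Longrightarrow> snd x \<le> length p" for x using f(3,6) k by (meson le_trans)
  then show "\<And>x. x \<in> set (snd c) \<Longrightarrow> snd x \<le> length p" unfolding c by simp
  have "length h * (2 * length p + 4) \<le> length p * (2 * length p + 4)"
    using n by (intro mult_le_mono1) simp
  then have hist: "sz (hist_tree h) \<le> 1 + 2 * sum_list (map fst h) + length p * (2 * length p + 4)"
    using sz_hist_le[of h "length p"] h by (meson add_left_mono le_trans)
  then show "sz (hist_tree (snd c)) \<le> 1 + 2 * sum_list p + length p * (2 * length p + 4)"
    unfolding c using S by simp
  have key: "sz (key_tree (mx, l, i, rem)) \<le> 6 * sum_list p + 4 * length p + 7 - 2 * sum_list (map fst h)"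
    using S f n k by (simp add: key_tree_def sz_nums')
  have "8 * sum_list p + (length p * (2 * length p + 4) + 4 * length p) + 9 = cand_bound (sum_list p) (length p)"
    unfolding cand_bound_def by (simp add: algebra_simps)
  then show "sz (cand_tree c) \<le> cand_bound (sum_list p) (length p)"
    using key hist S unfolding c cand_tree_def by simp
  show "cand_ok N p c" if N: "6 * sum_list p + 2 * length p + 6 \<le> N"
  proof -
    have "e \<le> sum_list rem" if "e \<in> set rem" for e using that by (simp add: member_le_sum_list)
    then have "2 * mx + 2 * l + 2 * e + 2 \<le> N" if "e \<in> set rem" for e
      using that S f N by fastforce
    then show ?thesis using S n N unfolding c cand_ok_def by (simp add: sz_nums')
  qed
qed

lemma sz_layer_le:
  "(\<And>c. c \<in> set L \<Longrightarrow> sz (cand_tree c) \<le> B) \<Longrightarrow> sz (layer_tree L) \<le> 1 + length L * (B + 1)"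
proof (induction L)
  case (Cons c L)
  have "sz (cand_tree c) \<le> B" "sz (layer_tree L) \<le> 1 + length L * (B + 1)" using Cons by auto
  then show ?case by simp
qed simp

text \<open>A number with \<open>b\<close> binary digits is at least 2 to the power
  \<open>b - 1\<close>, because its leading digit is nonzero.\<close>

lemma length_bin_log: "1 \<le> m \<Longrightarrow> length (bin m) \<le> nat \<lceil>log 2 (real m)\<rceil> + 1"
proof -
  assume m: "1 \<le> m"
  have "2 ^ (length (bin m) - 1) \<le> m"
    using m
  proof (induction m rule: less_induct)
    case (less m)
    show ?case
    proof (cases "m = 1")
      case True
      then show ?thesis by (simp add: bin.simps)
    next
      case False
      then have h: "1 \<le> m div 2" "m div 2 < m" using less.prems by auto
      have len: "length (bin m) = length (bin (m div 2)) + 1" using less.prems by (subst bin.simps) simp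
      have "bin (m div 2) \<noteq> []" using h by (subst bin.simps) simp
      then have "length (bin m) - 1 = Suc (length (bin (m div 2)) - 1)" using len by (cases "bin (m div 2)") auto
      then have "2 ^ (length (bin m) - 1) = 2 * 2 ^ (length (bin (m div 2)) - 1)" by simp
      also have "\<dots> \<le> 2 * (m div 2)" using less.IH[OF h(2,1)] by simp
      finally show ?thesis by linarith
    qed
  qed
  then have "real (2 ^ (length (bin m) - 1)) \<le> real m" by (simp only: of_nat_le_iff)
  then have "2 powr real (length (bin m) - 1) \<le> real m" by (simp add: powr_realpow)
  then have "real (length (bin m) - 1) \<le> log 2 (real m)" using m by (simp add: le_log_iff)
  then show ?thesis by linarith
qed

text \<open>The crude bound of \<open>x\<close> digits for a job of size \<open>x\<close> is good
  enough, as job sizes may enter the running time through an arbitrary function.\<close>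

lemma length_encode_instance:
  assumes "1 \<le> m" "\<And>x. x \<in> set p \<Longrightarrow> x \<le> P"
  shows "length (encode_instance m p) \<le> nat \<lceil>log 2 (real m)\<rceil> + 1 + length p * (P + 1)"
proof -
  have "length (concat (map (\<lambda>x. 3 # bin x) p)) \<le> length p * (P + 1)"
    using assms(2)
  proof (induction p)
    case (Cons x p)
    have "length (bin x) \<le> P" using length_bin_le[of x] Cons.prems[of x] by simp
    moreover have "length (concat (map (\<lambda>x. 3 # bin x) p)) \<le> length p * (P + 1)" using Cons by simp
    ultimately show ?case by simp
  qed simp
  then show ?thesis unfolding encode_instance_def using length_bin_log[OF assms(1)] by simp
qed

lemma set_encode_instance: "set (encode_instance m p) \<subseteq> {1, 2, 3}"
  unfolding encode_instance_def by (auto dest!: subsetD[OF set_bin])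

lemma set_out_syms: "set (out_syms is) \<subseteq> {1, 2, 3}"
  unfolding out_syms_def by (auto dest!: subsetD[OF set_bin])

lemma out_syms_encode: "length is = n \<Longrightarrow> out_syms is = encode_schedule n (\<lambda>j. is ! j)"
proof -
  assume "length is = n"
  then have "map (\<lambda>i. bin i @ [3]) is = map (\<lambda>j. bin (is ! j) @ [3]) [0..<n]"
    by (intro nth_equalityI) auto
  then show ?thesis unfolding out_syms_def encode_schedule_def by simp
qed

text \<open>\<open>X\<close> stands for the number of jobs plus the logarithm of \<open>m\<close>.\<close>

definition size_bound :: "nat \<Rightarrow> nat \<Rightarrow> nat" where
  "size_bound P X = (let S = X * P; W = X + 1 + X * (P + 1); Q = P + 2 * W in
     (1 + layer_bound P (window P) S X * (cand_bound S X + 1)) +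
     (2 * (X * X) + 2 * (window P * X) + 2 * X + 4) + (2 * W + 1) +
     (6 * S + 2 * X + 6) + (4 * P + 2) + (4 * window P + 2 * rows_bound P + 2 * (P * P) + 10) +
     (6 * Q + (X + 1) * (2 * Q + 2) + (6 * W + 1) + 12) +
     (6 * (X + 1) * X + 6 * X + (1 + 2 * S + X * (2 * X + 4)) + 10))"

text \<open>Subterms without \<open>X\<close>, in particular \<open>(P * window P + 1) ^ P\<close>,
  count as parameters; the rest is built from \<open>X\<close> by sums and products.\<close>

lemma fpt_bounded_size: "fpt_bounded size_bound"
proof -
  have "fpt_bounded (\<lambda>P X. size_bound P X)"
    unfolding size_bound_def Let_def layer_bound_def cand_bound_def
    by (intro fpt_bounded_intros)
  then show ?thesis .
qed

lemma layer_bound_mono: "S \<le> S' \<Longrightarrow> n \<le> n' \<Longrightarrow> layer_bound P E S n \<le> layer_bound P E S' n'"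
  unfolding layer_bound_def by (intro mult_le_mono add_mono) auto

lemma cand_bound_mono: "S \<le> S' \<Longrightarrow> n \<le> n' \<Longrightarrow> cand_bound S n \<le> cand_bound S' n'"
  unfolding cand_bound_def by (intro add_mono mult_le_mono) auto

lemma program_correct:
  assumes inst: "valid_instance m p"
  defines "X \<equiv> length p + nat \<lceil>log 2 (real m)\<rceil>" and "w \<equiv> encode_instance m p"
  obtains qs where "length qs = length p" "optimal_schedule m p (\<lambda>j. qs ! j)"
    "eval MAIN (lst (map symt w)) = lst (map symt (out_syms qs))"
    "sz (lst (map symt w)) \<le> size_bound (pmax p) X"
    "ok (size_bound (pmax p) X) MAIN (lst (map symt w))"
proof -
  define P E M n where "P = pmax p" and "E = window P" and "M = min m (length w)" and "n = length p"
  define S W Q where "S = X * P" and "W = X + 1 + X * (P + 1)" and "Q = P + 2 * W"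
  define N where "N = size_bound P X"
  define L where "L = layer E p M n"
  define h where "h = snd (best L)"
  have m: "1 \<le> m" and p0: "\<forall>x\<in>set p. 0 < x" using inst unfolding valid_instance_def by auto
  have pP: "set p \<subseteq> {1..P}" using p0 le_pmax unfolding P_def by (auto simp: Suc_le_eq)
  have nX: "n \<le> X" unfolding X_def n_def by simp
  have w1: "1 \<le> length w" "n \<le> length w"
  proof -
    have "bin m \<noteq> []" using m by (subst bin.simps) simp
    then show "1 \<le> length w" unfolding w_def encode_instance_def by (cases "bin m") auto
    have "length p \<le> length (concat (map (\<lambda>x. 3 # bin x) p))" by (induction p) auto
    then show "n \<le> length w" unfolding w_def encode_instance_def n_def by simp
  qed
  have wW: "length w \<le> W"
  proof -
    have "length w \<le> nat \<lceil>log 2 (real m)\<rceil> + 1 + n * (P + 1)"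
      unfolding w_def n_def P_def by (rule length_encode_instance[OF m le_pmax])
    moreover have "n * (P + 1) \<le> X * (P + 1)" using nX by (rule mult_le_mono1)
    ultimately show ?thesis unfolding W_def X_def by linarith
  qed
  have "sum_list p \<le> (\<Sum>x\<leftarrow>p. P)" using sum_list_mono[of p "\<lambda>x. x" "\<lambda>_. P"] le_pmax unfolding P_def by simp
  then have sumS: "sum_list p \<le> S"
  proof -
    have "sum_list p \<le> n * P" using \<open>sum_list p \<le> (\<Sum>x\<leftarrow>p. P)\<close> by (simp add: sum_list_triv n_def)
    also have "\<dots> \<le> S" unfolding S_def using nX by (rule mult_le_mono1)
    finally show ?thesis .
  qed
  have M: "0 < M" "M \<le> W" using m w1 wW unfolding M_def by auto
  have N: "1 + layer_bound P E S X * (cand_bound S X + 1) \<le> N"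
    "2 * (X * X) + 2 * (E * X) + 2 * X + 4 \<le> N" "2 * W + 1 \<le> N"
    "6 * S + 2 * X + 6 \<le> N" "4 * P + 2 \<le> N" "4 * E + 2 * rows_bound P + 2 * (P * P) + 10 \<le> N"
    "6 * Q + (X + 1) * (2 * Q + 2) + (6 * W + 1) + 12 \<le> N"
    "6 * (X + 1) * X + 6 * X + (1 + 2 * S + X * (2 * X + 4)) + 10 \<le> N"
    unfolding N_def size_bound_def Let_def S_def[symmetric] W_def[symmetric] Q_def[symmetric] E_def[symmetric]
    by linarith+
  \<comment> \<open>The cut-off for the number of machines is the length of the input, which is
    positive and at least the number of jobs.\<close>
  have opt: "optimal_schedule m p (\<lambda>j. assign p h ! j)" "length (assign p h) = length p" "L \<noteq> []"
    "mset (map fst h) = mset p"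
    using search_optimal[OF inst pP, of "length w"] w1 unfolding h_def L_def E_def M_def n_def by auto
  have len_layer: "length (layer E p M k) \<le> layer_bound P E S X" if "k \<le> n" for k
  \<comment> \<open>The count of the keys divides by the number of jobs, so the instance without
    jobs, whose only layer is the initial one, is treated apart.\<close>
  proof (cases "p = []")
    case True
    then have "k = 0" using that unfolding n_def by simp
    then show ?thesis by (simp add: layer_0 layer_bound_def Suc_le_eq)
  next
    case False
    then show ?thesis
      using length_layer[OF pP False M(1), of k E] layer_bound_mono[OF sumS, of "length p" X P E] that nX
      unfolding n_def by simp
  qed
  have sound: "sound_cand E p M k c" if "c \<in> set (layer E p M k)" for c k
    using sound_layer[OF M(1) that] .
  have "sz (cand_tree c) \<le> cand_bound S X" if "c \<in> set (layer E p M k)" "k \<le> n" for c k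
    using sound_cand_sizes(1)[OF sound[OF that(1)]] cand_bound_mono[OF sumS, of "length p" X] that(2) nX
    unfolding n_def by simp
  then have sz_layer: "sz (layer_tree (layer E p M k)) \<le> N" if k: "k \<le> n" for k
    using sz_layer_le[of "layer E p M k" "cand_bound S X"] mult_le_mono1[OF len_layer[OF k], of "cand_bound S X + 1"] N(1) k
    by fastforce
  have mono: "n * n \<le> X * X" "E * n \<le> E * X" "n * (2 * n + 4) \<le> X * (2 * X + 4)"
    "6 * (n + 1) * n \<le> 6 * (X + 1) * X" "(n + 1) * (2 * Q + 2) \<le> (X + 1) * (2 * Q + 2)"
    by (intro mult_le_mono add_mono nX order_refl)+
  have params: "params_ok N E M p"
    unfolding params_ok_def n_def[symmetric] using N(2,3) mono(1,2) nX M(2) by linarith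
  have cok: "cand_ok N p c" if "c \<in> set (layer E p M k)" "k < n" for c k
    using sound_cand_sizes(4)[OF sound[OF that(1)], of N] that(2) N(4) sumS nX unfolding n_def by simp
  have layers: "ok N LAYERS (context_tree E M p)"
    by (rule ok_LAYERS[OF params]) (use cok sz_layer in \<open>auto simp: n_def\<close>)
  have QQ: "x \<le> Q" if "x \<in> set p" for x using le_pmax[OF that] unfolding Q_def P_def by simp
  have Q2: "2 * length w \<le> Q" using wW unfolding Q_def by simp
  have szw: "sz (lst (map symt w)) \<le> 6 * W + 1"
    using sz_symts[of w] set_encode_instance wW unfolding w_def by fastforce
  have Np: "6 * Q + (length p + 1) * (2 * Q + 2) + sz (lst (map symt w)) + 12 \<le> N"
    using N(7) mono(5) szw unfolding n_def by linarith
  note parse = eval_ok_PARSE[OF QQ Q2[unfolded w_def] Np[unfolded w_def], folded w_def, folded M_def]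
  have best: "best L \<in> set (layer E p M n)" using best_props(1)[OF opt(3)] unfolding L_def .
  note bs = sound_cand_sizes(2,3)[OF sound[OF best], folded n_def, OF order_refl, folded h_def]
  have out: "ok N OUT (Nd (hist_tree h) (nums p))"
  proof (rule ok_OUT[OF opt(4), of n])
    show "6 * (n + 1) * length p + 6 * n + sz (hist_tree h) + 10 \<le> N"
      using bs(1) N(8) mono(3,4) sumS nX unfolding n_def[symmetric] by linarith
  qed (rule bs(2))
  have "eval MAIN (lst (map symt w)) = lst (map symt (out_syms (assign p h)))"
    using eval_MAIN[of m p] parse(1) opt(3,4) unfolding h_def L_def E_def P_def M_def w_def n_def by blast
  moreover have "ok N MAIN (lst (map symt w))"
  proof -
    have "ok N PMAX (nums p)" using N(5) unfolding P_def by (rule ok_PMAX)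
    moreover have "ok N WINDOW (num (pmax p))" using N(6) unfolding P_def E_def by (rule ok_WINDOW)
    ultimately show ?thesis
      using ok_MAIN[of m p N] parse opt(3,4) layers sz_layer[OF order_refl] out
      unfolding h_def L_def E_def P_def M_def w_def n_def by blast
  qed
  moreover have "sz (lst (map symt w)) \<le> N" using Np by simp
  ultimately show ?thesis using that opt(1,2) unfolding N_def P_def by blast
qed

theorem mainTheorem2:
  shows "\<exists>(f :: nat \<Rightarrow> nat) (c :: nat) (M :: tm). wf_tm M \<and>
    (\<forall>m p. valid_instance m p \<longrightarrow>
       (\<exists>t. solves_within M m p t \<and>
            t \<le> f (pmax p) * (length p + nat \<lceil>log 2 (real m)\<rceil> + 1) ^ c))"
proof -
  obtain M C d where M: "wf_tm M" and run: "\<And>w v N. set w \<subseteq> {1, 2, 3} \<Longrightarrow> set v \<subseteq> {1, 2, 3} \<Longrightarrow>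
     eval MAIN (lst (map symt w)) = lst (map symt v) \<Longrightarrow> sz (lst (map symt w)) \<le> N \<Longrightarrow>
     ok N MAIN (lst (map symt w)) \<Longrightarrow>
     \<exists>t tape h. t \<le> C * (N + 1) ^ d \<and> tm_run M t (initial_config w) = (1, tape, h) \<and> tape_output tape v"
    using fn_turing_machine[of MAIN] by blast
  \<comment> \<open>The constants \<open>C\<close> and \<open>d\<close> belong to the machine, so a
    polynomial of this fixed degree in the size bound keeps the form of a function of
    \<open>P\<close> times a fixed power of \<open>X + 1\<close>.\<close>
  have "fpt_bounded (\<lambda>P X. C * (size_bound P X + 1) ^ d)"
    by (intro fpt_bounded_mult fpt_bounded_power fpt_bounded_add fpt_bounded_parameter)
      (rule fpt_bounded_size)
  then obtain f c where fc: "\<And>P X. C * (size_bound P X + 1) ^ d \<le> f P * (X + 1) ^ c"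
    unfolding fpt_bounded_def by blast
  have "\<exists>t. solves_within M m p t \<and> t \<le> f (pmax p) * (length p + nat \<lceil>log 2 (real m)\<rceil> + 1) ^ c"
    if inst: "valid_instance m p" for m p
  proof -
    obtain qs where s: "length qs = length p" "optimal_schedule m p (\<lambda>j. qs ! j)"
      "eval MAIN (lst (map symt (encode_instance m p))) = lst (map symt (out_syms qs))"
      "sz (lst (map symt (encode_instance m p))) \<le> size_bound (pmax p) (length p + nat \<lceil>log 2 (real m)\<rceil>)"
      "ok (size_bound (pmax p) (length p + nat \<lceil>log 2 (real m)\<rceil>)) MAIN (lst (map symt (encode_instance m p)))"
      by (rule program_correct[OF inst]) (rule that)
    obtain t tape h where t: "t \<le> C * (size_bound (pmax p) (length p + nat \<lceil>log 2 (real m)\<rceil>) + 1) ^ d"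
      "tm_run M t (initial_config (encode_instance m p)) = (1, tape, h)" "tape_output tape (out_syms qs)"
      using run[OF set_encode_instance set_out_syms s(3-5)] by blast
    have "solves_within M m p t"
      unfolding solves_within_def t(2) using s(2) t(3) out_syms_encode[OF s(1)] by auto
    then show ?thesis using t(1) fc le_trans by blast
  qed
  then show ?thesis using M by blast
qed

end
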